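(* Let $p=2$, let $\mathscr B=(\partial:\mathscr B_1\to\mathscr B_0)$ be the pair algebra of secondary cohomology operations, with $\mathscr B_1=R\oplus\Sigma\mathscr A$ and multiplication map $A:\mathscr A\otimes R\to\mathscr A$. Let $$\mathbb F\xleftarrow{\ \epsilon\ }\mathscr A\langle g_0^0\rangle\xleftarrow{\ d\ }\mathscr A\langle g_1^{2^n}\mid n\ge0\rangle\xleftarrow{\ d\ }\mathscr A\langle g_2^{2^i+2^j}\mid|i-j|\ne1\rangle\leftarrow\cdots$$ be the minimal resolution of the left $\mathscr A$-module $\mathbb F$, and let $$\mathbb G^\Sigma\xleftarrow{\ \epsilon\ }\mathscr B\langle g_0^0\rangle\xleftarrow{\ d\ }\mathscr B\langle g_1^{2^n}\mid n\ge0\rangle\xleftarrow{\ d\ }\mathscr B\langle g_2^{2^i+2^j}\mid|i-j|\ne1\rangle\leftarrow\cdots\qquad( * )$$ be the sequence of $\mathscr B$-module homomorphisms obtained from it by lifting the differentials literally to $\mathscr B_0$. Then completions of $( * )$ to an exact secondary complex are in one-to-one correspondence with families of maps $\delta_m:\mathscr A\langle g_{m+2}^*\rangle\to\Sigma\mathscr A\langle g_m^*\rangle$ satisfying $$d\,\delta g=\delta\, dg$$ for all generators $g$, where, for $a\in\mathscr A$ and $g$ a generator, $\delta(ag)$ is defined by $$\delta(ag)=a\,\delta(g)+A(a,ddg),$$ and $A(a,rg')$ for $r\in R$ and $g'$ a generator is interpreted as $A(a,r)g'$.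
   Context: **Algebra.** $\mathbb F=\mathbb Z/2$, $\mathbb G=\mathbb Z/4$, $\mathscr A$ is the mod $2$ Steenrod algebra, $(\Sigma X)^n=X^{n-1}$. $\mathscr B_0$ is the graded free associative $\mathbb G$-algebra on generators $Sq^n$ of degree $n\ge1$; $\pi:\mathscr B_0\to\mathscr A$ is the canonical surjection with kernel $R$. A pair algebra is a bimodule map $\partial:B_1\to B_0$ of graded $B_0$-bimodules ($B_0$ a graded algebra) with $\partial(x)y=x\partial(y)$. In the pair algebra $\mathscr B$ of secondary cohomology operations (which has $\pi_0\mathscr B=\operatorname{coker}\partial=\mathscr A$ and $\pi_1\mathscr B=\ker\partial=\Sigma\mathscr A$), as an abelian group $\mathscr B_1=R\oplus\Sigma\mathscr A$, i.e. $\mathscr B_1^n=R^n\oplus\mathscr A^{n-1}$, $\partial$ is the projection to $R\subset\mathscr B_0$, and the bimodule structure is $$(r,a)b=(rb,a\pi(b)),\qquad b(r,a)=(br,\ A(\pi(b),r)+\pi(b)a),$$ where $A:\mathscr A\otimes R\to\mathscr A$, the multiplication map, is the degree $-1$ map determined by this left action. **Modules.** A left $\mathscr B$-module is a $\mathscr B_0$-linear degree $0$ map $\partial:M_1\to M_0$ of graded left $\mathscr B_0$-modules with a $\mathscr B_0$-linear map $\bar\mu:\mathscr B_1\otimes_{\mathscr B_0}M_0\to M_1$ satisfying $\bar\mu(b\otimes\partial m)=\partial(b)m$ and $\partial\bar\mu(b\otimes m)=\partial(b)m$; morphisms $f=(f_0,f_1)$ consist of degree $0$ $\mathscr B_0$-linear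 maps commuting with $\partial$, $\bar\mu$. $\mathscr B\langle g\mid\cdots\rangle$ is the free $\mathscr B$-module on the listed generators: its components in levels $0$ and $1$ are $\mathscr B_0\langle g\mid\cdots\rangle$ and $\mathscr B_1\langle g\mid\cdots\rangle=(R\oplus\Sigma\mathscr A)\langle g\mid\cdots\rangle$. $\mathbb G^\Sigma=(\mathbb F\oplus\Sigma\mathbb F\to\mathbb G)$ is the $\mathscr B$-module equal to $\mathbb F\cong2\mathbb G\subset\mathbb G$ in degree $0$, to $\mathbb F\to0$ in degree $1$ and zero otherwise, with the $\mathscr B$-module structure for which the surjection $\epsilon=(\epsilon_0,\epsilon_1):\mathscr B\to\mathbb G^\Sigma$ is a morphism, where $\epsilon_0:\mathscr B_0\to\mathbb G$ is the augmentation and $\epsilon_1(r,a)=(\epsilon_0(r),\epsilon(a))\in2\mathbb G\oplus\Sigma\mathbb F$. **Resolution and its lift.** $g_m^d$ denotes a generator of the $m$-th module of the minimal resolution in degree $d$ (there may be several with the same $m,d$); $g_m^*$ stands for all generators with lower index $m$. Each value $d(g)$ is written as an $\mathbb F$-linear combination of terms (monomial in the $Sq^i$)$\cdot$(generator). Let $\chi:\mathbb F\to\mathbb G$, $\chi(0)=0,\chi(1)=1$. Applying $\chi$ to the coefficients of these expressions gives elements $d(g)\in\mathscr B_0\langle g_{m-1}^*\rangle$ for generators $g$ with lower index $m$, and so the $\mathscr B$-module morphisms $d$ in $( * )$ (on level $1$, $d((r,a)g)=(r,a)d(g)$). The composite $dd(g)$, computed in $\mathscr B_0\langle g_{m-2}^*\rangle$,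 lies in $R\langle g_{m-2}^*\rangle$; this is the element $ddg$ appearing in $A(a,ddg)$. **Secondary complexes.** A secondary chain complex consists of $\mathscr B$-modules $M_n=(\partial_n:M_{n,1}\to M_{n,0})$, morphisms $d_n:M_{n+1}\to M_n$ and degree $0$ $\mathscr B_0$-linear maps $H_n:M_{n+2,0}\to M_{n,1}$ with $d_{n,0}d_{n+1,0}=\partial_nH_n$, $d_{n,1}d_{n+1,1}=H_n\partial_{n+2}$, $H_nd_{n+2,0}=d_{n,1}H_{n+1}$. It is exact if for every $(c,\gamma)\in M_{n,0}\oplus M_{n-1,1}$ with $d_{n-1,0}c=\partial_{n-1}\gamma$, $H_{n-2}c=d_{n-2,1}\gamma$ there are $b\in M_{n+1,0}$, $\beta\in M_{n,1}$ with $c=d_{n,0}b+\partial_n\beta$, $\gamma=H_{n-1}b+d_{n-1,1}\beta$. A completion of $( * )$ to an exact secondary complex is a family of degree preserving maps $\mathscr B_0\langle g_{m+2}^*\rangle\to(R\oplus\Sigma\mathscr A)\langle g_m^*\rangle$, $m\ge0$, which, used as the maps $H_m$ (with $\mathscr B\langle g_m^*\rangle$ placed in position $m$, $\mathbb G^\Sigma$ in position $-1$, zero modules below, and $H_n=0$ for $n<0$), make $( * )$ an exact secondary complex. **Meaning of the families $\delta_m$.** $\delta_m$ ($m\ge0$) is degree preserving and is given by arbitrary values $\delta_m(g)\in\Sigma\mathscr A\langle g_m^*\rangle$ on the generators $g$ with lower index $m+2$, extended additively by the displayed formula for $\delta(ag)$. The equation $d\delta g=\delta dg$ reads $d\,\delta_m(g)=\delta_{m-1}(dg)$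 for generators $g$ with lower index $m+2$; here $dg\in\mathscr A\langle g_{m+1}^*\rangle$, $d$ on $\Sigma\mathscr A\langle g_m^*\rangle$ is induced by the differential of the minimal resolution, and for $m=0$ the left side is $\epsilon\,\delta_0(g)$ and $\delta_{-1}=0$. The correspondence sends a completion to the maps induced by its $\Sigma\mathscr A$-components. *)

theory Defs
  imports
    "HOL-Library.Poly_Mapping"
    "HOL-Library.Z2"
    "HOL-Library.Numeral_Type"
    "HOL-Library.Product_Plus"
    "HOL-Library.FuncSet"
begin

section \<open>Graded groups, pair algebras and their modules\<close>

text \<open>
  A graded abelian group is an internal direct sum: a subgroup \<open>carr\<close> of an ambient
  abelian group together with its homogeneous pieces. All gradings are indexed by the
  integers, so that a suspension is a shift without truncation.
\<close>

record 'a graded =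
  carr :: "'a set"
  piece :: "int \<Rightarrow> 'a set"

definition add_subgroup :: "'a::ab_group_add set \<Rightarrow> bool" where
  "add_subgroup S \<longleftrightarrow> 0 \<in> S \<and> (\<forall>x\<in>S. \<forall>y\<in>S. x - y \<in> S)"

definition graded_group :: "'a::ab_group_add graded \<Rightarrow> bool" where
  "graded_group X \<longleftrightarrow>
     add_subgroup (carr X) \<and>
     (\<forall>n. add_subgroup (piece X n) \<and> piece X n \<subseteq> carr X) \<and>
     (\<forall>x\<in>carr X. \<exists>!c. (\<forall>n. c n \<in> piece X n) \<and> finite {n. c n \<noteq> 0}
                        \<and> x = (\<Sum>n | c n \<noteq> 0. c n))"

definition graded_hom ::
  "'a::ab_group_add graded \<Rightarrow> 'b::ab_group_add graded \<Rightarrow> ('a \<Rightarrow> 'b) \<Rightarrow> bool" where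
  "graded_hom X Y f \<longleftrightarrow>
     (\<forall>x\<in>carr X. f x \<in> carr Y) \<and>
     (\<forall>x\<in>carr X. \<forall>y\<in>carr X. f (x + y) = f x + f y) \<and>
     (\<forall>n. \<forall>x\<in>piece X n. f x \<in> piece Y n)"

definition graded_bilinear ::
  "'a::ab_group_add graded \<Rightarrow> 'b::ab_group_add graded \<Rightarrow> 'c::ab_group_add graded
    \<Rightarrow> ('a \<Rightarrow> 'b \<Rightarrow> 'c) \<Rightarrow> bool" where
  "graded_bilinear X Y Z f \<longleftrightarrow>
     (\<forall>x\<in>carr X. \<forall>y\<in>carr Y. f x y \<in> carr Z) \<and>
     (\<forall>x\<in>carr X. \<forall>x'\<in>carr X. \<forall>y\<in>carr Y. f (x + x') y = f x y + f x' y) \<and>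
     (\<forall>x\<in>carr X. \<forall>y\<in>carr Y. \<forall>y'\<in>carr Y. f x (y + y') = f x y + f x y') \<and>
     (\<forall>m n. \<forall>x\<in>piece X m. \<forall>y\<in>piece Y n. f x y \<in> piece Z (m + n))"

definition graded_ring :: "'r::ring_1 graded \<Rightarrow> bool" where
  "graded_ring R \<longleftrightarrow> graded_group R \<and> 1 \<in> piece R 0 \<and> graded_bilinear R R R (*)"

definition graded_left_module ::
  "'r::ring_1 graded \<Rightarrow> 'x::ab_group_add graded \<Rightarrow> ('r \<Rightarrow> 'x \<Rightarrow> 'x) \<Rightarrow> bool" where
  "graded_left_module R X s \<longleftrightarrow>
     graded_group X \<and> graded_bilinear R X X s \<and>
     (\<forall>x\<in>carr X. s 1 x = x) \<and>
     (\<forall>a\<in>carr R. \<forall>b\<in>carr R. \<forall>x\<in>carr X. s (a * b) x = s a (s b x))"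

definition graded_right_module ::
  "'r::ring_1 graded \<Rightarrow> 'x::ab_group_add graded \<Rightarrow> ('x \<Rightarrow> 'r \<Rightarrow> 'x) \<Rightarrow> bool" where
  "graded_right_module R X t \<longleftrightarrow>
     graded_group X \<and> graded_bilinear X R X t \<and>
     (\<forall>x\<in>carr X. t x 1 = x) \<and>
     (\<forall>a\<in>carr R. \<forall>b\<in>carr R. \<forall>x\<in>carr X. t x (a * b) = t (t x a) b)"

definition left_linear ::
  "'r graded \<Rightarrow> 'x graded \<Rightarrow> ('r \<Rightarrow> 'x \<Rightarrow> 'x) \<Rightarrow> ('r \<Rightarrow> 'y \<Rightarrow> 'y) \<Rightarrow> ('x \<Rightarrow> 'y) \<Rightarrow> bool" where
  "left_linear R X s s' f \<longleftrightarrow> (\<forall>b\<in>carr R. \<forall>x\<in>carr X. f (s b x) = s' b (f x))"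

record ('r, 'b) pair_alg =
  lev0 :: "'r graded"
  lev1 :: "'b graded"
  bdry :: "'b \<Rightarrow> 'r"
  lmul :: "'r \<Rightarrow> 'b \<Rightarrow> 'b"
  rmul :: "'b \<Rightarrow> 'r \<Rightarrow> 'b"

definition pair_algebra :: "('r::ring_1, 'b::ab_group_add) pair_alg \<Rightarrow> bool" where
  "pair_algebra B \<longleftrightarrow>
     graded_ring (lev0 B) \<and>
     graded_left_module (lev0 B) (lev1 B) (lmul B) \<and>
     graded_right_module (lev0 B) (lev1 B) (rmul B) \<and>
     (\<forall>a\<in>carr (lev0 B). \<forall>x\<in>carr (lev1 B). \<forall>b\<in>carr (lev0 B).
        rmul B (lmul B a x) b = lmul B a (rmul B x b)) \<and>
     graded_hom (lev1 B) (lev0 B) (bdry B) \<and>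
     (\<forall>a\<in>carr (lev0 B). \<forall>x\<in>carr (lev1 B).
        bdry B (lmul B a x) = a * bdry B x \<and> bdry B (rmul B x a) = bdry B x * a) \<and>
     (\<forall>x\<in>carr (lev1 B). \<forall>y\<in>carr (lev1 B). lmul B (bdry B x) y = rmul B x (bdry B y))"

record ('r, 'b, 'x, 'y) pair_mod =
  mod0 :: "'x graded"
  mod1 :: "'y graded"
  act0 :: "'r \<Rightarrow> 'x \<Rightarrow> 'x"
  act1 :: "'r \<Rightarrow> 'y \<Rightarrow> 'y"
  mbdry :: "'y \<Rightarrow> 'x"
  mu :: "'b \<Rightarrow> 'x \<Rightarrow> 'y"

text \<open>The map out of the tensor product over level \<open>0\<close> of the pair algebra is given as a balanced
  biadditive map \<open>mu\<close>.\<close>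

definition pair_module ::
  "('r::ring_1, 'b::ab_group_add) pair_alg \<Rightarrow>
   ('r, 'b, 'x::ab_group_add, 'y::ab_group_add) pair_mod \<Rightarrow> bool" where
  "pair_module B M \<longleftrightarrow>
     graded_left_module (lev0 B) (mod0 M) (act0 M) \<and>
     graded_left_module (lev0 B) (mod1 M) (act1 M) \<and>
     graded_hom (mod1 M) (mod0 M) (mbdry M) \<and>
     left_linear (lev0 B) (mod1 M) (act1 M) (act0 M) (mbdry M) \<and>
     graded_bilinear (lev1 B) (mod0 M) (mod1 M) (mu M) \<and>
     (\<forall>\<beta>\<in>carr (lev1 B). \<forall>b\<in>carr (lev0 B). \<forall>x\<in>carr (mod0 M).
        mu M (rmul B \<beta> b) x = mu M \<beta> (act0 M b x) \<and>
        mu M (lmul B b \<beta>) x = act1 M b (mu M \<beta> x)) \<and>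
     (\<forall>\<beta>\<in>carr (lev1 B). \<forall>y\<in>carr (mod1 M). mu M \<beta> (mbdry M y) = act1 M (bdry B \<beta>) y) \<and>
     (\<forall>\<beta>\<in>carr (lev1 B). \<forall>x\<in>carr (mod0 M). mbdry M (mu M \<beta> x) = act0 M (bdry B \<beta>) x)"

definition pair_module_hom ::
  "('r::ring_1, 'b::ab_group_add) pair_alg \<Rightarrow>
   ('r, 'b, 'x::ab_group_add, 'y::ab_group_add) pair_mod \<Rightarrow>
   ('r, 'b, 'v::ab_group_add, 'w::ab_group_add) pair_mod \<Rightarrow>
   ('x \<Rightarrow> 'v) \<Rightarrow> ('y \<Rightarrow> 'w) \<Rightarrow> bool" where
  "pair_module_hom B M N f0 f1 \<longleftrightarrow>
     graded_hom (mod0 M) (mod0 N) f0 \<and> left_linear (lev0 B) (mod0 M) (act0 M) (act0 N) f0 \<and>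
     graded_hom (mod1 M) (mod1 N) f1 \<and> left_linear (lev0 B) (mod1 M) (act1 M) (act1 N) f1 \<and>
     (\<forall>y\<in>carr (mod1 M). f0 (mbdry M y) = mbdry N (f1 y)) \<and>
     (\<forall>\<beta>\<in>carr (lev1 B). \<forall>x\<in>carr (mod0 M). f1 (mu M \<beta> x) = mu N \<beta> (f0 x))"

text \<open>Here \<open>d0 n\<close>, \<open>d1 n\<close> are the two levels of a map from position \<open>n + 1\<close> to position \<open>n\<close>,
  and \<open>H n\<close> goes from level \<open>0\<close> in position \<open>n + 2\<close> to level \<open>1\<close> in position \<open>n\<close>.\<close>

definition secondary_complex ::
  "('r::ring_1, 'b::ab_group_add) pair_alg \<Rightarrow>
   (int \<Rightarrow> ('r, 'b, 'x::ab_group_add, 'y::ab_group_add) pair_mod) \<Rightarrow>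
   (int \<Rightarrow> 'x \<Rightarrow> 'x) \<Rightarrow> (int \<Rightarrow> 'y \<Rightarrow> 'y) \<Rightarrow> (int \<Rightarrow> 'x \<Rightarrow> 'y) \<Rightarrow> bool" where
  "secondary_complex B M d0 d1 H \<longleftrightarrow>
     (\<forall>n. pair_module B (M n)) \<and>
     (\<forall>n. pair_module_hom B (M (n + 1)) (M n) (d0 n) (d1 n)) \<and>
     (\<forall>n. graded_hom (mod0 (M (n + 2))) (mod1 (M n)) (H n) \<and>
          left_linear (lev0 B) (mod0 (M (n + 2))) (act0 (M (n + 2))) (act1 (M n)) (H n)) \<and>
     (\<forall>n. \<forall>x\<in>carr (mod0 (M (n + 2))). d0 n (d0 (n + 1) x) = mbdry (M n) (H n x)) \<and>
     (\<forall>n. \<forall>y\<in>carr (mod1 (M (n + 2))). d1 n (d1 (n + 1) y) = H n (mbdry (M (n + 2)) y)) \<and>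
     (\<forall>n. \<forall>x\<in>carr (mod0 (M (n + 3))). H n (d0 (n + 2) x) = d1 n (H (n + 1) x))"

definition exact_secondary_complex ::
  "('r::ring_1, 'b::ab_group_add) pair_alg \<Rightarrow>
   (int \<Rightarrow> ('r, 'b, 'x::ab_group_add, 'y::ab_group_add) pair_mod) \<Rightarrow>
   (int \<Rightarrow> 'x \<Rightarrow> 'x) \<Rightarrow> (int \<Rightarrow> 'y \<Rightarrow> 'y) \<Rightarrow> (int \<Rightarrow> 'x \<Rightarrow> 'y) \<Rightarrow> bool" where
  "exact_secondary_complex B M d0 d1 H \<longleftrightarrow>
     secondary_complex B M d0 d1 H \<and>
     (\<forall>n. \<forall>c\<in>carr (mod0 (M n)). \<forall>\<gamma>\<in>carr (mod1 (M (n - 1))).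
        d0 (n - 1) c = mbdry (M (n - 1)) \<gamma> \<and> H (n - 2) c = d1 (n - 2) \<gamma> \<longrightarrow>
        (\<exists>b\<in>carr (mod0 (M (n + 1))). \<exists>\<beta>\<in>carr (mod1 (M n)).
           c = d0 n b + mbdry (M n) \<beta> \<and> \<gamma> = H (n - 1) b + d1 (n - 1) \<beta>))"


section \<open>The Steenrod algebra\<close>

text \<open>The word \<open>[i\<^sub>1, \<dots>, i\<^sub>k]\<close> stands for the monomial
  \<open>Sq\<^bsup>i\<^sub>1\<^esup> \<cdots> Sq\<^bsup>i\<^sub>k\<^esup>\<close> with all \<open>i\<^sub>j \<ge> 1\<close>. Finitely
  supported functions on words, with convolution, form the free associative algebra.\<close>

typedef sq_word = "{w :: nat list. 0 \<notin> set w}"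
  by (rule exI[of _ "[]"]) simp

setup_lifting type_definition_sq_word

instantiation sq_word :: monoid_add
begin
lift_definition zero_sq_word :: sq_word is "[]" by simp
lift_definition plus_sq_word :: "sq_word \<Rightarrow> sq_word \<Rightarrow> sq_word" is "(@)" by simp
instance by standard (transfer; simp)+
end

lift_definition word_deg :: "sq_word \<Rightarrow> nat" is sum_list .

type_synonym free2 = "sq_word \<Rightarrow>\<^sub>0 bit"
type_synonym B0 = "sq_word \<Rightarrow>\<^sub>0 4"

lift_definition sq_letter :: "nat \<Rightarrow> sq_word" is "\<lambda>n. if n = 0 then [] else [n]" by simp

text \<open>\<open>sq 0\<close> is the unit, as is customary in the Adem relations.\<close>

definition sq :: "nat \<Rightarrow> free2" where
  "sq n = Poly_Mapping.single (sq_letter n) 1"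

definition adem :: "nat \<Rightarrow> nat \<Rightarrow> free2" where
  "adem a b = sq a * sq b -
     (\<Sum>c = 0..a div 2. of_nat ((b - c - 1) choose (a - 2 * c)) * sq (a + b - c) * sq c)"

inductive_set adem_ideal :: "free2 set" where
  zero: "0 \<in> adem_ideal"
| add: "x \<in> adem_ideal \<Longrightarrow> 0 < a \<Longrightarrow> a < 2 * b \<Longrightarrow> x + p * adem a b * q \<in> adem_ideal"

lemma adem_ideal_add: "y \<in> adem_ideal \<Longrightarrow> x \<in> adem_ideal \<Longrightarrow> x + y \<in> adem_ideal"
proof (induction y rule: adem_ideal.induct)
  case (add y a b p q)
  then have "(x + y) + p * adem a b * q \<in> adem_ideal" by (blast intro: adem_ideal.add)
  then show ?case by (simp add: add.assoc)
qed simp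

lemma adem_ideal_mult: "x \<in> adem_ideal \<Longrightarrow> u * x * v \<in> adem_ideal"
proof (induction x rule: adem_ideal.induct)
  case zero
  then show ?case by (simp add: adem_ideal.zero)
next
  case (add x a b p q)
  have "u * (x + p * adem a b * q) * v = u * x * v + (u * p) * adem a b * (q * v)"
    by (simp add: algebra_simps)
  with add adem_ideal.add show ?case by metis
qed

lemma adem_ideal_uminus: "x \<in> adem_ideal \<Longrightarrow> - x \<in> adem_ideal"
  using adem_ideal_mult[of x "- 1" 1] by simp

lemma sq_word_add_eq_0: "0 = k + l \<longleftrightarrow> k = 0 \<and> l = (0 :: sq_word)"
  by transfer auto

lemma lookup_mult_0:
  fixes f g :: "sq_word \<Rightarrow>\<^sub>0 'a::semiring_0"
  shows "Poly_Mapping.lookup (f * g) 0 = Poly_Mapping.lookup f 0 * Poly_Mapping.lookup g 0"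
proof -
  have *: "(\<Sum>q. g q when 0 = l + q) = (g 0 when l = 0)" for g :: "sq_word \<Rightarrow> 'a" and l
  proof -
    have "(\<lambda>q. g q when 0 = l + q) = (\<lambda>q. (g q when q = 0) when l = 0)"
      by (auto simp: sq_word_add_eq_0 when_def)
    then show ?thesis by (simp only: Sum_any_when_independent Sum_any_when_equal)
  qed
  show ?thesis
    unfolding times_poly_mapping.rep_eq prod_fun_def * by (simp add: mult_when)
qed

lemma sq_letter_eq_0: "sq_letter n = 0 \<longleftrightarrow> n = 0"
  by transfer simp

lemma lookup_sq_0: "Poly_Mapping.lookup (sq n) 0 = (if n = 0 then 1 else 0)"
  by (simp add: sq_def lookup_single sq_letter_eq_0 when_def)

lemma lookup_adem_0: "0 < a \<Longrightarrow> a < 2 * b \<Longrightarrow> Poly_Mapping.lookup (adem a b) 0 = 0"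
  unfolding adem_def lookup_minus lookup_sum lookup_mult_0 lookup_sq_0
  by (subst sum.neutral) auto

lemma lookup_adem_ideal_0: "x \<in> adem_ideal \<Longrightarrow> Poly_Mapping.lookup x 0 = 0"
  by (induction rule: adem_ideal.induct) (simp_all add: lookup_add lookup_mult_0 lookup_adem_0)

quotient_type steenrod = free2 / "\<lambda>x y. x - y \<in> adem_ideal"
  morphisms rep_steenrod steen
proof (rule equivpI)
  show "reflp (\<lambda>x y. x - y \<in> adem_ideal)"
    by (simp add: reflp_def adem_ideal.zero)
  show "symp (\<lambda>x y. x - y \<in> adem_ideal)"
    using adem_ideal_uminus by (fastforce simp: symp_def)
  show "transp (\<lambda>x y. x - y \<in> adem_ideal)"
  proof (rule transpI)
    fix x y z :: free2
    assume "x - y \<in> adem_ideal" "y - z \<in> adem_ideal"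
    from adem_ideal_add[OF this] show "x - z \<in> adem_ideal" by simp
  qed
qed

instantiation steenrod :: ring_1
begin

lift_definition zero_steenrod :: steenrod is 0 .
lift_definition one_steenrod :: steenrod is 1 .

lift_definition plus_steenrod :: "steenrod \<Rightarrow> steenrod \<Rightarrow> steenrod" is "(+)"
  using adem_ideal_add by (fastforce simp: algebra_simps)

lift_definition uminus_steenrod :: "steenrod \<Rightarrow> steenrod" is uminus
  using adem_ideal_uminus by fastforce

lift_definition minus_steenrod :: "steenrod \<Rightarrow> steenrod \<Rightarrow> steenrod" is "(-)"
proof -
  fix x x' y y' :: free2
  assume "x - x' \<in> adem_ideal" "y - y' \<in> adem_ideal"
  from adem_ideal_add[OF this(1) adem_ideal_uminus[OF this(2)]]
  show "x - y - (x' - y') \<in> adem_ideal" by (simp add: algebra_simps)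
qed

lift_definition times_steenrod :: "steenrod \<Rightarrow> steenrod \<Rightarrow> steenrod" is "(*)"
proof -
  fix x x' y y' :: free2
  assume *: "x - x' \<in> adem_ideal" "y - y' \<in> adem_ideal"
  have "1 * (x - x') * y + x' * (y - y') * 1 \<in> adem_ideal"
    using * by (intro adem_ideal_add adem_ideal_mult)
  then show "x * y - x' * y' \<in> adem_ideal" by (simp add: algebra_simps)
qed

instance
proof
  show "(0::steenrod) \<noteq> 1"
    by transfer (use lookup_adem_ideal_0 in fastforce)
qed (transfer; simp add: algebra_simps adem_ideal.zero)+

end

lift_definition aug_steen :: "steenrod \<Rightarrow> bit" is "\<lambda>x. Poly_Mapping.lookup x 0"
  using lookup_adem_ideal_0 by (fastforce simp: lookup_minus)

definition red4 :: "4 \<Rightarrow> bit" where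
  "red4 x = (if x \<in> {1, 3} then 1 else 0)"

definition chi :: "bit \<Rightarrow> 4" where
  "chi x = (if x = 0 then 0 else 1)"

definition proj :: "B0 \<Rightarrow> steenrod" where
  "proj b = steen (Poly_Mapping.map red4 b)"

definition relR :: "B0 set" where
  "relR = {r. proj r = 0}"

definition aug_B0 :: "B0 \<Rightarrow> 4" where
  "aug_B0 b = Poly_Mapping.lookup b 0"

definition free_alg_graded :: "(sq_word \<Rightarrow>\<^sub>0 'k::zero) graded" where
  "free_alg_graded =
     \<lparr>carr = UNIV, piece = (\<lambda>n. {f. \<forall>w\<in>Poly_Mapping.keys f. int (word_deg w) = n})\<rparr>"

definition steen_graded :: "steenrod graded" where
  "steen_graded = \<lparr>carr = UNIV, piece = (\<lambda>n. steen ` piece free_alg_graded n)\<rparr>"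

definition susp :: "'a graded \<Rightarrow> 'a graded" where
  "susp X = \<lparr>carr = carr X, piece = (\<lambda>n. piece X (n - 1))\<rparr>"

definition gprod :: "'a graded \<Rightarrow> 'b graded \<Rightarrow> ('a \<times> 'b) graded" where
  "gprod X Y = \<lparr>carr = carr X \<times> carr Y, piece = (\<lambda>n. piece X n \<times> piece Y n)\<rparr>"


section \<open>The pair algebra with multiplication map \<open>A\<close>\<close>

text \<open>With level \<open>1\<close> identified with \<open>R \<oplus> \<Sigma>\<A>\<close>, all of the structure of the pair algebra of
  secondary cohomology operations beyond \<open>\<A>\<close> and \<open>R\<close> lies in the multiplication map \<open>A\<close>.
  The topological construction that produces this map (and its dependence on the chosen
  splitting) is not formalised: \<open>secB A\<close> is formed for an arbitrary \<open>A\<close>, only whose values on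
  \<open>\<A> \<otimes> R\<close> matter. That \<open>secB A\<close> is a \<open>pair_algebra\<close> says exactly that \<open>A\<close> is a map of degree
  \<open>-1\<close> for which the formulas \<open>lmulB\<close>, \<open>rmulB\<close> define a pair algebra; a statement for all such
  \<open>A\<close> covers the secondary operations.\<close>

type_synonym B1 = "B0 \<times> steenrod"

definition R_graded :: "B0 graded" where
  "R_graded = \<lparr>carr = relR, piece = (\<lambda>n. relR \<inter> piece free_alg_graded n)\<rparr>"

definition B1_graded :: "B1 graded" where
  "B1_graded = gprod R_graded (susp steen_graded)"

definition lmulB :: "(steenrod \<Rightarrow> B0 \<Rightarrow> steenrod) \<Rightarrow> B0 \<Rightarrow> B1 \<Rightarrow> B1" where
  "lmulB A b = (\<lambda>(r, a). (b * r, A (proj b) r + proj b * a))"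

definition rmulB :: "B1 \<Rightarrow> B0 \<Rightarrow> B1" where
  "rmulB = (\<lambda>(r, a) b. (r * b, a * proj b))"

definition secB :: "(steenrod \<Rightarrow> B0 \<Rightarrow> steenrod) \<Rightarrow> (B0, B1) pair_alg" where
  "secB A = \<lparr>lev0 = free_alg_graded, lev1 = B1_graded, bdry = fst,
             lmul = lmulB A, rmul = rmulB\<rparr>"


section \<open>Free modules\<close>

text \<open>A finitely supported function \<open>f :: 'g \<Rightarrow>\<^sub>0 'c\<close> is the element \<open>\<Sum>\<^sub>g f(g) g\<close>.
  The type \<open>'g\<close> consists of all generators of a resolution; \<open>low g\<close> is the lower index of
  \<open>g\<close> (the number of the module it belongs to) and \<open>deg g\<close> its degree.\<close>

definition free_graded ::
  "('g \<Rightarrow> nat) \<Rightarrow> 'g set \<Rightarrow> 'c::zero graded \<Rightarrow> ('g \<Rightarrow>\<^sub>0 'c) graded" where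
  "free_graded deg G X =
     \<lparr>carr = {f. Poly_Mapping.keys f \<subseteq> G \<and> (\<forall>g. Poly_Mapping.lookup f g \<in> carr X)},
      piece = (\<lambda>n. {f. Poly_Mapping.keys f \<subseteq> G \<and>
                       (\<forall>g. Poly_Mapping.lookup f g \<in> piece X (n - int (deg g)))})\<rparr>"

definition gens :: "('g \<Rightarrow> nat) \<Rightarrow> int \<Rightarrow> 'g set" where
  "gens low n = {g. int (low g) = n}"

text \<open>Applied to \<open>f = \<Sum>\<^sub>g c\<^sub>g g\<close>, the map \<open>lin_ext s D\<close> gives
  \<open>\<Sum>\<^sub>g c\<^sub>g D(g)\<close>, where \<open>s c\<close> acts on the coefficients of \<open>D(g)\<close>.\<close>

definition lin_ext ::
  "('c::zero \<Rightarrow> 'k::zero \<Rightarrow> 'l::comm_monoid_add) \<Rightarrow> ('g \<Rightarrow> 'h \<Rightarrow>\<^sub>0 'k) \<Rightarrow>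
   ('g \<Rightarrow>\<^sub>0 'c) \<Rightarrow> 'h \<Rightarrow>\<^sub>0 'l" where
  "lin_ext s D f =
     (\<Sum>g\<in>Poly_Mapping.keys f. Poly_Mapping.map (s (Poly_Mapping.lookup f g)) (D g))"

definition coeff_sum :: "('c::zero \<Rightarrow> 'k::comm_monoid_add) \<Rightarrow> ('g \<Rightarrow>\<^sub>0 'c) \<Rightarrow> 'k" where
  "coeff_sum e f = (\<Sum>g\<in>Poly_Mapping.keys f. e (Poly_Mapping.lookup f g))"


section \<open>The minimal resolution and its literal lift\<close>

text \<open>For a generator \<open>g\<close> with \<open>low g > 0\<close> the value \<open>dA g\<close> is its image under the
  differential. With the single generator \<open>g\<^sub>0\<^sup>0\<close> in position \<open>0\<close>, the augmentation
  \<open>\<A>\<langle>g\<^sub>0\<^sup>0\<rangle> \<rightarrow> \<F>\<close> is \<open>coeff_sum aug_steen\<close>.\<close>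

definition minimal_resolution ::
  "('g \<Rightarrow> nat) \<Rightarrow> ('g \<Rightarrow> nat) \<Rightarrow> ('g \<Rightarrow> 'g \<Rightarrow>\<^sub>0 steenrod) \<Rightarrow> bool" where
  "minimal_resolution low deg dA \<longleftrightarrow>
     (let F = (\<lambda>m. carr (free_graded deg (gens low m) steen_graded));
          d = lin_ext (*) dA
      in
       (\<forall>g. low g > 0 \<longrightarrow>
          dA g \<in> piece (free_graded deg (gens low (int (low g) - 1)) steen_graded) (int (deg g))) \<and>
       coeff_sum aug_steen ` F 0 = UNIV \<and>
       {x \<in> F 0. coeff_sum aug_steen x = 0} = d ` F 1 \<and>
       (\<forall>m\<ge>0. {x \<in> F (m + 1). d x = 0} = d ` F (m + 2)) \<and>
       (\<forall>g g'. low g > 0 \<longrightarrow> aug_steen (Poly_Mapping.lookup (dA g) g') = 0) \<and>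
       bij_betw deg (gens low 0) {0} \<and>
       bij_betw deg (gens low 1) {2 ^ n | n. True} \<and>
       bij_betw deg (gens low 2) {2 ^ i + 2 ^ j | i j. \<bar>int i - int j\<bar> \<noteq> 1})"

text \<open>A choice, for every generator, of a homogeneous expression of \<open>dA g\<close> as an
  \<open>\<F>\<close>-linear combination of (monomial)(generator).\<close>

definition literal_expression ::
  "('g \<Rightarrow> nat) \<Rightarrow> ('g \<Rightarrow> nat) \<Rightarrow> ('g \<Rightarrow> 'g \<Rightarrow>\<^sub>0 steenrod) \<Rightarrow> ('g \<Rightarrow> 'g \<Rightarrow>\<^sub>0 free2) \<Rightarrow> bool" where
  "literal_expression low deg dA ex \<longleftrightarrow>
     (\<forall>g. low g > 0 \<longrightarrow>
        ex g \<in> piece (free_graded deg (gens low (int (low g) - 1)) free_alg_graded) (int (deg g)) \<and>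
        Poly_Mapping.map steen (ex g) = dA g)"

definition lift_gen :: "('g \<Rightarrow> 'g \<Rightarrow>\<^sub>0 free2) \<Rightarrow> 'g \<Rightarrow> 'g \<Rightarrow>\<^sub>0 B0" where
  "lift_gen ex g = Poly_Mapping.map (Poly_Mapping.map chi) (ex g)"

definition lift_d0 :: "('g \<Rightarrow> 'g \<Rightarrow>\<^sub>0 free2) \<Rightarrow> ('g \<Rightarrow>\<^sub>0 B0) \<Rightarrow> 'g \<Rightarrow>\<^sub>0 B0" where
  "lift_d0 ex = lin_ext (*) (lift_gen ex)"

definition lift_d1 :: "('g \<Rightarrow> 'g \<Rightarrow>\<^sub>0 free2) \<Rightarrow> ('g \<Rightarrow>\<^sub>0 B1) \<Rightarrow> 'g \<Rightarrow>\<^sub>0 B1" where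
  "lift_d1 ex = lin_ext rmulB (lift_gen ex)"

definition ddg :: "('g \<Rightarrow> 'g \<Rightarrow>\<^sub>0 free2) \<Rightarrow> 'g \<Rightarrow> 'g \<Rightarrow>\<^sub>0 B0" where
  "ddg ex g = lift_d0 ex (lift_gen ex g)"


section \<open>The module \<open>\<G>\<^sup>\<Sigma>\<close> and the sequence to be completed\<close>

text \<open>Level \<open>1\<close> of \<open>\<G>\<^sup>\<Sigma>\<close> is \<open>2\<G> \<oplus> \<Sigma>\<F>\<close>, with boundary the inclusion of \<open>2\<G>\<close>. Its
  structure maps are pushed forward along \<open>eps1\<close> from the pair algebra, using the section
  \<open>GS_lift\<close> of \<open>eps1\<close>.\<close>

definition G0_graded :: "4 graded" where
  "G0_graded = \<lparr>carr = UNIV, piece = (\<lambda>n. if n = 0 then UNIV else {0})\<rparr>"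

definition GS1_graded :: "(4 \<times> bit) graded" where
  "GS1_graded =
     \<lparr>carr = {0, 2} \<times> UNIV,
      piece = (\<lambda>n. (if n = 0 then {0, 2} else {0}) \<times> (if n = 1 then UNIV else {0}))\<rparr>"

definition eps1 :: "B1 \<Rightarrow> 4 \<times> bit" where
  "eps1 = (\<lambda>(r, a). (aug_B0 r, aug_steen a))"

definition GS_lift :: "4 \<times> bit \<Rightarrow> B1" where
  "GS_lift = (\<lambda>(x, y). (Poly_Mapping.single 0 x, if y = 0 then 0 else 1))"

definition GS_act1 :: "(steenrod \<Rightarrow> B0 \<Rightarrow> steenrod) \<Rightarrow> B0 \<Rightarrow> 4 \<times> bit \<Rightarrow> 4 \<times> bit" where
  "GS_act1 A b z = eps1 (lmulB A b (GS_lift z))"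

definition GS_mu :: "B1 \<Rightarrow> 4 \<Rightarrow> 4 \<times> bit" where
  "GS_mu \<beta> x = eps1 (rmulB \<beta> (Poly_Mapping.single 0 x))"

definition zero_graded :: "'a::zero graded" where
  "zero_graded = \<lparr>carr = {0}, piece = (\<lambda>n. {0})\<rparr>"

text \<open>All modules of the sequence are placed in common ambient types: the first factor
  contains the free modules in positions \<open>n \<ge> 0\<close> (there \<open>gens low n\<close> is empty for
  \<open>n < 0\<close>), and the second factor contains \<open>\<G>\<^sup>\<Sigma>\<close> in position \<open>-1\<close>. In every
  position at least one of the factors vanishes.\<close>

definition seq_mod ::
  "(steenrod \<Rightarrow> B0 \<Rightarrow> steenrod) \<Rightarrow> ('g \<Rightarrow> nat) \<Rightarrow> ('g \<Rightarrow> nat) \<Rightarrow> int \<Rightarrow>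
   (B0, B1, ('g \<Rightarrow>\<^sub>0 B0) \<times> 4, ('g \<Rightarrow>\<^sub>0 B1) \<times> (4 \<times> bit)) pair_mod" where
  "seq_mod A low deg n =
     \<lparr>mod0 = gprod (free_graded deg (gens low n) free_alg_graded)
                    (if n = -1 then G0_graded else zero_graded),
      mod1 = gprod (free_graded deg (gens low n) B1_graded)
                    (if n = -1 then GS1_graded else zero_graded),
      act0 = (\<lambda>b (f, x). (Poly_Mapping.map ((*) b) f, aug_B0 b * x)),
      act1 = (\<lambda>b (f, z). (Poly_Mapping.map (lmulB A b) f, GS_act1 A b z)),
      mbdry = (\<lambda>(f, z). (Poly_Mapping.map fst f, fst z)),
      mu = (\<lambda>\<beta> (f, x). (Poly_Mapping.map (rmulB \<beta>) f, GS_mu \<beta> x))\<rparr>"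

definition seq_d0 ::
  "('g \<Rightarrow> 'g \<Rightarrow>\<^sub>0 free2) \<Rightarrow> int \<Rightarrow> ('g \<Rightarrow>\<^sub>0 B0) \<times> 4 \<Rightarrow> ('g \<Rightarrow>\<^sub>0 B0) \<times> 4" where
  "seq_d0 ex n = (\<lambda>(f, x). if n = -1 then (0, coeff_sum aug_B0 f) else (lift_d0 ex f, 0))"

definition seq_d1 ::
  "('g \<Rightarrow> 'g \<Rightarrow>\<^sub>0 free2) \<Rightarrow> int \<Rightarrow>
   ('g \<Rightarrow>\<^sub>0 B1) \<times> (4 \<times> bit) \<Rightarrow> ('g \<Rightarrow>\<^sub>0 B1) \<times> (4 \<times> bit)" where
  "seq_d1 ex n = (\<lambda>(f, z). if n = -1 then (0, coeff_sum eps1 f) else (lift_d1 ex f, 0))"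

definition seq_H ::
  "(nat \<Rightarrow> ('g \<Rightarrow>\<^sub>0 B0) \<Rightarrow> 'g \<Rightarrow>\<^sub>0 B1) \<Rightarrow> int \<Rightarrow>
   ('g \<Rightarrow>\<^sub>0 B0) \<times> 4 \<Rightarrow> ('g \<Rightarrow>\<^sub>0 B1) \<times> (4 \<times> bit)" where
  "seq_H H n = (\<lambda>(f, x). if n \<ge> 0 then (H (nat n) f, 0) else 0)"

abbreviation free_B0 ::
  "('g \<Rightarrow> nat) \<Rightarrow> ('g \<Rightarrow> nat) \<Rightarrow> nat \<Rightarrow> ('g \<Rightarrow>\<^sub>0 B0) graded" where
  "free_B0 low deg m \<equiv> free_graded deg (gens low (int m)) free_alg_graded"

abbreviation free_A ::
  "('g \<Rightarrow> nat) \<Rightarrow> ('g \<Rightarrow> nat) \<Rightarrow> nat \<Rightarrow> ('g \<Rightarrow>\<^sub>0 steenrod) graded" where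
  "free_A low deg m \<equiv> free_graded deg (gens low (int m)) steen_graded"

abbreviation free_susp_A ::
  "('g \<Rightarrow> nat) \<Rightarrow> ('g \<Rightarrow> nat) \<Rightarrow> nat \<Rightarrow> ('g \<Rightarrow>\<^sub>0 steenrod) graded" where
  "free_susp_A low deg m \<equiv> free_graded deg (gens low (int m)) (susp steen_graded)"

text \<open>Maps defined on a module are represented by functions that are \<open>undefined\<close> off its
  carrier, so that equality of families is equality of families of maps.\<close>

definition completions ::
  "(steenrod \<Rightarrow> B0 \<Rightarrow> steenrod) \<Rightarrow> ('g \<Rightarrow> nat) \<Rightarrow> ('g \<Rightarrow> nat) \<Rightarrow>
   ('g \<Rightarrow> 'g \<Rightarrow>\<^sub>0 free2) \<Rightarrow> (nat \<Rightarrow> ('g \<Rightarrow>\<^sub>0 B0) \<Rightarrow> 'g \<Rightarrow>\<^sub>0 B1) set" where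
  "completions A low deg ex =
     {H. (\<forall>m. H m \<in> extensional (carr (free_B0 low deg (m + 2)))) \<and>
         exact_secondary_complex (secB A) (seq_mod A low deg) (seq_d0 ex) (seq_d1 ex) (seq_H H)}"

definition delta_families ::
  "(steenrod \<Rightarrow> B0 \<Rightarrow> steenrod) \<Rightarrow> ('g \<Rightarrow> nat) \<Rightarrow> ('g \<Rightarrow> nat) \<Rightarrow>
   ('g \<Rightarrow> 'g \<Rightarrow>\<^sub>0 steenrod) \<Rightarrow> ('g \<Rightarrow> 'g \<Rightarrow>\<^sub>0 free2) \<Rightarrow>
   (nat \<Rightarrow> ('g \<Rightarrow>\<^sub>0 steenrod) \<Rightarrow> 'g \<Rightarrow>\<^sub>0 steenrod) set" where
  "delta_families A low deg dA ex =
     {\<delta>. (\<forall>m. \<delta> m \<in> extensional (carr (free_A low deg (m + 2)))) \<and>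
         (\<forall>m. graded_hom (free_A low deg (m + 2)) (free_susp_A low deg m) (\<delta> m)) \<and>
         (\<forall>m a g. low g = m + 2 \<longrightarrow>
            \<delta> m (Poly_Mapping.single g a) =
              Poly_Mapping.map ((*) a) (\<delta> m (Poly_Mapping.single g 1)) +
              Poly_Mapping.map (A a) (ddg ex g)) \<and>
         (\<forall>g. low g = 2 \<longrightarrow> coeff_sum aug_steen (\<delta> 0 (Poly_Mapping.single g 1)) = 0) \<and>
         (\<forall>m g. low g = m + 3 \<longrightarrow>
            lin_ext (*) dA (\<delta> (m + 1) (Poly_Mapping.single g 1)) = \<delta> m (dA g))}"

end

theory Submission
  imports Defs
begin

text \<open>
  The equation \<open>\<partial>H = dd\<close> determines the \<open>R\<close>-component of \<open>H\<close>, so \<open>H(x) = (ddx, h(x))\<close>. On an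
  element \<open>r g\<close> with \<open>r \<in> R\<close> one has \<open>H(r g) = dd((r, 0) g) = (r \<cdot> ddg, 0)\<close>, so \<open>h\<close>
  vanishes there and factors through a map \<open>\<delta>\<close> on \<open>\<A>\<langle>g\<rangle>\<close>; linearity of \<open>H\<close> over \<open>\<B>\<^sub>0\<close> is the
  formula for \<open>\<delta>(a g)\<close>, and \<open>H d = d H\<close> is \<open>\<delta> d = d \<delta>\<close>. Conversely
  \<open>H(x) = (ddx, \<delta>(\<pi> x))\<close> is always a secondary complex: in position \<open>-1\<close> this uses that
  \<open>A(a, r)\<close> has augmentation \<open>0\<close> whenever \<open>r\<close> has. Exactness is then automatic:
  given \<open>(c, \<gamma>)\<close>, exactness of the minimal resolution yields \<open>b\<close> with \<open>c - db \<in> R\<langle>g\<rangle>\<close>, and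
  \<open>\<gamma> - Hb - d(c - db, 0)\<close> is a cycle of \<open>\<Sigma>\<A>\<langle>g\<rangle>\<close>, hence a boundary.
\<close>

text \<open>The multiplication map belongs to the left action alone. Differentials multiply
  coefficients from the right, so on level 1 they never meet it: their second component is the
  differential of the resolution, and dd sends (r, a) g to (r ddg, a pi(ddg)) = (r ddg, 0). The map
  A reappears only when b in B_0 acts from the left on H(g) = (ddg, h(g)); this is the origin of the
  term A(a, ddg). The construction of H from delta rests on two identities read off from the pair
  algebra axioms: A(ab, r) = A(a, br) + a A(b, r) makes the formula for delta(ag) compatible with
  the left action, and A(a, rb) = A(a, r) pi(b) makes it compatible with d, so that equations
  imposed on generators hold on whole modules. As A is constrained only on A tensor R, additivity is
  assumed on subgroups in many of the general lemmas.\<close>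

section \<open>Graded groups\<close>

lemma add_subgroup_UNIV [simp]: "add_subgroup UNIV"
  by (simp add: add_subgroup_def)

lemma add_subgroup_singleton_0 [simp]: "add_subgroup {0}"
  by (simp add: add_subgroup_def)

lemma add_subgroup_0: "add_subgroup S \<Longrightarrow> 0 \<in> S"
  by (simp add: add_subgroup_def)

lemma add_subgroup_diff: "add_subgroup S \<Longrightarrow> x \<in> S \<Longrightarrow> y \<in> S \<Longrightarrow> x - y \<in> S"
  by (simp add: add_subgroup_def)

lemma add_subgroup_uminus: "add_subgroup S \<Longrightarrow> x \<in> S \<Longrightarrow> - x \<in> S"
  using add_subgroup_diff[of S 0 x] add_subgroup_0[of S] by simp

lemma add_subgroup_add: "add_subgroup S \<Longrightarrow> x \<in> S \<Longrightarrow> y \<in> S \<Longrightarrow> x + y \<in> S"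
  using add_subgroup_diff[of S x "- y"] add_subgroup_uminus[of S y] by simp

lemma add_subgroup_sum: "add_subgroup S \<Longrightarrow> (\<And>i. i \<in> I \<Longrightarrow> f i \<in> S) \<Longrightarrow> sum f I \<in> S"
  by (induction I rule: infinite_finite_induct) (auto simp: add_subgroup_0 add_subgroup_add)

lemma additive_0:
  fixes u :: "'a::ab_group_add \<Rightarrow> 'b::ab_group_add"
  assumes "add_subgroup S" "\<And>x y. x \<in> S \<Longrightarrow> y \<in> S \<Longrightarrow> u (x + y) = u x + u y"
  shows "u 0 = 0"
  using assms(2)[of 0 0] add_subgroup_0[OF assms(1)] by simp

lemma additive_diff:
  fixes u :: "'a::ab_group_add \<Rightarrow> 'b::ab_group_add"
  assumes "add_subgroup S" "\<And>x y. x \<in> S \<Longrightarrow> y \<in> S \<Longrightarrow> u (x + y) = u x + u y" "x \<in> S" "y \<in> S"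
  shows "u (x - y) = u x - u y"
  using assms(2)[of "x - y" y] add_subgroup_diff[OF assms(1)] assms(3,4)
  by (simp add: algebra_simps)

lemma additive_sum:
  fixes u :: "'a::ab_group_add \<Rightarrow> 'b::ab_group_add"
  assumes "add_subgroup S" "\<And>x y. x \<in> S \<Longrightarrow> y \<in> S \<Longrightarrow> u (x + y) = u x + u y"
    and "\<And>i. i \<in> I \<Longrightarrow> f i \<in> S"
  shows "u (sum f I) = (\<Sum>i\<in>I. u (f i))"
  using assms(3)
  by (induction I rule: infinite_finite_induct)
    (auto simp: additive_0[OF assms(1,2)] assms(2) add_subgroup_sum[OF assms(1)])

lemma graded_group_carr: "graded_group X \<Longrightarrow> add_subgroup (carr X)"
  by (simp add: graded_group_def)

lemma graded_group_piece: "graded_group X \<Longrightarrow> add_subgroup (piece X n)"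
  by (simp add: graded_group_def)

lemma graded_group_piece_carr: "graded_group X \<Longrightarrow> x \<in> piece X n \<Longrightarrow> x \<in> carr X"
  by (auto simp: graded_group_def)

text \<open>The existence half of the direct sum decomposition: a property closed under sums need
  only be checked on homogeneous elements.\<close>

lemma graded_group_induct [consumes 2, case_names zero piece add]:
  assumes "graded_group X" "x \<in> carr X" "P 0"
    and "\<And>n x. x \<in> piece X n \<Longrightarrow> P x"
    and "\<And>x y. x \<in> carr X \<Longrightarrow> y \<in> carr X \<Longrightarrow> P x \<Longrightarrow> P y \<Longrightarrow> P (x + y)"
  shows "P x"
proof -
  obtain c where c: "\<And>n. c n \<in> piece X n" "x = (\<Sum>n | c n \<noteq> 0. c n)"
    using assms(1,2) unfolding graded_group_def by blast
  have "sum c I \<in> carr X \<and> P (sum c I)" if "finite I" for I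
    using that
    by induction (auto simp: assms(3) intro!: assms(5) assms(4)[OF c(1)] add_subgroup_0
        add_subgroup_add graded_group_carr[OF assms(1)] graded_group_piece_carr[OF assms(1) c(1)])
  moreover have "sum c I = 0" if "infinite I" for I
    using that by simp
  ultimately show ?thesis
    using c(2) assms(3) by (cases "finite {n. c n \<noteq> 0}") auto
qed

text \<open>The uniqueness half: the family, extended by 0 off the image of \<phi>, is compared with
  the trivial decomposition of 0. The reindexing by \<phi> is there for free modules, where the
  coefficient at g of an element of degree n has degree n - deg g.\<close>

lemma graded_group_indep:
  assumes "graded_group X" "finite I" "inj_on \<phi> I"
    and c: "\<And>i. i \<in> I \<Longrightarrow> c i \<in> piece X (\<phi> i)" "sum c I = 0" and "i \<in> I"
  shows "c i = 0"
proof -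
  define e where "e k = (if k \<in> \<phi> ` I then c (inv_into I \<phi> k) else 0)" for k
  have e: "e (\<phi> j) = c j" if "j \<in> I" for j
    using that assms(3) by (simp add: e_def)
  have fin: "finite {k. e k \<noteq> 0}"
    by (rule finite_subset[of _ "\<phi> ` I"]) (auto simp: e_def assms(2) split: if_splits)
  have "(\<Sum>k | e k \<noteq> 0. e k) = sum e (\<phi> ` I)"
    by (rule sum.mono_neutral_left) (auto simp: e_def assms(2) split: if_splits)
  also have "\<dots> = 0"
    using c(2) e by (simp add: sum.reindex[OF assms(3)])
  finally have "(\<Sum>k | e k \<noteq> 0. e k) = 0" .
  moreover have "\<forall>k. e k \<in> piece X k"
    using c(1) e by (auto simp: e_def add_subgroup_0[OF graded_group_piece[OF assms(1)]])
  moreover obtain d where d: "\<And>c. \<lbrakk>\<forall>n. c n \<in> piece X n; finite {n. c n \<noteq> 0}; 0 = (\<Sum>n | c n \<noteq> 0. c n)\<rbrakk> \<Longrightarrow> c = d"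
    using assms(1) add_subgroup_0[of "carr X"] unfolding graded_group_def by metis
  moreover have "(\<lambda>_. 0) = d"
    by (rule d) (simp_all add: add_subgroup_0[OF graded_group_piece[OF assms(1)]])
  ultimately have "e = (\<lambda>_. 0)"
    using fin by simp
  then show ?thesis
    using e[OF assms(6)] by simp
qed

text \<open>Decomposability without uniqueness. In this form it is closed under sums and can be
  proved by induction on elements.\<close>

definition homogeneous_sum :: "'a::ab_group_add graded \<Rightarrow> 'a \<Rightarrow> bool" where
  "homogeneous_sum X x \<longleftrightarrow>
     (\<exists>c. (\<forall>n. c n \<in> piece X n) \<and> finite {n. c n \<noteq> 0} \<and> x = (\<Sum>n | c n \<noteq> 0. c n))"

lemma homogeneous_sum_piece:
  assumes "\<And>n. add_subgroup (piece X n)" "x \<in> piece X n"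
  shows "homogeneous_sum X x"
proof -
  have "{k. (if k = n then x else 0) \<noteq> 0} = (if x = 0 then {} else {n})"
    by auto
  then show ?thesis
    unfolding homogeneous_sum_def using assms(2) add_subgroup_0[OF assms(1)]
    by (intro exI[of _ "\<lambda>k. if k = n then x else 0"]) simp
qed

lemma homogeneous_sum_0: "(\<And>n. add_subgroup (piece X n)) \<Longrightarrow> homogeneous_sum X 0"
  using add_subgroup_0 by (blast intro: homogeneous_sum_piece)

lemma homogeneous_sum_add:
  assumes "\<And>n. add_subgroup (piece X n)" "homogeneous_sum X x" "homogeneous_sum X y"
  shows "homogeneous_sum X (x + y)"
proof -
  obtain c where c: "\<And>n. c n \<in> piece X n" "finite {n. c n \<noteq> 0}" "x = (\<Sum>n | c n \<noteq> 0. c n)"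
    using assms(2) by (auto simp: homogeneous_sum_def)
  obtain e where e: "\<And>n. e n \<in> piece X n" "finite {n. e n \<noteq> 0}" "y = (\<Sum>n | e n \<noteq> 0. e n)"
    using assms(3) by (auto simp: homogeneous_sum_def)
  let ?I = "{n. c n \<noteq> 0} \<union> {n. e n \<noteq> 0}"
  have "x = sum c ?I" "y = sum e ?I"
    unfolding c(3) e(3) using c(2) e(2) by (auto intro!: sum.mono_neutral_left)
  moreover have "(\<Sum>n | c n + e n \<noteq> 0. c n + e n) = (\<Sum>n\<in>?I. c n + e n)"
    using c(2) e(2) by (auto intro!: sum.mono_neutral_left)
  moreover have "finite {n. c n + e n \<noteq> 0}"
    by (rule finite_subset[of _ ?I]) (use c(2) e(2) in auto)
  ultimately show ?thesis
    unfolding homogeneous_sum_def using c(1) e(1) add_subgroup_add[OF assms(1)]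
    by (intro exI[of _ "\<lambda>n. c n + e n"]) (simp add: sum.distrib)
qed

text \<open>Two decompositions of one element differ by a vanishing sum of homogeneous terms over
  the union of their supports, so uniqueness reduces to independence of the pieces.\<close>

lemma graded_groupI:
  assumes "add_subgroup (carr X)" "\<And>n. add_subgroup (piece X n)" "\<And>n. piece X n \<subseteq> carr X"
    and "\<And>x. x \<in> carr X \<Longrightarrow> homogeneous_sum X x"
    and indep: "\<And>I c n. finite I \<Longrightarrow> (\<And>n. c n \<in> piece X n) \<Longrightarrow> sum c I = 0 \<Longrightarrow> n \<in> I \<Longrightarrow> c n = 0"
  shows "graded_group X"
  unfolding graded_group_def
proof (intro conjI ballI allI)
  fix x
  assume "x \<in> carr X"
  then obtain c where c: "\<forall>n. c n \<in> piece X n" "finite {n. c n \<noteq> 0}" "x = (\<Sum>n | c n \<noteq> 0. c n)"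
    using assms(4) by (auto simp: homogeneous_sum_def)
  show "\<exists>!c. (\<forall>n. c n \<in> piece X n) \<and> finite {n. c n \<noteq> 0} \<and> x = (\<Sum>n | c n \<noteq> 0. c n)"
  proof (rule ex1I[of _ c], use c in blast)
    fix e
    assume e: "(\<forall>n. e n \<in> piece X n) \<and> finite {n. e n \<noteq> 0} \<and> x = (\<Sum>n | e n \<noteq> 0. e n)"
    let ?I = "{n. c n \<noteq> 0} \<union> {n. e n \<noteq> 0}"
    have "x = sum c ?I"
      unfolding c(3) by (rule sum.mono_neutral_left) (use c(2) e in auto)
    moreover have "x = (\<Sum>n | e n \<noteq> 0. e n)"
      using e by blast
    then have "x = sum e ?I"
      by (rule trans) (rule sum.mono_neutral_left, use c(2) e in auto)
    ultimately have "(\<Sum>n\<in>?I. e n - c n) = 0"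
      by (simp add: sum_subtractf)
    then have "e n - c n = 0" if "n \<in> ?I" for n
      using indep[of ?I "\<lambda>n. e n - c n" n] that c e add_subgroup_diff[OF assms(2)] by blast
    then have "e n = c n" for n
      by (cases "n \<in> ?I") auto
    then show "e = c" ..
  qed
qed (use assms(1-3) in auto)

text \<open>Covers level 0 of G^Sigma, both summands of its level 1 and the zero module. With
  \<open>S = UNIV\<close> it also serves as a trivial grading that opens
  \<open>free_graded_induct\<close> to all finitely supported functions.\<close>

definition concentrated :: "'a::ab_group_add set \<Rightarrow> int \<Rightarrow> 'a graded" where
  "concentrated S k = \<lparr>carr = S, piece = (\<lambda>n. if n = k then S else {0})\<rparr>"

lemma graded_group_concentrated:
  assumes "add_subgroup S"
  shows "graded_group (concentrated S k)"
proof (rule graded_groupI)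
  show sub: "add_subgroup (piece (concentrated S k) n)" for n
    using assms by (simp add: concentrated_def)
  show "homogeneous_sum (concentrated S k) x" if "x \<in> carr (concentrated S k)" for x
    by (rule homogeneous_sum_piece[OF sub, of _ k]) (use that in \<open>simp add: concentrated_def\<close>)
  fix I and c :: "int \<Rightarrow> 'a" and n
  assume *: "finite I" "\<And>n. c n \<in> piece (concentrated S k) n" "sum c I = 0" "n \<in> I"
  have "c j = 0" if "j \<noteq> k" for j
    using *(2)[of j] that by (simp add: concentrated_def)
  then have "sum c (I - {k}) = 0"
    by (intro sum.neutral) auto
  then have "sum c I = (if k \<in> I then c k else 0)"
    using *(1) by (auto simp: sum.remove[of I k])
  then show "c n = 0"
    using *(3,4) \<open>\<And>j. j \<noteq> k \<Longrightarrow> c j = 0\<close> by (cases "n = k") auto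
qed (use assms in \<open>auto simp: concentrated_def add_subgroup_0\<close>)

lemma add_subgroup_Times: "add_subgroup S \<Longrightarrow> add_subgroup T \<Longrightarrow> add_subgroup (S \<times> T)"
  by (auto simp: add_subgroup_def zero_prod_def)

lemma add_subgroup_TimesD:
  assumes "add_subgroup (S \<times> T)"
  shows "add_subgroup S" "add_subgroup T"
proof -
  have 0: "0 \<in> S" "0 \<in> T"
    using add_subgroup_0[OF assms] by (auto simp: zero_prod_def)
  show "add_subgroup S"
    unfolding add_subgroup_def
  proof (intro conjI ballI 0)
    show "x - y \<in> S" if "x \<in> S" "y \<in> S" for x y
      using add_subgroup_diff[OF assms, of "(x, 0)" "(y, 0)"] that 0 by simp
  qed
  show "add_subgroup T"
    unfolding add_subgroup_def
  proof (intro conjI ballI 0)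
    show "x - y \<in> T" if "x \<in> T" "y \<in> T" for x y
      using add_subgroup_diff[OF assms, of "(0, x)" "(0, y)"] that 0 by simp
  qed
qed

lemma graded_group_gprod:
  assumes "graded_group X" "graded_group Y"
  shows "graded_group (gprod X Y)"
proof (rule graded_groupI)
  show sub: "add_subgroup (piece (gprod X Y) n)" for n
    using assms by (simp add: gprod_def add_subgroup_Times graded_group_piece)
  note 0 = add_subgroup_0[OF graded_group_piece]
  have 1: "homogeneous_sum (gprod X Y) (x, 0)" if "x \<in> carr X" for x
    using assms(1) that
  proof (induction rule: graded_group_induct)
    case (add x y)
    then show ?case
      using homogeneous_sum_add[OF sub, of "(x, 0)" "(y, 0)"] by simp
  next
    case (piece n x)
    then show ?case
      using 0[OF assms(2)] by (intro homogeneous_sum_piece[OF sub, of _ n]) (simp add: gprod_def)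
  qed (use homogeneous_sum_0[OF sub] in \<open>simp add: zero_prod_def\<close>)
  have 2: "homogeneous_sum (gprod X Y) (0, y)" if "y \<in> carr Y" for y
    using assms(2) that
  proof (induction rule: graded_group_induct)
    case (add x y)
    then show ?case
      using homogeneous_sum_add[OF sub, of "(0, x)" "(0, y)"] by simp
  next
    case (piece n x)
    then show ?case
      using 0[OF assms(1)] by (intro homogeneous_sum_piece[OF sub, of _ n]) (simp add: gprod_def)
  qed (use homogeneous_sum_0[OF sub] in \<open>simp add: zero_prod_def\<close>)
  show "homogeneous_sum (gprod X Y) z" if "z \<in> carr (gprod X Y)" for z
    using homogeneous_sum_add[OF sub 1 2, of "fst z" "snd z"] that by (auto simp: gprod_def)
  fix I and c :: "int \<Rightarrow> 'a \<times> 'b" and n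
  assume *: "finite I" "\<And>n. c n \<in> piece (gprod X Y) n" "sum c I = 0" "n \<in> I"
  have c: "fst (c n) \<in> piece X n" "snd (c n) \<in> piece Y n" for n
    using *(2)[of n] by (auto simp: gprod_def)
  have "(\<Sum>n\<in>I. fst (c n)) = 0" "(\<Sum>n\<in>I. snd (c n)) = 0"
    using *(3) by (simp_all flip: fst_sum snd_sum)
  then have "fst (c n) = 0" "snd (c n) = 0"
    using graded_group_indep[OF assms(1) *(1), of id "\<lambda>n. fst (c n)", OF _ _ _ *(4)]
      graded_group_indep[OF assms(2) *(1), of id "\<lambda>n. snd (c n)", OF _ _ _ *(4)] c by simp_all
  then show "c n = 0"
    by (simp add: prod_eq_iff)
qed (use assms in \<open>auto simp: gprod_def add_subgroup_Times graded_group_carr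
      dest: graded_group_piece_carr\<close>)

text \<open>Applied to \<open>B1_graded\<close>, this yields the direct sum decompositions of R and
  of the suspended Steenrod algebra from the hypothesis that \<open>secB A\<close> is a pair
  algebra, in place of an argument on homogeneity of the Adem ideal.\<close>

lemma graded_group_gprodD:
  assumes "graded_group (gprod X Y)" 
  shows "graded_group X" "graded_group Y"
proof -
  have sub: "add_subgroup (carr X \<times> carr Y)" "\<And>n. add_subgroup (piece X n \<times> piece Y n)"
    and le: "\<And>n. piece X n \<times> piece Y n \<subseteq> carr X \<times> carr Y"
    using assms by (auto simp: graded_group_def gprod_def)
  note 0 = sub[THEN add_subgroup_0, unfolded zero_prod_def]
  have carr: "add_subgroup (carr X)" "add_subgroup (carr Y)"
    and piece_sub: "add_subgroup (piece X n)" "add_subgroup (piece Y n)" for n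
    using sub(1) sub(2)[of n] add_subgroup_TimesD by blast+
  have dec: "homogeneous_sum X (fst z) \<and> homogeneous_sum Y (snd z)" if "z \<in> carr (gprod X Y)" for z
    using assms that
  proof (induction rule: graded_group_induct)
    case (piece n x)
    then show ?case
      by (auto simp: gprod_def intro!: homogeneous_sum_piece[of _ _ n] piece_sub)
  qed (auto intro!: homogeneous_sum_0 homogeneous_sum_add piece_sub)
  have pair_sum: "(\<Sum>n\<in>I. (c n, 0)) = (sum c I, 0)" "(\<Sum>n\<in>I. (0, e n)) = (0, sum e I)"
    for I and c :: "int \<Rightarrow> 'a" and e :: "int \<Rightarrow> 'b"
    by (simp_all add: prod_eq_iff fst_sum snd_sum)
  show "graded_group X"
  proof (rule graded_groupI[OF carr(1) piece_sub(1)])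
    show "homogeneous_sum X x" if "x \<in> carr X" for x
      using dec[of "(x, 0)"] that 0 by (simp add: gprod_def)
    show "piece X n \<subseteq> carr X" for n
      using le[of n] 0(2)[of n] by auto
    show "c n = 0" if "finite I" "\<And>n. c n \<in> piece X n" "sum c I = 0" "n \<in> I" for I c n
      using graded_group_indep[OF assms that(1), of id "\<lambda>n. (c n, 0)", OF _ _ _ that(4)] that(2,3) 0(2)
      by (simp add: gprod_def pair_sum zero_prod_def)
  qed
  show "graded_group Y"
  proof (rule graded_groupI[OF carr(2) piece_sub(2)])
    show "homogeneous_sum Y y" if "y \<in> carr Y" for y
      using dec[of "(0, y)"] that 0 by (simp add: gprod_def)
    show "piece Y n \<subseteq> carr Y" for n
      using le[of n] 0(2)[of n] by auto
    show "c n = 0" if "finite I" "\<And>n. c n \<in> piece Y n" "sum c I = 0" "n \<in> I" for I c n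
      using graded_group_indep[OF assms that(1), of id "\<lambda>n. (0, c n)", OF _ _ _ that(4)] that(2,3) 0(2)
      by (simp add: gprod_def pair_sum zero_prod_def)
  qed
qed

section \<open>Finitely supported functions\<close>

lemma lookup_map_0: "h 0 = 0 \<Longrightarrow> Poly_Mapping.lookup (Poly_Mapping.map h f) k = h (Poly_Mapping.lookup f k)"
  by (simp add: Poly_Mapping.map.rep_eq when_def)

lemma map_map_0:
  "h 0 = 0 \<Longrightarrow> h' 0 = 0 \<Longrightarrow>
    Poly_Mapping.map h (Poly_Mapping.map h' f) = Poly_Mapping.map (\<lambda>x. h (h' x)) f"
  by (rule poly_mapping_eqI) (simp add: Poly_Mapping.map.rep_eq when_def)

lemma map_single_0: "h 0 = 0 \<Longrightarrow> Poly_Mapping.map h (Poly_Mapping.single g c) = Poly_Mapping.single g (h c)"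
  by (rule poly_mapping_eqI) (simp add: Poly_Mapping.map.rep_eq lookup_single when_def)

lemma map_zero [simp]: "Poly_Mapping.map h 0 = 0"
  by (rule poly_mapping_eqI) (simp add: Poly_Mapping.map.rep_eq)

lemma poly_mapping_sum_single:
  "(\<Sum>g\<in>Poly_Mapping.keys f. Poly_Mapping.single g (Poly_Mapping.lookup f g)) = f"
proof (rule poly_mapping_eqI)
  fix h
  have "(\<Sum>g\<in>Poly_Mapping.keys f. Poly_Mapping.lookup f g when g = h) = Poly_Mapping.lookup f h"
    by (auto simp: when_def in_keys_iff)
  then show "Poly_Mapping.lookup
      (\<Sum>g\<in>Poly_Mapping.keys f. Poly_Mapping.single g (Poly_Mapping.lookup f g)) h =
    Poly_Mapping.lookup f h"
    by (simp add: lookup_sum lookup_single)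
qed

text \<open>All partial sums of the expansion of \<open>f\<close> keep their generators in
  \<open>G\<close> and their coefficients in \<open>C\<close>. Carrying this along lets the additive
  step assume both summands in the module, as is needed for maps that are additive only
  there.\<close>

lemma poly_mapping_additive_induct:
  assumes "Poly_Mapping.keys f \<subseteq> G" "\<And>g. Poly_Mapping.lookup f g \<in> C"
    and "P 0" "\<And>g c. g \<in> G \<Longrightarrow> c \<in> C \<Longrightarrow> P (Poly_Mapping.single g c)"
    and "\<And>f f'. \<lbrakk>Poly_Mapping.keys f \<subseteq> G; \<And>g. Poly_Mapping.lookup f g \<in> C; P f; 
          Poly_Mapping.keys f' \<subseteq> G; \<And>g. Poly_Mapping.lookup f' g \<in> C; P f'\<rbrakk> \<Longrightarrow> P (f + f')"
    and C: "add_subgroup C"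
  shows "P f"
proof -
  let ?s = "\<lambda>I. \<Sum>g\<in>I. Poly_Mapping.single g (Poly_Mapping.lookup f g)"
  have "Poly_Mapping.keys (?s I) \<subseteq> G \<and> (\<forall>g. Poly_Mapping.lookup (?s I) g \<in> C) \<and> P (?s I)"
    if "finite I" "I \<subseteq> G" for I
    using that
  proof induction
    case empty
    then show ?case
      by (simp add: assms(3) add_subgroup_0[OF C])
  next
    case (insert g I)
    have 1: "Poly_Mapping.keys (Poly_Mapping.single g (Poly_Mapping.lookup f g)) \<subseteq> G"
      using insert.prems by simp
    have 2: "Poly_Mapping.lookup (Poly_Mapping.single g (Poly_Mapping.lookup f g)) h \<in> C" for h
      using assms(2) add_subgroup_0[OF C] by (simp add: lookup_single when_def)
    have 3: "Poly_Mapping.keys (?s I) \<subseteq> G" "\<And>g. Poly_Mapping.lookup (?s I) g \<in> C" "P (?s I)"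
      using insert by auto
    have "P (Poly_Mapping.single g (Poly_Mapping.lookup f g) + ?s I)"
      using insert.prems by (intro assms(5)[OF 1 2 _ 3] assms(4) assms(2)) auto
    moreover have "Poly_Mapping.keys (Poly_Mapping.single g (Poly_Mapping.lookup f g) + ?s I) \<subseteq> G"
      by (rule order.trans[OF keys_add Un_least[OF 1 3(1)]])
    moreover have "Poly_Mapping.lookup (Poly_Mapping.single g (Poly_Mapping.lookup f g) + ?s I) h \<in> C" for h
      unfolding lookup_add by (intro add_subgroup_add[OF C] 2 3(2))
    moreover have "?s (insert g I) = Poly_Mapping.single g (Poly_Mapping.lookup f g) + ?s I"
      by (rule sum.insert) (use insert.hyps in auto)
    ultimately show ?case
      by (simp only:) blast
  qed
  from this[of "Poly_Mapping.keys f"] show ?thesis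
    using assms(1) by (simp add: poly_mapping_sum_single)
qed

section \<open>Free modules as graded groups\<close>

lemma free_graded_carr_iff:
  "f \<in> carr (free_graded deg G X) \<longleftrightarrow>
     Poly_Mapping.keys f \<subseteq> G \<and> (\<forall>g. Poly_Mapping.lookup f g \<in> carr X)"
  by (simp add: free_graded_def)

lemma free_graded_piece_iff:
  "f \<in> piece (free_graded deg G X) n \<longleftrightarrow>
     Poly_Mapping.keys f \<subseteq> G \<and> (\<forall>g. Poly_Mapping.lookup f g \<in> piece X (n - int (deg g)))"
  by (simp add: free_graded_def)

lemma add_subgroup_free:
  assumes "\<And>g. add_subgroup (C g)"
  shows "add_subgroup {f :: 'g \<Rightarrow>\<^sub>0 'c::ab_group_add. Poly_Mapping.keys f \<subseteq> G \<and> (\<forall>g. Poly_Mapping.lookup f g \<in> C g)}"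
  unfolding add_subgroup_def
proof (intro conjI ballI CollectI)
  fix f f'
  assume *: "f \<in> {f. Poly_Mapping.keys f \<subseteq> G \<and> (\<forall>g. Poly_Mapping.lookup f g \<in> C g)}"
    "f' \<in> {f. Poly_Mapping.keys f \<subseteq> G \<and> (\<forall>g. Poly_Mapping.lookup f g \<in> C g)}"
  then show "Poly_Mapping.keys (f - f') \<subseteq> G"
    by (intro order.trans[OF keys_diff]) auto
  show "\<forall>g. Poly_Mapping.lookup (f - f') g \<in> C g"
    using * add_subgroup_diff[OF assms] by (simp add: lookup_minus)
qed (simp_all add: add_subgroup_0[OF assms])

lemma free_graded_induct [consumes 2, case_names zero single add]:
  assumes "graded_group X" "f \<in> carr (free_graded deg G X)"
    and "P 0" "\<And>g c. g \<in> G \<Longrightarrow> c \<in> carr X \<Longrightarrow> P (Poly_Mapping.single g c)"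
    and "\<And>f f'. \<lbrakk>f \<in> carr (free_graded deg G X); P f; f' \<in> carr (free_graded deg G X); P f'\<rbrakk>
            \<Longrightarrow> P (f + f')"
  shows "P f"
  using assms(2-5) graded_group_carr[OF assms(1)]
  unfolding free_graded_carr_iff
  by (intro poly_mapping_additive_induct[of f G "carr X" P]) auto

text \<open>Existence of decompositions is an induction over generators and, inside it, over the
  homogeneous parts of one coefficient. Independence is checked at each generator separately, with
  the injective shift n - deg g.\<close>

lemma graded_group_free:
  fixes X :: "'c::ab_group_add graded"
  assumes "graded_group X"
  shows "graded_group (free_graded deg G X)"
proof (rule graded_groupI)
  show sub: "add_subgroup (piece (free_graded deg G X) n)" for n
    using add_subgroup_free[of "\<lambda>g. piece X (n - int (deg g))" G] graded_group_piece[OF assms]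
    by (simp add: free_graded_def)
  show "add_subgroup (carr (free_graded deg G X))"
    using add_subgroup_free[of "\<lambda>g. carr X" G] graded_group_carr[OF assms]
    by (simp add: free_graded_def)
  show "piece (free_graded deg G X) n \<subseteq> carr (free_graded deg G X)" for n
    using graded_group_piece_carr[OF assms] by (fastforce simp: free_graded_carr_iff free_graded_piece_iff)
  show "homogeneous_sum (free_graded deg G X) f" if "f \<in> carr (free_graded deg G X)" for f
    using assms that
  proof (induction rule: free_graded_induct)
    case (single g c)
    show ?case
      using assms single(2)
    proof (induction rule: graded_group_induct)
      case (piece n c)
      then show ?case
        using single(1) add_subgroup_0[OF graded_group_piece[OF assms]]
        by (intro homogeneous_sum_piece[OF sub, of _ "n + int (deg g)"])
          (auto simp: free_graded_piece_iff lookup_single when_def)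
    qed (auto simp: single_add intro!: homogeneous_sum_0 homogeneous_sum_add sub)
  qed (auto intro!: homogeneous_sum_0 homogeneous_sum_add sub)
  fix I and c :: "int \<Rightarrow> 'a \<Rightarrow>\<^sub>0 'c" and n
  assume *: "finite I" "\<And>n. c n \<in> piece (free_graded deg G X) n" "sum c I = 0" "n \<in> I"
  show "c n = 0"
  proof (rule poly_mapping_eqI)
    fix g
    have "(\<Sum>n\<in>I. Poly_Mapping.lookup (c n) g) = 0"
      using *(3) by (simp flip: lookup_sum)
    then show "Poly_Mapping.lookup (c n) g = Poly_Mapping.lookup 0 g"
      using graded_group_indep[OF assms *(1), of "\<lambda>n. n - int (deg g)"
          "\<lambda>n. Poly_Mapping.lookup (c n) g", OF _ _ _ *(4)] *(2) by (simp add: free_graded_piece_iff inj_on_def)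
  qed
qed

text \<open>In contrast to \<open>graded_bilinear\<close> this is required on whole types. Ring
  multiplication and \<open>rmulB\<close> satisfy it; \<open>lmulB A\<close> need not, since A is
  arbitrary off \<open>relR\<close>.\<close>

definition biadditive ::
  "('a::ab_group_add \<Rightarrow> 'b::ab_group_add \<Rightarrow> 'c::ab_group_add) \<Rightarrow> bool" where
  "biadditive s \<longleftrightarrow>
     (\<forall>x x' y. s (x + x') y = s x y + s x' y) \<and> (\<forall>x y y'. s x (y + y') = s x y + s x y')"

lemma biadditive_times: "biadditive ((*) :: 'a::ring \<Rightarrow> 'a \<Rightarrow> 'a)"
  by (simp add: biadditive_def algebra_simps)

lemma biadditive_add_left: "biadditive s \<Longrightarrow> s (x + x') y = s x y + s x' y"
  by (simp add: biadditive_def)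

lemma biadditive_add_right: "biadditive s \<Longrightarrow> s x (y + y') = s x y + s x y'"
  by (simp add: biadditive_def)

lemma biadditive_0_left: "biadditive s \<Longrightarrow> s 0 y = 0"
  by (rule additive_0[OF add_subgroup_UNIV, of "\<lambda>x. s x y"]) (simp add: biadditive_def)

lemma biadditive_0_right: "biadditive s \<Longrightarrow> s x 0 = 0"
  by (rule additive_0[OF add_subgroup_UNIV, of "s x"]) (simp add: biadditive_def)

lemma map_add_fun:
  fixes u :: "'a::ab_group_add \<Rightarrow> 'b::ab_group_add"
  assumes "add_subgroup S" "\<And>x y. x \<in> S \<Longrightarrow> y \<in> S \<Longrightarrow> u (x + y) = u x + u y"
    and "\<And>g. Poly_Mapping.lookup f g \<in> S" "\<And>g. Poly_Mapping.lookup f' g \<in> S"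
  shows "Poly_Mapping.map u (f + f') = Poly_Mapping.map u f + Poly_Mapping.map u f'"
  using assms(3,4)
  by (intro poly_mapping_eqI)
    (simp add: lookup_map_0[of u, OF additive_0[OF assms(1,2)]] lookup_add assms(2))

lemma keys_map_subset: "Poly_Mapping.keys (Poly_Mapping.map h f) \<subseteq> Poly_Mapping.keys f"
  by (auto simp: Poly_Mapping.map.rep_eq in_keys_iff when_def)

section \<open>Linear maps given by their values on generators\<close>

lemma lookup_lin_ext:
  assumes "\<And>c. s c 0 = 0"
  shows "Poly_Mapping.lookup (lin_ext s D f) h =
    (\<Sum>g\<in>Poly_Mapping.keys f. s (Poly_Mapping.lookup f g) (Poly_Mapping.lookup (D g) h))"
  by (simp add: lin_ext_def lookup_sum lookup_map_0[of "s _", OF assms])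

lemma lin_ext_0 [simp]: "lin_ext s D 0 = 0"
  by (simp add: lin_ext_def)

lemma lin_ext_single:
  assumes "biadditive s"
  shows "lin_ext s D (Poly_Mapping.single g c) = Poly_Mapping.map (s c) (D g)"
proof (cases "c = 0")
  case True
  have "Poly_Mapping.map (s 0) (D g) = 0"
    by (rule poly_mapping_eqI) (simp add: Poly_Mapping.map.rep_eq biadditive_0_left[OF assms])
  then show ?thesis
    using True by (simp add: lin_ext_def)
qed (simp add: lin_ext_def)

lemma lin_ext_add:
  assumes "biadditive s"
  shows "lin_ext s D (f + f') = lin_ext s D f + lin_ext s D f'"
proof (rule poly_mapping_eqI)
  fix h
  let ?K = "Poly_Mapping.keys f \<union> Poly_Mapping.keys f'"
  have *: "(\<Sum>g\<in>Poly_Mapping.keys p. s (Poly_Mapping.lookup p g) (Poly_Mapping.lookup (D g) h)) =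
     (\<Sum>g\<in>?K. s (Poly_Mapping.lookup p g) (Poly_Mapping.lookup (D g) h))"
    if "Poly_Mapping.keys p \<subseteq> ?K" for p
    by (rule sum.mono_neutral_left)
      (use that in \<open>auto simp: in_keys_iff biadditive_0_left[OF assms]\<close>)
  show "Poly_Mapping.lookup (lin_ext s D (f + f')) h =
      Poly_Mapping.lookup (lin_ext s D f + lin_ext s D f') h"
    unfolding lookup_add[of "lin_ext s D f"] lookup_lin_ext[of s, OF biadditive_0_right[OF assms]] *[OF keys_add]
      *[OF Un_upper1] *[OF Un_upper2]
    by (simp add: lookup_add biadditive_add_left[OF assms] sum.distrib)
qed

lemma lin_ext_diff:
  assumes "biadditive s"
  shows "lin_ext s D (f - f') = lin_ext s D f - lin_ext s D f'"
  by (rule additive_diff[OF add_subgroup_UNIV]) (simp_all add: lin_ext_add[OF assms])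

text \<open>The common source of the commutation rules for differentials: \<open>u\<close> is
  applied to the result, \<open>v\<close> to the coefficients. It is used with \<open>u\<close> a
  projection (\<open>fst\<close>, \<open>snd\<close>, \<open>proj\<close>), a left multiplication,
  or A(a, -), which is additive only on the subgroup \<open>S = relR\<close>.\<close>

lemma map_lin_ext:
  assumes "biadditive s" "biadditive s'"
    and "add_subgroup S" "\<And>x y. x \<in> S \<Longrightarrow> y \<in> S \<Longrightarrow> u (x + y) = u x + u y" "v 0 = 0"
    and mem: "\<And>g h. g \<in> Poly_Mapping.keys f \<Longrightarrow>
      s (Poly_Mapping.lookup f g) (Poly_Mapping.lookup (D g) h) \<in> S"
    and eq: "\<And>g h. g \<in> Poly_Mapping.keys f \<Longrightarrow>
      u (s (Poly_Mapping.lookup f g) (Poly_Mapping.lookup (D g) h)) =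
      s' (v (Poly_Mapping.lookup f g)) (Poly_Mapping.lookup (D' g) h)"
  shows "Poly_Mapping.map u (lin_ext s D f) = lin_ext s' D' (Poly_Mapping.map v f)"
proof (rule poly_mapping_eqI)
  fix h
  let ?K = "Poly_Mapping.keys (Poly_Mapping.map v f)"
  have "(\<Sum>g\<in>?K. s' (v (Poly_Mapping.lookup f g)) (Poly_Mapping.lookup (D' g) h)) =
    (\<Sum>g\<in>Poly_Mapping.keys f. s' (v (Poly_Mapping.lookup f g)) (Poly_Mapping.lookup (D' g) h))"
    by (rule sum.mono_neutral_left)
      (auto simp: keys_map_subset in_keys_iff lookup_map_0 assms(5) biadditive_0_left[OF assms(2)])
  then show "Poly_Mapping.lookup (Poly_Mapping.map u (lin_ext s D f)) h =
      Poly_Mapping.lookup (lin_ext s' D' (Poly_Mapping.map v f)) h"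
    by (simp add: lookup_map_0[of u, OF additive_0[OF assms(3,4)]] lookup_map_0[of v, OF assms(5)]
        lookup_lin_ext[of s, OF biadditive_0_right[OF assms(1)]]
        lookup_lin_ext[of s', OF biadditive_0_right[OF assms(2)]]
        additive_sum[OF assms(3,4)] mem eq)
qed

text \<open>By associativity of the actions a composite of linear extensions is again one. This is
  how dd becomes the linear extension of \<open>ddg\<close> on both levels.\<close>

lemma lin_ext_lin_ext:
  assumes "biadditive s" "biadditive t" "biadditive s'" "biadditive t'"
    and assoc: "\<And>c k l. s (t c k) l = s' c (t' k l)"
  shows "lin_ext s D (lin_ext t E f) = lin_ext s' (\<lambda>g. lin_ext t' D (E g)) f"
proof -
  \<comment> \<open>The grading put here on the coefficients carries no information; it only makes
    the induction rule applicable.\<close>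
  have "f \<in> carr (free_graded (\<lambda>_. 0) UNIV (concentrated UNIV 0))"
    by (simp add: free_graded_carr_iff concentrated_def)
  with graded_group_concentrated[OF add_subgroup_UNIV] show ?thesis
  proof (induction rule: free_graded_induct)
    case (single g c)
    have "Poly_Mapping.map (s' c) (lin_ext t' D (E g)) = lin_ext s D (Poly_Mapping.map (t c) (E g))"
      by (rule map_lin_ext[OF assms(4,1) add_subgroup_UNIV])
        (auto simp: biadditive_0_right assms biadditive_add_right)
    then show ?case
      by (simp add: lin_ext_single assms)
  qed (simp_all add: lin_ext_add assms)
qed

lemma lin_ext_mem:
  assumes "biadditive s" "\<And>h. add_subgroup (C h)"
    and keys: "\<And>g. g \<in> Poly_Mapping.keys f \<Longrightarrow> Poly_Mapping.keys (D g) \<subseteq> G'"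
    and mem: "\<And>g h. g \<in> Poly_Mapping.keys f \<Longrightarrow>
      s (Poly_Mapping.lookup f g) (Poly_Mapping.lookup (D g) h) \<in> C h"
  shows "Poly_Mapping.keys (lin_ext s D f) \<subseteq> G'" "Poly_Mapping.lookup (lin_ext s D f) h \<in> C h"
proof -
  note [simp] = lookup_lin_ext[of s, OF biadditive_0_right[OF assms(1)]]
  show "Poly_Mapping.lookup (lin_ext s D f) h \<in> C h"
    by (simp add: add_subgroup_sum[OF assms(2)] mem)
  have "Poly_Mapping.lookup (D g) k = 0" if "k \<notin> G'" "g \<in> Poly_Mapping.keys f" for k g
    using keys[OF that(2)] that(1) by (auto simp: in_keys_iff)
  then have "Poly_Mapping.lookup (lin_ext s D f) k = 0" if "k \<notin> G'" for k
    using that by (simp add: biadditive_0_right[OF assms(1)])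
  then show "Poly_Mapping.keys (lin_ext s D f) \<subseteq> G'"
    by (metis in_keys_iff subsetI)
qed

lemma graded_hom_lin_ext:
  assumes "biadditive s" "graded_bilinear X Y Z s" "graded_group Y" "graded_group Z"
    and D: "\<And>g. g \<in> G \<Longrightarrow> D g \<in> piece (free_graded deg G' Y) (int (deg g))"
  shows "graded_hom (free_graded deg G X) (free_graded deg G' Z) (lin_ext s D)"
  unfolding graded_hom_def
proof (intro conjI ballI allI)
  have keys: "Poly_Mapping.keys (D g) \<subseteq> G'" if "g \<in> G" for g
    using D[OF that] by (simp add: free_graded_piece_iff)
  have lookup: "Poly_Mapping.lookup (D g) h \<in> piece Y (int (deg g) - int (deg h))" if "g \<in> G" for g h
    using D[OF that] by (simp add: free_graded_piece_iff)
  fix f f'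
  show "lin_ext s D (f + f') = lin_ext s D f + lin_ext s D f'"
    by (rule lin_ext_add[OF assms(1)])
  show "lin_ext s D f \<in> carr (free_graded deg G' Z)" if f: "f \<in> carr (free_graded deg G X)"
  proof -
    have "Poly_Mapping.keys (D g) \<subseteq> G' \<and> (\<forall>h.
        s (Poly_Mapping.lookup f g) (Poly_Mapping.lookup (D g) h) \<in> carr Z)"
      if "g \<in> Poly_Mapping.keys f" for g
    proof -
      have "g \<in> G" "Poly_Mapping.lookup f g \<in> carr X"
        using f that by (auto simp: free_graded_carr_iff)
      then show ?thesis
        using assms(2) keys graded_group_piece_carr[OF assms(3) lookup]
        unfolding graded_bilinear_def by blast
    qed
    then show ?thesis
      using lin_ext_mem[OF assms(1), of "\<lambda>_. carr Z" f D G'] graded_group_carr[OF assms(4)]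
      by (simp add: free_graded_carr_iff)
  qed
  show "lin_ext s D f \<in> piece (free_graded deg G' Z) n" if f: "f \<in> piece (free_graded deg G X) n" for n
  proof -
    have "Poly_Mapping.keys (D g) \<subseteq> G' \<and> (\<forall>h.
        s (Poly_Mapping.lookup f g) (Poly_Mapping.lookup (D g) h) \<in> piece Z (n - int (deg h)))"
      if "g \<in> Poly_Mapping.keys f" for g
    proof -
      have g: "g \<in> G" "Poly_Mapping.lookup f g \<in> piece X (n - int (deg g))"
        using f that by (auto simp: free_graded_piece_iff)
      then have "s (Poly_Mapping.lookup f g) (Poly_Mapping.lookup (D g) h)
          \<in> piece Z ((n - int (deg g)) + (int (deg g) - int (deg h)))" for h
        using assms(2) lookup unfolding graded_bilinear_def by blast
      then show ?thesis
        using keys[OF g(1)] by simp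
    qed
    then show ?thesis
      using lin_ext_mem[OF assms(1), of "\<lambda>h. piece Z (n - int (deg h))" f D G']
        graded_group_piece[OF assms(4)]
      by (simp add: free_graded_piece_iff)
  qed
qed

section \<open>Sums of coefficients\<close>

lemma coeff_sum_0 [simp]: "coeff_sum e 0 = 0"
  by (simp add: coeff_sum_def)

lemma coeff_sum_single: "e 0 = 0 \<Longrightarrow> coeff_sum e (Poly_Mapping.single g c) = e c"
  by (cases "c = 0") (simp_all add: coeff_sum_def)

lemma coeff_sum_add:
  fixes e :: "'c::ab_group_add \<Rightarrow> 'k::ab_group_add"
  assumes "\<And>x y. e (x + y) = e x + e y"
  shows "coeff_sum e (f + f') = coeff_sum e f + coeff_sum e f'"
proof -
  let ?K = "Poly_Mapping.keys f \<union> Poly_Mapping.keys f'"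
  have 0: "e 0 = 0"
    by (rule additive_0[OF add_subgroup_UNIV assms])
  have *: "coeff_sum e p = (\<Sum>g\<in>?K. e (Poly_Mapping.lookup p g))" if "Poly_Mapping.keys p \<subseteq> ?K" for p
    unfolding coeff_sum_def
    by (rule sum.mono_neutral_left) (use that in \<open>auto simp: in_keys_iff 0\<close>)
  show ?thesis
    unfolding *[OF keys_add] *[OF Un_upper1] *[OF Un_upper2]
    by (simp add: lookup_add assms sum.distrib)
qed

lemma coeff_sum_map:
  fixes u :: "'a::ab_group_add \<Rightarrow> 'b::ab_group_add"
  assumes "add_subgroup S" "\<And>x y. x \<in> S \<Longrightarrow> y \<in> S \<Longrightarrow> u (x + y) = u x + u y" "v 0 = 0" "e' 0 = 0"
    and "\<And>g. e (Poly_Mapping.lookup f g) \<in> S"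
    and "\<And>g. u (e (Poly_Mapping.lookup f g)) = e' (v (Poly_Mapping.lookup f g))"
  shows "u (coeff_sum e f) = coeff_sum e' (Poly_Mapping.map v f)"
proof -
  have "coeff_sum e' (Poly_Mapping.map v f) = (\<Sum>g\<in>Poly_Mapping.keys f. e' (v (Poly_Mapping.lookup f g)))"
    unfolding coeff_sum_def
    by (rule sum.mono_neutral_cong_left)
      (auto simp: keys_map_subset in_keys_iff lookup_map_0 assms(3,4))
  then show ?thesis
    unfolding coeff_sum_def using assms(5,6) by (simp add: additive_sum[OF assms(1,2)])
qed

text \<open>Meant for the vanishing of the composite of the augmentation with d, on both levels:
  already every single product of coefficients is killed.\<close>

lemma coeff_sum_lin_ext_eq_0:
  fixes e :: "'c::ab_group_add \<Rightarrow> 'k::ab_group_add"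
  assumes "biadditive s" "\<And>x y. e (x + y) = e x + e y"
    and "\<And>g h. g \<in> Poly_Mapping.keys f \<Longrightarrow>
      e (s (Poly_Mapping.lookup f g) (Poly_Mapping.lookup (D g) h)) = 0"
  shows "coeff_sum e (lin_ext s D f) = 0"
  unfolding coeff_sum_def lookup_lin_ext[of s, OF biadditive_0_right[OF assms(1)]]
  by (intro sum.neutral ballI) (simp add: additive_sum[OF add_subgroup_UNIV assms(2)] assms(3))

section \<open>Modules over pair algebras\<close>

lemma graded_homD:
  assumes "graded_hom X Y f"
  shows "x \<in> carr X \<Longrightarrow> f x \<in> carr Y"
    and "x \<in> carr X \<Longrightarrow> y \<in> carr X \<Longrightarrow> f (x + y) = f x + f y"
    and "x \<in> piece X n \<Longrightarrow> f x \<in> piece Y n"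
  using assms by (auto simp: graded_hom_def)

lemma graded_hom_0: "graded_group X \<Longrightarrow> graded_hom X Y f \<Longrightarrow> f 0 = 0"
  by (rule additive_0[OF graded_group_carr]) (auto simp: graded_homD)

lemma graded_bilinearD:
  assumes "graded_bilinear X Y Z f"
  shows "x \<in> carr X \<Longrightarrow> y \<in> carr Y \<Longrightarrow> f x y \<in> carr Z"
    and "x \<in> carr X \<Longrightarrow> x' \<in> carr X \<Longrightarrow> y \<in> carr Y \<Longrightarrow> f (x + x') y = f x y + f x' y"
    and "x \<in> carr X \<Longrightarrow> y \<in> carr Y \<Longrightarrow> y' \<in> carr Y \<Longrightarrow> f x (y + y') = f x y + f x y'"
    and "x \<in> piece X m \<Longrightarrow> y \<in> piece Y n \<Longrightarrow> f x y \<in> piece Z (m + n)"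
  using assms by (auto simp: graded_bilinear_def)

lemma graded_bilinear_0_right:
  "graded_group Y \<Longrightarrow> graded_bilinear X Y Z f \<Longrightarrow> x \<in> carr X \<Longrightarrow> f x 0 = 0"
  by (rule additive_0[OF graded_group_carr, of Y "f x"]) (auto simp: graded_bilinearD)

lemma graded_bilinear_free:
  fixes s :: "'a::ab_group_add \<Rightarrow> 'b::ab_group_add \<Rightarrow> 'c::ab_group_add"
  assumes "graded_group Y" "graded_bilinear X Y Z s" "graded_group X"
  shows "graded_bilinear X (free_graded deg G Y) (free_graded deg G Z) (\<lambda>b. Poly_Mapping.map (s b))"
proof -
  note bil = graded_bilinearD[OF assms(2)]
  have lookup: "Poly_Mapping.lookup (Poly_Mapping.map (s b) f) g = s b (Poly_Mapping.lookup f g)"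
    if "b \<in> carr X" for b g and f :: "'d \<Rightarrow>\<^sub>0 'b"
    using graded_bilinear_0_right[OF assms(1,2) that] by (rule lookup_map_0)
  have keys: "Poly_Mapping.keys (Poly_Mapping.map (s b) f) \<subseteq> G" if "Poly_Mapping.keys f \<subseteq> G" for b f
    by (rule order.trans[OF keys_map_subset that])
  have piece: "s b c \<in> piece Z (m + n - k)" if "b \<in> piece X m" "c \<in> piece Y (n - k)" for b c m n k
    using bil(4)[OF that] by (simp add: algebra_simps)
  show ?thesis
    unfolding graded_bilinear_def
    by (auto simp: free_graded_carr_iff free_graded_piece_iff keys lookup lookup_add bil piece
        graded_group_piece_carr[OF assms(3)] add_subgroup_add[OF graded_group_carr[OF assms(3)]] intro!: poly_mapping_eqI)
qed

lemma graded_hom_free: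
  assumes "graded_group X" "graded_hom X Y h"
  shows "graded_hom (free_graded deg G X) (free_graded deg G Y) (Poly_Mapping.map h)"
proof -
  have "Poly_Mapping.keys (Poly_Mapping.map h f) \<subseteq> G" if "Poly_Mapping.keys f \<subseteq> G" for f
    by (rule order.trans[OF keys_map_subset that])
  then show ?thesis
    unfolding graded_hom_def
    by (auto simp: free_graded_carr_iff free_graded_piece_iff lookup_map_0[of h, OF graded_hom_0[OF assms]]
        lookup_add graded_homD[OF assms(2)] intro!: poly_mapping_eqI)
qed

section \<open>Constructions of modules: free, regular, product and image\<close>

definition free_pair_module ::
  "('g \<Rightarrow> nat) \<Rightarrow> 'g set \<Rightarrow> ('r::ring_1, 'b::ab_group_add) pair_alg \<Rightarrow>
   ('r, 'b, 'g \<Rightarrow>\<^sub>0 'r, 'g \<Rightarrow>\<^sub>0 'b) pair_mod" where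
  "free_pair_module deg G B =
     \<lparr>mod0 = free_graded deg G (lev0 B), mod1 = free_graded deg G (lev1 B),
      act0 = (\<lambda>b. Poly_Mapping.map ((*) b)), act1 = (\<lambda>b. Poly_Mapping.map (lmul B b)),
      mbdry = Poly_Mapping.map (bdry B), mu = (\<lambda>\<beta>. Poly_Mapping.map (rmul B \<beta>))\<rparr>"

definition regular_pair_module ::
  "('r::ring_1, 'b::ab_group_add) pair_alg \<Rightarrow> ('r, 'b, 'r, 'b) pair_mod" where
  "regular_pair_module B =
     \<lparr>mod0 = lev0 B, mod1 = lev1 B, act0 = (*), act1 = lmul B, mbdry = bdry B, mu = rmul B\<rparr>"

text \<open>The modules of the sequence live in product types; each of them is such a product of a
  free module with G^Sigma or 0, so the axioms can be checked factor by factor.\<close>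

definition prod_pair_module ::
  "('r, 'b, 'x, 'y) pair_mod \<Rightarrow> ('r, 'b, 'v, 'w) pair_mod \<Rightarrow> ('r, 'b, 'x \<times> 'v, 'y \<times> 'w) pair_mod" where
  "prod_pair_module M N =
     \<lparr>mod0 = gprod (mod0 M) (mod0 N), mod1 = gprod (mod1 M) (mod1 N),
      act0 = (\<lambda>b (x, v). (act0 M b x, act0 N b v)), act1 = (\<lambda>b (y, w). (act1 M b y, act1 N b w)),
      mbdry = (\<lambda>(y, w). (mbdry M y, mbdry N w)), mu = (\<lambda>\<beta> (x, v). (mu M \<beta> x, mu N \<beta> v))\<rparr>"

lemma pair_module_regular:
  assumes "pair_algebra B"
  shows "pair_module B (regular_pair_module B)"
proof -
  have "x \<in> carr (lev0 B) \<Longrightarrow> bdry B \<beta> * x = bdry B (rmul B \<beta> x)"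
    if "\<beta> \<in> carr (lev1 B)" for x \<beta>
    using assms that by (simp add: pair_algebra_def)
  then show ?thesis
    using assms
    by (simp add: pair_algebra_def pair_module_def regular_pair_module_def graded_left_module_def
        graded_right_module_def graded_ring_def left_linear_def mult.assoc)
qed

lemma graded_left_module_free:
  assumes "graded_ring R" "graded_left_module R X s"
  shows "graded_left_module R (free_graded deg G X) (\<lambda>b. Poly_Mapping.map (s b))"
proof -
  have R: "graded_group R" "1 \<in> carr R" "\<And>a b. a \<in> carr R \<Longrightarrow> b \<in> carr R \<Longrightarrow> a * b \<in> carr R"
    using assms(1) by (auto simp: graded_ring_def graded_bilinear_def dest: graded_group_piece_carr)
  have X: "graded_group X" "graded_bilinear R X X s"
    using assms(2) by (auto simp: graded_left_module_def)
  have s: "\<And>b. b \<in> carr R \<Longrightarrow> s b 0 = 0"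
    by (rule graded_bilinear_0_right[OF X])
  show ?thesis
    using assms(2) R(2,3) s
    unfolding graded_left_module_def
    by (auto simp: graded_group_free[OF X(1)] graded_bilinear_free[OF X R(1)] lookup_map_0[of "s _"]
        free_graded_carr_iff intro!: poly_mapping_eqI)
qed

lemma pair_module_free:
  assumes "pair_algebra B"
  shows "pair_module B (free_pair_module deg G B)"
proof -
  have B: "graded_ring (lev0 B)" "graded_group (lev0 B)" "graded_group (lev1 B)"
    "graded_left_module (lev0 B) (lev1 B) (lmul B)" "graded_left_module (lev0 B) (lev0 B) (*)"
    "graded_bilinear (lev1 B) (lev0 B) (lev1 B) (rmul B)"
    "graded_bilinear (lev0 B) (lev1 B) (lev1 B) (lmul B)"
    "graded_hom (lev1 B) (lev0 B) (bdry B)"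
    using assms
    by (auto simp: pair_algebra_def graded_ring_def graded_left_module_def graded_right_module_def
        mult.assoc)
  have zero: "a \<in> carr (lev0 B) \<Longrightarrow> lmul B a 0 = 0" "x \<in> carr (lev1 B) \<Longrightarrow> rmul B x 0 = 0"
    "bdry B 0 = 0" for a x
    using graded_bilinear_0_right[OF B(3,7)] graded_bilinear_0_right[OF B(2,6)]
      graded_hom_0[OF B(3,8)] by auto
  have mem: "\<beta> \<in> carr (lev1 B) \<Longrightarrow> b \<in> carr (lev0 B) \<Longrightarrow> rmul B \<beta> b \<in> carr (lev1 B)"
    "\<beta> \<in> carr (lev1 B) \<Longrightarrow> b \<in> carr (lev0 B) \<Longrightarrow> lmul B b \<beta> \<in> carr (lev1 B)"
    "\<beta> \<in> carr (lev1 B) \<Longrightarrow> bdry B \<beta> \<in> carr (lev0 B)" for \<beta> b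
    by (auto simp: graded_bilinearD[OF B(6)] graded_bilinearD[OF B(7)] graded_homD[OF B(8)])
  have rules: "\<beta> \<in> carr (lev1 B) \<Longrightarrow> a \<in> carr (lev0 B) \<Longrightarrow> b \<in> carr (lev0 B) \<Longrightarrow>
        rmul B \<beta> (a * b) = rmul B (rmul B \<beta> a) b"
    "\<beta> \<in> carr (lev1 B) \<Longrightarrow> a \<in> carr (lev0 B) \<Longrightarrow> b \<in> carr (lev0 B) \<Longrightarrow>
        rmul B (lmul B a \<beta>) b = lmul B a (rmul B \<beta> b)"
    "a \<in> carr (lev0 B) \<Longrightarrow> \<beta> \<in> carr (lev1 B) \<Longrightarrow> bdry B (lmul B a \<beta>) = a * bdry B \<beta>"
    "a \<in> carr (lev0 B) \<Longrightarrow> \<beta> \<in> carr (lev1 B) \<Longrightarrow> bdry B (rmul B \<beta> a) = bdry B \<beta> * a"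
    "\<beta> \<in> carr (lev1 B) \<Longrightarrow> \<gamma> \<in> carr (lev1 B) \<Longrightarrow> lmul B (bdry B \<beta>) \<gamma> = rmul B \<beta> (bdry B \<gamma>)"
    for a b \<beta> \<gamma>
    using assms unfolding pair_algebra_def graded_right_module_def by metis+
  note lookup = lookup_map_0[of "bdry B"] lookup_map_0[of "lmul B _"] lookup_map_0[of "rmul B _"]
    lookup_map_0[of "(*) _"]
  show ?thesis
    unfolding pair_module_def free_pair_module_def pair_mod.simps left_linear_def
    by (intro conjI graded_left_module_free[OF B(1,4)] graded_left_module_free[OF B(1,5)]
        graded_bilinear_free[OF B(2,6,3)] graded_hom_free[OF B(3,8)] ballI poly_mapping_eqI)
      (auto simp: free_graded_carr_iff lookup zero mem rules)
qed

lemma gprod_carr: "carr (gprod X Y) = carr X \<times> carr Y"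
  and gprod_piece: "piece (gprod X Y) n = piece X n \<times> piece Y n"
  by (simp_all add: gprod_def)

lemma pair_module_prod:
  assumes "pair_module B M" "pair_module B N"
  shows "pair_module B (prod_pair_module M N)"
  using assms
  unfolding pair_module_def prod_pair_module_def pair_mod.simps graded_left_module_def left_linear_def
    graded_bilinear_def graded_hom_def
  by (simp add: graded_group_gprod gprod_carr gprod_piece Ball_def)

text \<open>The equational axioms pass to the image of a surjection that respects all operations. A
  direct sum decomposition does not pass to images, so the two graded groups underlying
  \<open>N\<close> are supplied separately.\<close>

lemma pair_module_image:
  assumes M: "pair_module B M" and N: "graded_group (mod0 N)" "graded_group (mod1 N)"
    and e0: "carr (mod0 N) = e0 ` carr (mod0 M)" "\<And>n. piece (mod0 N) n = e0 ` piece (mod0 M) n"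
      "\<And>x y. x \<in> carr (mod0 M) \<Longrightarrow> y \<in> carr (mod0 M) \<Longrightarrow> e0 (x + y) = e0 x + e0 y"
    and e1: "carr (mod1 N) = e1 ` carr (mod1 M)" "\<And>n. piece (mod1 N) n = e1 ` piece (mod1 M) n"
      "\<And>x y. x \<in> carr (mod1 M) \<Longrightarrow> y \<in> carr (mod1 M) \<Longrightarrow> e1 (x + y) = e1 x + e1 y"
    and act0: "\<And>b x. b \<in> carr (lev0 B) \<Longrightarrow> x \<in> carr (mod0 M) \<Longrightarrow> act0 N b (e0 x) = e0 (act0 M b x)"
    and act1: "\<And>b y. b \<in> carr (lev0 B) \<Longrightarrow> y \<in> carr (mod1 M) \<Longrightarrow> act1 N b (e1 y) = e1 (act1 M b y)"
    and bd: "\<And>y. y \<in> carr (mod1 M) \<Longrightarrow> mbdry N (e1 y) = e0 (mbdry M y)"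
    and mu: "\<And>\<beta> x. \<beta> \<in> carr (lev1 B) \<Longrightarrow> x \<in> carr (mod0 M) \<Longrightarrow> mu N \<beta> (e0 x) = e1 (mu M \<beta> x)"
    and B: "pair_algebra B"
  shows "pair_module B N" "pair_module_hom B M N e0 e1"
proof -
  have B': "1 \<in> carr (lev0 B)" "\<And>a b. a \<in> carr (lev0 B) \<Longrightarrow> b \<in> carr (lev0 B) \<Longrightarrow> a * b \<in> carr (lev0 B)"
    "\<And>a b. a \<in> carr (lev0 B) \<Longrightarrow> b \<in> carr (lev0 B) \<Longrightarrow> a + b \<in> carr (lev0 B)"
    "\<And>n b. b \<in> piece (lev0 B) n \<Longrightarrow> b \<in> carr (lev0 B)"
    "\<And>n b. b \<in> piece (lev1 B) n \<Longrightarrow> b \<in> carr (lev1 B)"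
    "\<And>a b. a \<in> carr (lev1 B) \<Longrightarrow> b \<in> carr (lev1 B) \<Longrightarrow> a + b \<in> carr (lev1 B)"
    "\<And>a b. a \<in> carr (lev0 B) \<Longrightarrow> b \<in> carr (lev1 B) \<Longrightarrow> lmul B a b \<in> carr (lev1 B)"
    "\<And>a b. a \<in> carr (lev0 B) \<Longrightarrow> b \<in> carr (lev1 B) \<Longrightarrow> rmul B b a \<in> carr (lev1 B)"
    "\<And>b. b \<in> carr (lev1 B) \<Longrightarrow> bdry B b \<in> carr (lev0 B)"
    using B add_subgroup_add graded_group_carr
    by (auto simp: pair_algebra_def graded_ring_def graded_left_module_def graded_right_module_def
        graded_bilinear_def graded_hom_def dest: graded_group_piece_carr)
  have M': "\<And>x y. x \<in> carr (mod0 M) \<Longrightarrow> y \<in> carr (mod0 M) \<Longrightarrow> x + y \<in> carr (mod0 M)"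
    "\<And>x y. x \<in> carr (mod1 M) \<Longrightarrow> y \<in> carr (mod1 M) \<Longrightarrow> x + y \<in> carr (mod1 M)"
    "\<And>n b. b \<in> piece (mod0 M) n \<Longrightarrow> b \<in> carr (mod0 M)"
    "\<And>n b. b \<in> piece (mod1 M) n \<Longrightarrow> b \<in> carr (mod1 M)"
    using M add_subgroup_add graded_group_carr
    by (auto simp: pair_module_def graded_left_module_def dest: graded_group_piece_carr)
  note rules = e0(3)[symmetric] e1(3)[symmetric] act0 act1 bd mu B' M' N
  have M'': "graded_bilinear (lev0 B) (mod0 M) (mod0 M) (act0 M)"
    "graded_bilinear (lev0 B) (mod1 M) (mod1 M) (act1 M)"
    "graded_bilinear (lev1 B) (mod0 M) (mod1 M) (mu M)"
    "graded_hom (mod1 M) (mod0 M) (mbdry M)"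
    using M by (auto simp: pair_module_def graded_left_module_def)
  note mem = graded_bilinearD[OF M''(1)] graded_bilinearD[OF M''(2)] graded_bilinearD[OF M''(3)]
     graded_homD[OF M''(4)]
  have "graded_left_module (lev0 B) (mod0 N) (act0 N)"
    using M unfolding pair_module_def graded_left_module_def
    by (simp add: graded_bilinear_def e0(1,2) rules mem ball_simps)
  moreover have "graded_left_module (lev0 B) (mod1 N) (act1 N)"
    using M unfolding pair_module_def graded_left_module_def
    by (simp add: graded_bilinear_def e1(1,2) rules mem ball_simps)
  moreover have "graded_hom (mod1 N) (mod0 N) (mbdry N)"
    by (simp add: graded_hom_def e0(1,2) e1(1,2) rules mem)
  moreover have "graded_bilinear (lev1 B) (mod0 N) (mod1 N) (mu N)"
    by (simp add: graded_bilinear_def e0(1,2) e1(1,2) rules mem)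
  ultimately show "pair_module B N"
    using M unfolding pair_module_def
    by (simp add: left_linear_def e0(1,2) e1(1,2) rules mem)
  show "pair_module_hom B M N e0 e1"
    unfolding pair_module_hom_def left_linear_def graded_hom_def
    by (auto simp: rules mem e0(1,2) e1(1,2))
qed

text \<open>The zero module is the image of the regular module under the zero maps.\<close>

lemma pair_module_zero:
  assumes B: "pair_algebra B" and "mod0 N = zero_graded" "mod1 N = zero_graded"
    and "\<And>b. b \<in> carr (lev0 B) \<Longrightarrow> act0 N b 0 = 0" "\<And>b. b \<in> carr (lev0 B) \<Longrightarrow> act1 N b 0 = 0"
    and "mbdry N 0 = 0" "\<And>\<beta>. \<beta> \<in> carr (lev1 B) \<Longrightarrow> mu N \<beta> 0 = 0"
  shows "pair_module B N"
proof -
  have 0: "zero_graded = concentrated {0} 0"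
    by (auto simp: zero_graded_def concentrated_def)
  have gr: "graded_group (lev0 B)" "graded_group (lev1 B)"
    using B by (auto simp: pair_algebra_def graded_ring_def graded_left_module_def)
  have ne: "0 \<in> carr (lev0 B)" "0 \<in> carr (lev1 B)" "\<And>n. 0 \<in> piece (lev0 B) n" "\<And>n. 0 \<in> piece (lev1 B) n"
    using gr add_subgroup_0 graded_group_carr graded_group_piece by blast+
  show ?thesis
    by (rule pair_module_image(1)[OF pair_module_regular[OF B], of N "\<lambda>_. 0" "\<lambda>_. 0"])
      (use ne assms graded_group_concentrated[of "{0}" 0]
        in \<open>auto simp: regular_pair_module_def zero_graded_def concentrated_def\<close>)
qed

lemma pair_module_act_0:
  assumes "pair_module B M"
  shows "b \<in> carr (lev0 B) \<Longrightarrow> act0 M b 0 = 0" "b \<in> carr (lev0 B) \<Longrightarrow> act1 M b 0 = 0"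
    "\<beta> \<in> carr (lev1 B) \<Longrightarrow> mu M \<beta> 0 = 0" "mbdry M 0 = 0"
  using assms
  by (auto simp: pair_module_def graded_left_module_def graded_bilinear_0_right graded_hom_0)

lemma pair_module_0_mem:
  assumes "pair_module B M"
  shows "0 \<in> carr (mod0 M)" "0 \<in> carr (mod1 M)" "0 \<in> piece (mod0 M) n" "0 \<in> piece (mod1 M) n"
  using assms
  by (auto simp: pair_module_def graded_left_module_def
      intro!: add_subgroup_0 graded_group_carr graded_group_piece)

section \<open>Morphisms between these modules\<close>

lemma pair_module_hom_prod_diag:
  assumes "pair_module_hom B M M' f0 f1" "pair_module B N'"
  shows "pair_module_hom B (prod_pair_module M N) (prod_pair_module M' N')
    (\<lambda>(x, v). (f0 x, 0)) (\<lambda>(y, w). (f1 y, 0))"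
  using assms(1)
  unfolding pair_module_hom_def prod_pair_module_def pair_mod.simps left_linear_def graded_hom_def
  by (simp add: gprod_carr gprod_piece Ball_def pair_module_act_0[OF assms(2)]
      pair_module_0_mem[OF assms(2)])

text \<open>The shape of the augmentation, which leads from the free module in the first factor to
  G^Sigma in the second. The differentials stay in the first factor and have the preceding
  shape.\<close>

lemma pair_module_hom_prod_offdiag:
  assumes "pair_module_hom B M N' e0 e1" "pair_module B M'"
  shows "pair_module_hom B (prod_pair_module M N) (prod_pair_module M' N')
    (\<lambda>(x, v). (0, e0 x)) (\<lambda>(y, w). (0, e1 y))"
  using assms(1)
  unfolding pair_module_hom_def prod_pair_module_def pair_mod.simps left_linear_def graded_hom_def
  by (simp add: gprod_carr gprod_piece Ball_def pair_module_act_0[OF assms(2)]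
      pair_module_0_mem[OF assms(2)])

text \<open>Coefficients are multiplied from the right by the entries of \<open>D\<close>, so
  linearity is the compatibility of the two actions of a bimodule, and compatibility with
  \<open>mu\<close> is associativity of the right action.\<close>

lemma pair_module_hom_lin_ext:
  assumes B: "pair_algebra B" and rmul: "biadditive (rmul B)"
    and D: "\<And>g. g \<in> G \<Longrightarrow> D g \<in> piece (free_graded deg G' (lev0 B)) (int (deg g))"
  shows "pair_module_hom B (free_pair_module deg G B) (free_pair_module deg G' B)
    (lin_ext (*) D) (lin_ext (rmul B) D)"
proof -
  have B': "graded_bilinear (lev0 B) (lev0 B) (lev0 B) (*)" "graded_group (lev0 B)" "graded_group (lev1 B)"
    "graded_bilinear (lev1 B) (lev0 B) (lev1 B) (rmul B)" "graded_bilinear (lev0 B) (lev1 B) (lev1 B) (lmul B)"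
    "graded_hom (lev1 B) (lev0 B) (bdry B)"
    using B by (auto simp: pair_algebra_def graded_ring_def graded_left_module_def graded_right_module_def)
  have assoc: "a \<in> carr (lev0 B) \<Longrightarrow> x \<in> carr (lev1 B) \<Longrightarrow> b \<in> carr (lev0 B) \<Longrightarrow>
        rmul B (lmul B a x) b = lmul B a (rmul B x b)"
    "x \<in> carr (lev1 B) \<Longrightarrow> a \<in> carr (lev0 B) \<Longrightarrow> b \<in> carr (lev0 B) \<Longrightarrow>
        rmul B x (a * b) = rmul B (rmul B x a) b"
    "x \<in> carr (lev1 B) \<Longrightarrow> a \<in> carr (lev0 B) \<Longrightarrow> bdry B (rmul B x a) = bdry B x * a" for a b x
    using B by (auto simp: pair_algebra_def graded_right_module_def)
  have lookup_D: "Poly_Mapping.lookup (D g) h \<in> carr (lev0 B)" if "g \<in> G" for g h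
    using D[OF that] graded_group_piece_carr[OF B'(2)] by (auto simp: free_graded_piece_iff)
  have mem: "Poly_Mapping.keys f \<subseteq> G" "\<And>g. Poly_Mapping.lookup f g \<in> carr X"
    if "f \<in> carr (free_graded deg G X)" for f and X :: "'z::zero graded"
    using that by (auto simp: free_graded_carr_iff)
  show ?thesis
    unfolding pair_module_hom_def free_pair_module_def pair_mod.simps left_linear_def
  proof (intro conjI ballI)
    show "graded_hom (free_graded deg G (lev0 B)) (free_graded deg G' (lev0 B)) (lin_ext (*) D)"
      by (rule graded_hom_lin_ext[OF biadditive_times B'(1,2,2) D])
    show "graded_hom (free_graded deg G (lev1 B)) (free_graded deg G' (lev1 B)) (lin_ext (rmul B) D)"
      by (rule graded_hom_lin_ext[OF rmul B'(4,2,3) D])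
    fix b f
    assume "b \<in> carr (lev0 B)"
    show "lin_ext (*) D (Poly_Mapping.map ((*) b) f) = Poly_Mapping.map ((*) b) (lin_ext (*) D f)"
      by (rule map_lin_ext[symmetric, OF biadditive_times biadditive_times add_subgroup_UNIV])
        (auto simp: algebra_simps)
  next
    fix b f
    assume b: "b \<in> carr (lev0 B)" and f: "f \<in> carr (free_graded deg G (lev1 B))"
    show "lin_ext (rmul B) D (Poly_Mapping.map (lmul B b) f) =
        Poly_Mapping.map (lmul B b) (lin_ext (rmul B) D f)"
      by (rule map_lin_ext[symmetric, OF rmul rmul graded_group_carr[OF B'(3)]])
        (use b mem[OF f] lookup_D assoc graded_bilinearD[OF B'(4)] graded_bilinearD[OF B'(5)]
          graded_bilinear_0_right[OF B'(3,5)] in auto)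
  next
    fix f
    assume f: "f \<in> carr (free_graded deg G (lev1 B))"
    show "lin_ext (*) D (Poly_Mapping.map (bdry B) f) =
        Poly_Mapping.map (bdry B) (lin_ext (rmul B) D f)"
      by (rule map_lin_ext[symmetric, OF rmul biadditive_times graded_group_carr[OF B'(3)]])
        (use mem[OF f] lookup_D assoc graded_bilinearD[OF B'(4)] graded_homD[OF B'(6)]
          graded_hom_0[OF B'(3,6)] in auto)
  next
    fix \<beta> f
    assume b: "\<beta> \<in> carr (lev1 B)" and f: "f \<in> carr (free_graded deg G (lev0 B))"
    show "lin_ext (rmul B) D (Poly_Mapping.map (rmul B \<beta>) f) =
        Poly_Mapping.map (rmul B \<beta>) (lin_ext (*) D f)"
      by (rule map_lin_ext[symmetric, OF biadditive_times rmul add_subgroup_UNIV])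
        (use b mem[OF f] lookup_D assoc in
          \<open>auto simp: biadditive_add_right[OF rmul] biadditive_0_right[OF rmul]\<close>)
  qed
qed

lemma graded_hom_coeff_sum:
  assumes "graded_hom X Y e" "\<And>x y. e (x + y) = e x + e y" "graded_group Y"
    and deg: "\<And>g. g \<in> G \<Longrightarrow> deg g = 0"
  shows "graded_hom (free_graded deg G X) Y (coeff_sum e)"
  unfolding graded_hom_def
proof (intro conjI ballI allI)
  show "coeff_sum e (f + f') = coeff_sum e f + coeff_sum e f'" for f f'
    by (rule coeff_sum_add[OF assms(2)])
  show "coeff_sum e f \<in> carr Y" if "f \<in> carr (free_graded deg G X)" for f
    using that unfolding coeff_sum_def
    by (intro add_subgroup_sum[OF graded_group_carr[OF assms(3)]])
      (auto simp: free_graded_carr_iff graded_homD[OF assms(1)])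
  show "coeff_sum e f \<in> piece Y n" if f: "f \<in> piece (free_graded deg G X) n" for f n
    unfolding coeff_sum_def
  proof (rule add_subgroup_sum[OF graded_group_piece[OF assms(3)]])
    fix g
    assume "g \<in> Poly_Mapping.keys f"
    then have "g \<in> G"
      using f by (auto simp: free_graded_piece_iff)
    moreover have "Poly_Mapping.lookup f g \<in> piece X (n - int (deg g))"
      using f by (simp add: free_graded_piece_iff)
    ultimately show "e (Poly_Mapping.lookup f g) \<in> piece Y n"
      using graded_homD(3)[OF assms(1)] deg by fastforce
  qed
qed

text \<open>Extends a morphism out of the regular module to a free module with the same value on
  every generator. Adding up coefficients preserves degrees because the generators sit in degree
  0.\<close>

lemma pair_module_hom_coeff_sum:
  assumes B: "pair_algebra B" and N: "pair_module B N"
    and e: "pair_module_hom B (regular_pair_module B) N e0 e1"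
    and add: "\<And>x y. e0 (x + y) = e0 x + e0 y" "\<And>x y. e1 (x + y) = e1 x + e1 y"
    and deg: "\<And>g. g \<in> G \<Longrightarrow> deg g = 0"
  shows "pair_module_hom B (free_pair_module deg G B) N (coeff_sum e0) (coeff_sum e1)"
proof -
  have N': "graded_group (mod0 N)" "graded_group (mod1 N)" "graded_hom (mod1 N) (mod0 N) (mbdry N)"
    "graded_bilinear (lev0 B) (mod0 N) (mod0 N) (act0 N)"
    "graded_bilinear (lev0 B) (mod1 N) (mod1 N) (act1 N)"
    "graded_bilinear (lev1 B) (mod0 N) (mod1 N) (mu N)"
    using N by (auto simp: pair_module_def graded_left_module_def)
  have e': "graded_hom (lev0 B) (mod0 N) e0" "graded_hom (lev1 B) (mod1 N) e1"
    "b \<in> carr (lev0 B) \<Longrightarrow> x \<in> carr (lev0 B) \<Longrightarrow> act0 N b (e0 x) = e0 (b * x)"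
    "b \<in> carr (lev0 B) \<Longrightarrow> y \<in> carr (lev1 B) \<Longrightarrow> act1 N b (e1 y) = e1 (lmul B b y)"
    "y \<in> carr (lev1 B) \<Longrightarrow> mbdry N (e1 y) = e0 (bdry B y)"
    "\<beta> \<in> carr (lev1 B) \<Longrightarrow> x \<in> carr (lev0 B) \<Longrightarrow> mu N \<beta> (e0 x) = e1 (rmul B \<beta> x)" for b x y \<beta>
    using e by (simp_all add: pair_module_hom_def regular_pair_module_def left_linear_def)
  have 0: "e0 0 = 0" "e1 0 = 0"
    by (rule additive_0[OF add_subgroup_UNIV add(1)], rule additive_0[OF add_subgroup_UNIV add(2)])
  have zero: "a \<in> carr (lev0 B) \<Longrightarrow> lmul B a 0 = 0" "x \<in> carr (lev1 B) \<Longrightarrow> rmul B x 0 = 0"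
    "bdry B 0 = 0" for a x
    using pair_module_act_0[OF pair_module_regular[OF B]] by (simp_all add: regular_pair_module_def)
  have mem: "Poly_Mapping.lookup f g \<in> carr X"
    if "f \<in> carr (free_graded deg G X)" for f g and X :: "'z::zero graded"
    using that by (auto simp: free_graded_carr_iff)
  show ?thesis
    unfolding pair_module_hom_def free_pair_module_def pair_mod.simps left_linear_def
  proof (intro conjI ballI)
    show "graded_hom (free_graded deg G (lev0 B)) (mod0 N) (coeff_sum e0)"
      by (rule graded_hom_coeff_sum[OF e'(1) add(1) N'(1) deg])
    show "graded_hom (free_graded deg G (lev1 B)) (mod1 N) (coeff_sum e1)"
      by (rule graded_hom_coeff_sum[OF e'(2) add(2) N'(2) deg])
    fix b f
    assume "b \<in> carr (lev0 B)" "f \<in> carr (free_graded deg G (lev0 B))"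
    then show "coeff_sum e0 (Poly_Mapping.map ((*) b) f) = act0 N b (coeff_sum e0 f)"
      by (intro coeff_sum_map[symmetric, OF graded_group_carr[OF N'(1)]])
        (auto simp: mem 0 e' graded_bilinearD[OF N'(4)] graded_homD[OF e'(1)])
  next
    fix b f
    assume "b \<in> carr (lev0 B)" "f \<in> carr (free_graded deg G (lev1 B))"
    then show "coeff_sum e1 (Poly_Mapping.map (lmul B b) f) = act1 N b (coeff_sum e1 f)"
      by (intro coeff_sum_map[symmetric, OF graded_group_carr[OF N'(2)]])
        (auto simp: mem 0 e' zero graded_bilinearD[OF N'(5)] graded_homD[OF e'(2)])
  next
    fix f
    assume "f \<in> carr (free_graded deg G (lev1 B))"
    then show "coeff_sum e0 (Poly_Mapping.map (bdry B) f) = mbdry N (coeff_sum e1 f)"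
      by (intro coeff_sum_map[symmetric, OF graded_group_carr[OF N'(2)]])
        (auto simp: mem 0 e' zero graded_homD[OF N'(3)] graded_homD[OF e'(2)])
  next
    fix \<beta> f
    assume "\<beta> \<in> carr (lev1 B)" "f \<in> carr (free_graded deg G (lev0 B))"
    then show "coeff_sum e1 (Poly_Mapping.map (rmul B \<beta>) f) = mu N \<beta> (coeff_sum e0 f)"
      by (intro coeff_sum_map[symmetric, OF graded_group_carr[OF N'(1)]])
        (auto simp: mem 0 e' zero graded_bilinearD[OF N'(6)] graded_homD[OF e'(1)])
  qed
qed

section \<open>Reduction modulo two\<close>

lemma four_cases: "(x :: 4) = 0 \<or> x = 1 \<or> x = 2 \<or> x = 3"
proof (cases x rule: bit0_cases)
  case (of_int z)
  then have "z = 0 \<or> z = 1 \<or> z = 2 \<or> z = 3"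
    by auto
  then show ?thesis
    using of_int by auto
qed

lemma red4_simps [simp]: "red4 0 = 0" "red4 1 = 1" "red4 2 = 0" "red4 3 = 1"
  by (simp_all add: red4_def)

lemma red4_add: "red4 (x + y) = red4 x + red4 y"
  using four_cases[of x] four_cases[of y] by (auto simp: red4_def)

lemma red4_mult: "red4 (x * y) = red4 x * red4 y"
  using four_cases[of x] four_cases[of y] by (auto simp: red4_def)

lemma red4_eq_0_iff: "red4 x = 0 \<longleftrightarrow> x \<in> {0, 2}"
  using four_cases[of x] by (auto simp: red4_def)

lemma chi_0 [simp]: "chi 0 = 0"
  by (simp add: chi_def)

lemma red4_chi [simp]: "red4 (chi x) = x"
  by (cases x) (simp_all add: chi_def)

lemma map_red4_add: "Poly_Mapping.map red4 (f + f') = Poly_Mapping.map red4 f + Poly_Mapping.map red4 f'"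
  by (rule map_add_fun[OF add_subgroup_UNIV]) (simp_all add: red4_add)

lemma poly_mapping_single_induct [case_names zero single add]:
  fixes f :: "'k \<Rightarrow>\<^sub>0 'c::ab_group_add"
  assumes "P 0" "\<And>k c. P (Poly_Mapping.single k c)" "\<And>f f'. P f \<Longrightarrow> P f' \<Longrightarrow> P (f + f')"
  shows "P f"
  using assms by (intro poly_mapping_additive_induct[of f UNIV UNIV P]) auto

lemma map_red4_mult:
  "Poly_Mapping.map red4 (f * f') = Poly_Mapping.map red4 f * Poly_Mapping.map red4 f'"
  for f f' :: B0
proof (induction f rule: poly_mapping_single_induct)
  case (single k c)
  show ?case
    by (induction f' rule: poly_mapping_single_induct)
      (simp_all add: mult_single map_single_0 red4_mult map_red4_add distrib_left)
qed (simp_all add: map_red4_add distrib_right)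

lemma steen_add: "steen (x + y) = steen x + steen y"
  by (simp add: plus_steenrod.abs_eq)

lemma steen_mult: "steen (x * y) = steen x * steen y"
  by (simp add: times_steenrod.abs_eq)

lemma steen_0 [simp]: "steen 0 = 0"
  by (simp add: zero_steenrod_def)

lemma steen_surj: "\<exists>x. steen x = a"
  by (induction a rule: steenrod.abs_induct) blast

lemma proj_add: "proj (b + b') = proj b + proj b'"
  by (simp add: proj_def map_red4_add steen_add)

lemma proj_mult: "proj (b * b') = proj b * proj b'"
  by (simp add: proj_def map_red4_mult steen_mult)

lemma proj_0 [simp]: "proj 0 = 0"
  by (simp add: proj_def)

lemma proj_1 [simp]: "proj 1 = 1"
  by (simp add: proj_def map_single_0 one_steenrod_def flip: single_one)

lemma proj_diff: "proj (b - b') = proj b - proj b'"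
  using proj_add[of "b - b'" b'] by (simp add: algebra_simps)

lemma proj_map_chi [simp]: "proj (Poly_Mapping.map chi x) = steen x"
proof -
  have "Poly_Mapping.map red4 (Poly_Mapping.map chi x) = x"
    by (rule poly_mapping_eqI) (simp add: lookup_map_0)
  then show ?thesis
    by (simp add: proj_def)
qed

lemma proj_surj: "\<exists>b. proj b = a"
  using steen_surj proj_map_chi by metis

lemma add_subgroup_relR: "add_subgroup relR"
  by (simp add: add_subgroup_def relR_def proj_diff)

lemma relR_mult: "r \<in> relR \<Longrightarrow> b * r \<in> relR" "r \<in> relR \<Longrightarrow> r * b \<in> relR"
  by (simp_all add: relR_def proj_mult)

lemma biadditive_rmulB: "biadditive rmulB"
  by (auto simp: biadditive_def rmulB_def proj_add algebra_simps)

lemma aug_B0_add: "aug_B0 (b + b') = aug_B0 b + aug_B0 b'"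
  by (simp add: aug_B0_def lookup_add)

lemma aug_B0_mult: "aug_B0 (b * b') = aug_B0 b * aug_B0 b'"
  by (simp add: aug_B0_def lookup_mult_0)

lemma aug_B0_0 [simp]: "aug_B0 0 = 0"
  by (simp add: aug_B0_def)

lemma aug_B0_single [simp]: "aug_B0 (Poly_Mapping.single 0 x) = x"
  by (simp add: aug_B0_def)

lemma aug_steen_add: "aug_steen (a + a') = aug_steen a + aug_steen a'"
  by transfer (simp add: lookup_add)

lemma aug_steen_mult: "aug_steen (a * a') = aug_steen a * aug_steen a'"
  by transfer (simp add: lookup_mult_0)

lemma aug_steen_0 [simp]: "aug_steen 0 = 0"
  by transfer simp

lemma aug_steen_1 [simp]: "aug_steen 1 = 1"
  by transfer simp

lemma aug_steen_steen: "aug_steen (steen x) = Poly_Mapping.lookup x 0"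
  by (simp add: aug_steen.abs_eq)

lemma aug_steen_proj: "aug_steen (proj b) = red4 (aug_B0 b)"
  by (simp add: proj_def aug_steen_steen aug_B0_def lookup_map_0)

lemma eps1_add: "eps1 (x + y) = eps1 x + eps1 y"
  by (simp add: eps1_def aug_B0_add aug_steen_add split: prod.split)

section \<open>Gradings of the free algebra and of the Steenrod algebra\<close>

lemma word_deg_0 [simp]: "word_deg 0 = 0"
  by transfer simp

lemma word_deg_eq_0_iff: "word_deg w = 0 \<longleftrightarrow> w = 0"
proof transfer
  fix w :: "nat list"
  assume "0 \<notin> set w"
  then show "sum_list w = 0 \<longleftrightarrow> w = []"
    by (cases w) auto
qed

lemma free_alg_carr [simp]: "carr free_alg_graded = UNIV"
  by (simp add: free_alg_graded_def)

lemma free_alg_piece_iff: "f \<in> piece free_alg_graded n \<longleftrightarrow> (\<forall>w\<in>Poly_Mapping.keys f. int (word_deg w) = n)"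
  by (simp add: free_alg_graded_def)

lemma steen_carr [simp]: "carr steen_graded = UNIV"
  by (simp add: steen_graded_def)

lemma free_alg_single: "Poly_Mapping.single w c \<in> piece free_alg_graded (int (word_deg w))"
  by (simp add: free_alg_piece_iff)

lemma free_alg_piece_lookup_0:
  "f \<in> piece free_alg_graded n \<Longrightarrow> n \<noteq> 0 \<Longrightarrow> Poly_Mapping.lookup f 0 = 0"
  using word_deg_0 by (fastforce simp: free_alg_piece_iff simp flip: not_in_keys_iff_lookup_eq_zero)

lemma free_alg_piece_0:
  assumes "f \<in> piece free_alg_graded 0"
  shows "f = Poly_Mapping.single 0 (Poly_Mapping.lookup f 0)"
proof (rule poly_mapping_eqI)
  fix w
  have "Poly_Mapping.lookup f w = 0" if "w \<noteq> 0"
    using assms that word_deg_eq_0_iff[of w]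
    by (auto simp: free_alg_piece_iff simp flip: not_in_keys_iff_lookup_eq_zero)
  then show "Poly_Mapping.lookup f w = Poly_Mapping.lookup (Poly_Mapping.single 0 (Poly_Mapping.lookup f 0)) w"
    by (cases "w = 0") (auto simp: lookup_single)
qed

lemma free_alg_piece_neg: "f \<in> piece free_alg_graded n \<Longrightarrow> n < 0 \<Longrightarrow> f = 0"
  by (auto simp: free_alg_piece_iff simp flip: keys_eq_empty)

lemma steen_piece_aug: "a \<in> piece steen_graded n \<Longrightarrow> n \<noteq> 0 \<Longrightarrow> aug_steen a = 0"
  by (auto simp: steen_graded_def aug_steen_steen free_alg_piece_lookup_0)

lemma map_piece:
  "f \<in> piece free_alg_graded n \<Longrightarrow> Poly_Mapping.map h f \<in> piece free_alg_graded n"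
  using keys_map_subset[of h f] by (auto simp: free_alg_piece_iff)

lemma proj_piece: "b \<in> piece free_alg_graded n \<Longrightarrow> proj b \<in> piece steen_graded n"
  by (simp add: proj_def steen_graded_def map_piece)

lemma proj_piece_lift: "a \<in> piece steen_graded n \<Longrightarrow> \<exists>b\<in>piece free_alg_graded n. proj b = a"
  by (auto simp: steen_graded_def intro!: bexI[of _ "Poly_Mapping.map chi _"] map_piece)

text \<open>Coefficients are lifted one by one and by 0 off the support, so no new generators
  appear. The set \<open>C\<close> may depend on the generator because homogeneous lifts have to
  respect the shift by its degree.\<close>

lemma map_lift:
  assumes "p 0 = 0" "\<And>g. g \<in> Poly_Mapping.keys f \<Longrightarrow> \<exists>b\<in>C g. p b = Poly_Mapping.lookup f g" "\<And>g. 0 \<in> C g"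
  shows "\<exists>x. Poly_Mapping.keys x \<subseteq> Poly_Mapping.keys f \<and> (\<forall>g. Poly_Mapping.lookup x g \<in> C g) \<and>
    Poly_Mapping.map p x = f"
proof -
  obtain \<beta> where \<beta>: "\<And>g. g \<in> Poly_Mapping.keys f \<Longrightarrow> \<beta> g \<in> C g \<and> p (\<beta> g) = Poly_Mapping.lookup f g"
    using assms(2) by metis
  let ?x = "Poly_Mapping.mapp (\<lambda>g _. \<beta> g) f"
  have lookup: "Poly_Mapping.lookup ?x g = (if g \<in> Poly_Mapping.keys f then \<beta> g else 0)" for g
    by (simp add: lookup_mapp when_def)
  have "Poly_Mapping.map p ?x = f"
    by (rule poly_mapping_eqI) (simp add: lookup_map_0 lookup \<beta> assms(1) in_keys_iff)
  moreover have "Poly_Mapping.keys ?x \<subseteq> Poly_Mapping.keys f"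
    by (auto simp: in_keys_iff lookup split: if_splits)
  ultimately show ?thesis
    using \<beta> assms(3) by (intro exI[of _ ?x]) (simp add: lookup)
qed

lemma lift_free_piece:
  assumes "f \<in> piece (free_graded deg G steen_graded) n"
  shows "\<exists>x\<in>piece (free_graded deg G free_alg_graded) n. Poly_Mapping.map proj x = f"
proof -
  have f: "Poly_Mapping.keys f \<subseteq> G" "Poly_Mapping.lookup f g \<in> piece steen_graded (n - int (deg g))" for g
    using assms by (simp_all add: free_graded_piece_iff)
  obtain x where "Poly_Mapping.keys x \<subseteq> Poly_Mapping.keys f"
    "\<And>g. Poly_Mapping.lookup x g \<in> piece free_alg_graded (n - int (deg g))" "Poly_Mapping.map proj x = f"
    using map_lift[of proj f "\<lambda>g. piece free_alg_graded (n - int (deg g))", OF proj_0 proj_piece_lift[OF f(2)]]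
    by (auto simp: free_alg_piece_iff)
  then show ?thesis
    using f(1) by (intro bexI[of _ x]) (auto simp: free_graded_piece_iff)
qed

lemma lift_free_carr:
  assumes "f \<in> carr (free_graded deg G steen_graded)"
  shows "\<exists>x\<in>carr (free_graded deg G free_alg_graded). Poly_Mapping.map proj x = f"
proof -
  obtain x where "Poly_Mapping.keys x \<subseteq> Poly_Mapping.keys f" "Poly_Mapping.map proj x = f"
    using map_lift[of proj f "\<lambda>_. UNIV"] proj_surj by auto
  then show ?thesis
    using assms by (intro bexI[of _ x]) (auto simp: free_graded_carr_iff)
qed

section \<open>The multiplication map and the module \<open>\<G>\<^sup>\<Sigma>\<close>\<close>

lemma B1_carr: "carr B1_graded = relR \<times> UNIV"
  by (simp add: B1_graded_def gprod_def R_graded_def susp_def)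

lemma B1_piece:
  "piece B1_graded n = (relR \<inter> piece free_alg_graded n) \<times> piece steen_graded (n - 1)"
  by (simp add: B1_graded_def gprod_def R_graded_def susp_def)

lemma secB_simps [simp]:
  "lev0 (secB A) = free_alg_graded" "lev1 (secB A) = B1_graded" "bdry (secB A) = fst"
  "lmul (secB A) = lmulB A" "rmul (secB A) = rmulB"
  by (simp_all add: secB_def)

definition GS_module :: "(steenrod \<Rightarrow> B0 \<Rightarrow> steenrod) \<Rightarrow> (B0, B1, 4, 4 \<times> bit) pair_mod" where
  "GS_module A = \<lparr>mod0 = G0_graded, mod1 = GS1_graded, act0 = (\<lambda>b x. aug_B0 b * x),
     act1 = GS_act1 A, mbdry = fst, mu = GS_mu\<rparr>"

lemma graded_group_G0: "graded_group G0_graded"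
  using graded_group_concentrated[of UNIV 0] by (simp add: G0_graded_def concentrated_def)

lemma add_subgroup_twice: "add_subgroup {0, 2 :: 4}"
  by (auto simp: add_subgroup_def)

lemma GS1_eq: "GS1_graded = gprod (concentrated {0, 2} 0) (concentrated UNIV 1)"
  by (auto simp: GS1_graded_def gprod_def concentrated_def)

lemma graded_group_GS1: "graded_group GS1_graded"
  unfolding GS1_eq
  by (intro graded_group_gprod graded_group_concentrated add_subgroup_twice add_subgroup_UNIV)

lemma relR_aug: "r \<in> relR \<Longrightarrow> aug_B0 r \<in> {0, 2}"
  using aug_steen_proj[of r] by (simp add: relR_def red4_eq_0_iff)

lemma single_relR: "x \<in> {0, 2} \<Longrightarrow> Poly_Mapping.single 0 x \<in> relR"
  by (auto simp: relR_def proj_def map_single_0)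

section \<open>The multiplication map and the module structure on G^Sigma\<close>

locale secondary_algebra =
  fixes A :: "steenrod \<Rightarrow> B0 \<Rightarrow> steenrod"
  assumes pair_algebra: "pair_algebra (secB A)"
begin

lemma graded_group_B0: "graded_group (free_alg_graded :: B0 graded)"
  using pair_algebra by (simp add: pair_algebra_def graded_ring_def)

lemma graded_group_B1: "graded_group B1_graded"
  using pair_algebra by (simp add: pair_algebra_def graded_left_module_def)

lemma graded_group_R: "graded_group R_graded"
  and graded_group_susp: "graded_group (susp steen_graded)"
  using graded_group_gprodD graded_group_B1 unfolding B1_graded_def by blast+

lemma add_subgroup_steen_piece: "add_subgroup (piece steen_graded n)"
  using graded_group_piece[OF graded_group_susp, of "n + 1"] by (simp add: susp_def)

lemma lmulB_bilinear: "graded_bilinear free_alg_graded B1_graded B1_graded (lmulB A)"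
  using pair_algebra by (simp add: pair_algebra_def graded_left_module_def)

text \<open>The identities for A that follow are second components of pair algebra axioms, evaluated
  at elements (r, 0) after lifting a to B_0.\<close>

lemma A_add_left:
  assumes "r \<in> relR"
  shows "A (a + a') r = A a r + A a' r"
proof -
  obtain b b' where "proj b = a" "proj b' = a'"
    using proj_surj by metis
  then show ?thesis
    using graded_bilinearD(2)[OF lmulB_bilinear, of b b' "(r, 0)"] assms
    by (simp add: lmulB_def B1_carr proj_add)
qed

lemma A_add_right:
  assumes "r \<in> relR" "r' \<in> relR"
  shows "A a (r + r') = A a r + A a r'"
proof -
  obtain b where "proj b = a"
    using proj_surj by metis
  then show ?thesis
    using graded_bilinearD(3)[OF lmulB_bilinear, of b "(r, 0)" "(r', 0)"] assms
    by (simp add: lmulB_def B1_carr)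
qed

lemma A_0_left: "r \<in> relR \<Longrightarrow> A 0 r = 0"
  by (rule additive_0[OF add_subgroup_UNIV, of "\<lambda>a. A a r"]) (simp add: A_add_left)

lemma A_0_right: "A a 0 = 0"
  by (rule additive_0[OF add_subgroup_relR, of "A a"]) (rule A_add_right)

lemma A_1: "r \<in> relR \<Longrightarrow> A 1 r = 0"
  using pair_algebra
  by (auto simp: pair_algebra_def graded_left_module_def lmulB_def B1_carr dest: bspec[of _ _ "(r, 0)"])

text \<open>Associativity of the left action on (r, 0). The correction term a A(b, r) shows that A
  is a cocycle in its first argument and not linear; it accounts for the shape of the formula for
  delta(ag).\<close>

lemma A_mult_left:
  assumes "r \<in> relR"
  shows "A (a * proj b) r = A a (b * r) + a * A (proj b) r"
proof -
  obtain b' where "proj b' = a"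
    using proj_surj by metis
  moreover have "lmulB A (b' * b) (r, 0) = lmulB A b' (lmulB A b (r, 0))"
    using pair_algebra assms by (auto simp: pair_algebra_def graded_left_module_def B1_carr)
  ultimately show ?thesis
    by (simp add: lmulB_def proj_mult)
qed

lemma A_mult_right:
  assumes "r \<in> relR"
  shows "A a (r * b) = A a r * proj b"
proof -
  obtain b' where "proj b' = a"
    using proj_surj by metis
  moreover have "rmulB (lmulB A b' (r, 0)) b = lmulB A b' (rmulB (r, 0) b)"
    using pair_algebra assms by (auto simp: pair_algebra_def B1_carr)
  ultimately show ?thesis
    by (simp add: lmulB_def rmulB_def)
qed

lemma A_piece:
  assumes "a \<in> piece steen_graded m" "r \<in> relR" "r \<in> piece free_alg_graded n"
  shows "A a r \<in> piece steen_graded (m + n - 1)"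
proof -
  obtain b where "b \<in> piece free_alg_graded m" "proj b = a"
    using proj_piece_lift[OF assms(1)] by blast
  then show ?thesis
    using graded_bilinearD(4)[OF lmulB_bilinear, of b m "(r, 0)" n] assms(2,3)
      add_subgroup_0[OF add_subgroup_steen_piece]
    by (simp add: lmulB_def B1_piece)
qed

text \<open>For degree reasons only \<open>A(\<A>\<^sup>0, R\<^sup>1)\<close> and \<open>A(\<A>\<^sup>1, R\<^sup>0)\<close> can contribute.
  The former vanishes since \<open>A(1, r) = 0\<close>, and the latter does not occur for \<open>r\<close> of
  augmentation \<open>0\<close>.\<close>

lemma aug_A:
  assumes "r \<in> relR" "aug_B0 r = 0"
  shows "aug_steen (A a r) = 0"
proof -
  \<comment> \<open>Removing the constant term turns the hypothesis on r into an additive operation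
    on all of \<open>relR\<close>, so that homogeneous parts of r can be treated separately.\<close>
  define \<rho> where "\<rho> r = r - Poly_Mapping.single 0 (aug_B0 r)" for r :: B0
  have \<rho>_add: "\<rho> (x + y) = \<rho> x + \<rho> y" for x y
    by (simp add: \<rho>_def aug_B0_add single_add)
  have \<rho>_relR: "\<rho> x \<in> relR" if "x \<in> relR" for x
    unfolding \<rho>_def using that relR_aug single_relR add_subgroup_diff[OF add_subgroup_relR] by blast
  have hom: "aug_steen (A (proj b) (\<rho> s)) = 0" if b: "b = Poly_Mapping.single w c"
    and s: "s \<in> piece R_graded n" for b w c s n
  proof -
    have s': "s \<in> relR" "s \<in> piece free_alg_graded n"
      using s by (auto simp: R_graded_def)
    show ?thesis
    proof (cases "n = 0")
      case True
      then have "\<rho> s = 0"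
        using free_alg_piece_0 s'(2) by (auto simp: \<rho>_def aug_B0_def)
      then show ?thesis
        by (simp add: A_0_right)
    next
      case False
      then have \<rho>: "\<rho> s = s"
        using free_alg_piece_lookup_0[OF s'(2)] by (simp add: \<rho>_def aug_B0_def)
      have mem: "A (proj b) s \<in> piece steen_graded (int (word_deg w) + n - 1)"
        unfolding b by (intro A_piece proj_piece free_alg_single s')
      \<comment> \<open>The value has degree \<open>word_deg w + n - 1\<close>. If this is 0 and n
        is positive, then n = 1 and w is the empty word; n = 0 has been excluded.\<close>
      consider "w = 0" | "n < 0" | "int (word_deg w) + n - 1 \<noteq> 0"
        using False word_deg_eq_0_iff[of w] by fastforce
      then show ?thesis
      proof cases
        case 1
        have "proj b = (if red4 c = 0 then 0 else 1)"
          unfolding b 1 using proj_1 by (auto simp: proj_def map_single_0 one_steenrod_def simp flip: single_one)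
        then show ?thesis
          using A_0_left[OF s'(1)] A_1[OF s'(1)] by (simp add: \<rho>)
      next
        case 2
        then show ?thesis
          using free_alg_piece_neg[OF s'(2)] \<rho> by (simp add: A_0_right)
      next
        case 3
        then show ?thesis
          using steen_piece_aug[OF mem] \<rho> by simp
      qed
    qed
  qed
  have gen: "aug_steen (A (proj b) (\<rho> s)) = 0" if "s \<in> relR" for b s
  proof (induction b rule: poly_mapping_single_induct)
    case (single w c)
    have "s \<in> carr R_graded"
      using that by (simp add: R_graded_def)
    with graded_group_R show ?case
    proof (induction rule: graded_group_induct)
      case (add x y)
      then have "\<rho> x \<in> relR" "\<rho> y \<in> relR"
        using \<rho>_relR by (auto simp: R_graded_def)
      then show ?case
        using add by (simp add: \<rho>_add A_add_right aug_steen_add)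
    qed (use hom in \<open>auto simp: \<rho>_def A_0_right\<close>)
  qed (use \<rho>_relR[OF that] in \<open>simp_all add: A_0_left proj_add A_add_left aug_steen_add\<close>)
  obtain b where "proj b = a"
    using proj_surj by metis
  then show ?thesis
    using gen[OF assms(1), of b] assms(2) by (simp add: \<rho>_def)
qed

text \<open>Independence of the lift in the definition of \<open>GS_act1\<close>: r and its constant
  term have the same augmentation, so their difference is an element of R to which
  \<open>aug_A\<close> applies. With this, \<open>eps1\<close> carries the module structure over to
  G^Sigma.\<close>

lemma GS_act1_eps1:
  assumes "\<beta> \<in> carr B1_graded"
  shows "GS_act1 A b (eps1 \<beta>) = eps1 (lmulB A b \<beta>)"
proof -
  obtain r a where \<beta>: "\<beta> = (r, a)" "r \<in> relR"
    using assms by (auto simp: B1_carr)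
  let ?s = "Poly_Mapping.single 0 (aug_B0 r) :: B0"
  have s: "?s \<in> relR"
    using relR_aug[OF \<beta>(2)] by (rule single_relR)
  have "aug_steen (A (proj b) (r - ?s)) = 0"
    using add_subgroup_diff[OF add_subgroup_relR \<beta>(2) s]
    by (rule aug_A) (simp add: aug_B0_def lookup_minus)
  then have "aug_steen (A (proj b) r) = aug_steen (A (proj b) ?s)"
    using A_add_right[OF add_subgroup_diff[OF add_subgroup_relR \<beta>(2) s] s, of "proj b"]
    by (simp add: aug_steen_add)
  then show ?thesis
    by (simp add: \<beta>(1) GS_act1_def GS_lift_def eps1_def lmulB_def aug_B0_mult aug_steen_add
        aug_steen_mult)
qed

lemma eps1_image: "eps1 ` carr B1_graded = carr GS1_graded" (is ?carr)
  and eps1_image_piece: "eps1 ` piece B1_graded n = piece GS1_graded n" (is ?piece)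
proof -
  have "eps1 \<beta> \<in> carr GS1_graded" if "\<beta> \<in> carr B1_graded" for \<beta>
    using that relR_aug by (auto simp: B1_carr GS1_graded_def eps1_def)
  moreover have lift: "eps1 (GS_lift z) = z" for z
    by (auto simp: eps1_def GS_lift_def split: prod.split bit.split)
  moreover have "GS_lift z \<in> carr B1_graded" if "z \<in> carr GS1_graded" for z
    using that single_relR by (auto simp: B1_carr GS1_graded_def GS_lift_def)
  ultimately show ?carr
    by (metis (no_types, lifting) image_eqI image_subset_iff subsetI subset_antisym)
  have "eps1 \<beta> \<in> piece GS1_graded n" if "\<beta> \<in> piece B1_graded n" for \<beta>
    using that relR_aug free_alg_piece_lookup_0 steen_piece_aug
    by (fastforce simp: B1_piece GS1_graded_def eps1_def aug_B0_def)
  moreover have "GS_lift z \<in> piece B1_graded n" if "z \<in> piece GS1_graded n" for z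
  proof -
    have "1 \<in> piece steen_graded 0"
      using proj_piece[of 1 0] by (simp add: free_alg_piece_iff)
    moreover have "(2 :: B0) \<in> piece free_alg_graded 0" "(0 :: B0) \<in> piece free_alg_graded k" for k
      using free_alg_single[of 0 "2 :: 4"] by (simp_all add: free_alg_piece_iff)
    ultimately show ?thesis
      using that single_relR[of 2] add_subgroup_0[OF add_subgroup_steen_piece] add_subgroup_0[OF add_subgroup_relR]
      by (auto simp: B1_piece GS1_graded_def GS_lift_def split: if_splits)
  qed
  ultimately show ?piece
    using lift by (metis (no_types, lifting) image_eqI image_subset_iff subsetI subset_antisym)
qed

lemma GS_module:
  shows pair_module_GS: "pair_module (secB A) (GS_module A)"
    and pair_module_hom_GS:
      "pair_module_hom (secB A) (regular_pair_module (secB A)) (GS_module A) aug_B0 eps1"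
proof -
  have surj: "aug_B0 ` UNIV = UNIV"
    using aug_B0_single by (metis surjI)
  have "aug_B0 ` piece free_alg_graded n = piece G0_graded n" for n
  proof (cases "n = 0")
    case True
    then show ?thesis
      using free_alg_single[of 0] aug_B0_single
      by (auto simp: G0_graded_def intro!: image_eqI[of _ aug_B0 "Poly_Mapping.single 0 _"])
  next
    case False
    moreover have "(0 :: B0) \<in> piece free_alg_graded n"
      by (simp add: free_alg_piece_iff)
    ultimately show ?thesis
      using free_alg_piece_lookup_0 by (force simp: G0_graded_def aug_B0_def image_iff)
  qed
  moreover have "GS_mu \<beta> (aug_B0 x) = eps1 (rmulB \<beta> x)" for \<beta> x
    by (cases \<beta>) (simp add: GS_mu_def eps1_def rmulB_def aug_B0_mult aug_steen_mult aug_steen_proj)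
  moreover have "carr G0_graded = UNIV" "fst (eps1 \<beta>) = aug_B0 (fst \<beta>)" for \<beta>
    by (simp_all add: G0_graded_def eps1_def split: prod.split)
  ultimately have N: "graded_group (mod0 (GS_module A))" "graded_group (mod1 (GS_module A))"
    and e0: "carr (mod0 (GS_module A)) = aug_B0 ` carr (mod0 (regular_pair_module (secB A)))"
      "\<And>n. piece (mod0 (GS_module A)) n = aug_B0 ` piece (mod0 (regular_pair_module (secB A))) n"
    and e1: "carr (mod1 (GS_module A)) = eps1 ` carr (mod1 (regular_pair_module (secB A)))"
      "\<And>n. piece (mod1 (GS_module A)) n = eps1 ` piece (mod1 (regular_pair_module (secB A))) n"
    and act: "\<And>b x. act0 (GS_module A) b (aug_B0 x) = aug_B0 (act0 (regular_pair_module (secB A)) b x)"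
      "\<And>b y. y \<in> carr (mod1 (regular_pair_module (secB A))) \<Longrightarrow>
        act1 (GS_module A) b (eps1 y) = eps1 (act1 (regular_pair_module (secB A)) b y)"
      "\<And>y. mbdry (GS_module A) (eps1 y) = aug_B0 (mbdry (regular_pair_module (secB A)) y)"
      "\<And>\<beta> x. mu (GS_module A) \<beta> (aug_B0 x) = eps1 (mu (regular_pair_module (secB A)) \<beta> x)"
    by (simp_all add: GS_module_def regular_pair_module_def graded_group_G0 graded_group_GS1 surj
        eps1_image eps1_image_piece GS_act1_eps1 aug_B0_mult)
  show "pair_module (secB A) (GS_module A)"
    by (rule pair_module_image(1)[OF pair_module_regular[OF pair_algebra] N e0 aug_B0_add e1 eps1_add
          act pair_algebra])
  show "pair_module_hom (secB A) (regular_pair_module (secB A)) (GS_module A) aug_B0 eps1"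
    by (rule pair_module_image(2)[OF pair_module_regular[OF pair_algebra] N e0 aug_B0_add e1 eps1_add
          act pair_algebra])
qed

text \<open>Off position -1 only the carriers shrink to 0 and the operations remain, because
  \<open>seq_mod\<close> has the same operations in every position.\<close>

definition second_factor :: "int \<Rightarrow> (B0, B1, 4, 4 \<times> bit) pair_mod" where
  "second_factor n = (if n = -1 then GS_module A
     else (GS_module A)\<lparr>mod0 := zero_graded, mod1 := zero_graded\<rparr>)"

lemma pair_module_second_factor: "pair_module (secB A) (second_factor n)"
proof (cases "n = -1")
  case False
  note zero = pair_module_act_0[OF pair_module_GS]
  show ?thesis
    by (rule pair_module_zero[OF pair_algebra])
      (use False zero in \<open>auto simp: second_factor_def GS_module_def\<close>)
qed (simp add: second_factor_def pair_module_GS)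

lemma seq_mod_eq:
  "seq_mod A low deg n =
    prod_pair_module (free_pair_module deg (gens low n) (secB A)) (second_factor n)"
  by (auto simp: seq_mod_def prod_pair_module_def free_pair_module_def second_factor_def GS_module_def
      fun_eq_iff)

lemma pair_module_seq: "pair_module (secB A) (seq_mod A low deg n)"
  unfolding seq_mod_eq
  by (intro pair_module_prod pair_module_free pair_algebra pair_module_second_factor)

end

section \<open>Product-valued finitely supported functions\<close>

lemma single_map_times_1: "Poly_Mapping.single g b = Poly_Mapping.map ((*) b) (Poly_Mapping.single g 1)"
  for b :: "'b::ring_1"
  by (simp add: map_single_0)

text \<open>Assembles an element of a free level 1 module from its R-component and its Sigma
  A-component; writing it as a sum makes finite support automatic.\<close>

definition pm_pair :: "('g \<Rightarrow>\<^sub>0 'a::ab_group_add) \<Rightarrow> ('g \<Rightarrow>\<^sub>0 'b::ab_group_add) \<Rightarrow> 'g \<Rightarrow>\<^sub>0 'a \<times> 'b" where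
  "pm_pair f h = Poly_Mapping.map (\<lambda>r. (r, 0)) f + Poly_Mapping.map (\<lambda>a. (0, a)) h"

lemma lookup_pm_pair: "Poly_Mapping.lookup (pm_pair f h) g = (Poly_Mapping.lookup f g, Poly_Mapping.lookup h g)"
  by (simp add: pm_pair_def lookup_add lookup_map_0[of "\<lambda>r. (r, 0)", unfolded zero_prod_def]
      lookup_map_0[of "\<lambda>a. (0, a)", unfolded zero_prod_def] zero_prod_def)

lemma keys_pm_pair:
  "Poly_Mapping.keys (pm_pair f h) = Poly_Mapping.keys f \<union> Poly_Mapping.keys h"
  by (auto simp: in_keys_iff lookup_pm_pair zero_prod_def)

lemma map_fst_pm_pair [simp]: "Poly_Mapping.map fst (pm_pair f h) = f"
  and map_snd_pm_pair [simp]: "Poly_Mapping.map snd (pm_pair f h) = h"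
  by (rule poly_mapping_eqI, simp add: lookup_map_0 lookup_pm_pair)+

lemma pm_prod_eqI:
  fixes y y' :: "'g \<Rightarrow>\<^sub>0 'a::ab_group_add \<times> 'b::ab_group_add"
  assumes "Poly_Mapping.map fst y = Poly_Mapping.map fst y'" "Poly_Mapping.map snd y = Poly_Mapping.map snd y'"
  shows "y = y'"
proof (rule poly_mapping_eqI)
  fix g
  have "Poly_Mapping.lookup (Poly_Mapping.map fst y) g = Poly_Mapping.lookup (Poly_Mapping.map fst y') g"
    "Poly_Mapping.lookup (Poly_Mapping.map snd y) g = Poly_Mapping.lookup (Poly_Mapping.map snd y') g"
    by (simp_all only: assms)
  then show "Poly_Mapping.lookup y g = Poly_Mapping.lookup y' g"
    by (simp add: lookup_map_0 prod_eq_iff)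
qed

lemma map_diff_fun:
  fixes u :: "'a::ab_group_add \<Rightarrow> 'b::ab_group_add"
  assumes "\<And>x y. u (x + y) = u x + u y"
  shows "Poly_Mapping.map u (f - f') = Poly_Mapping.map u f - Poly_Mapping.map u f'"
  using map_add_fun[OF add_subgroup_UNIV, of u "f - f'" f'] assms by (simp add: algebra_simps)

lemma map_fst_add: "Poly_Mapping.map fst (f + f') = Poly_Mapping.map fst f + Poly_Mapping.map fst f'"
  and map_snd_add: "Poly_Mapping.map snd (f + f') = Poly_Mapping.map snd f + Poly_Mapping.map snd f'"
  for f f' :: "'g \<Rightarrow>\<^sub>0 'a::ab_group_add \<times> 'b::ab_group_add"
  by (simp_all add: map_add_fun[OF add_subgroup_UNIV])

lemma map_fst_diff: "Poly_Mapping.map fst (f - f') = Poly_Mapping.map fst f - Poly_Mapping.map fst f'"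
  and map_snd_diff: "Poly_Mapping.map snd (f - f') = Poly_Mapping.map snd f - Poly_Mapping.map snd f'"
  for f f' :: "'g \<Rightarrow>\<^sub>0 'a::ab_group_add \<times> 'b::ab_group_add"
  by (simp_all add: map_diff_fun)

lemma map_proj_add: "Poly_Mapping.map proj (f + f') = Poly_Mapping.map proj f + Poly_Mapping.map proj f'"
  by (rule map_add_fun[OF add_subgroup_UNIV]) (simp_all add: proj_add)

lemma map_proj_diff: "Poly_Mapping.map proj (f - f') = Poly_Mapping.map proj f - Poly_Mapping.map proj f'"
  by (rule map_diff_fun) (rule proj_add)

lemma map_proj_eq_0_iff: "Poly_Mapping.map proj f = 0 \<longleftrightarrow> (\<forall>g. Poly_Mapping.lookup f g \<in> relR)"
  by (auto simp: poly_mapping_eq_iff fun_eq_iff lookup_map_0 relR_def)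

lemma coeff_sum_eps1:
  "coeff_sum eps1 y = (coeff_sum aug_B0 (Poly_Mapping.map fst y), coeff_sum aug_steen (Poly_Mapping.map snd y))"
  using coeff_sum_map[OF add_subgroup_UNIV, of fst fst aug_B0 eps1 y]
    coeff_sum_map[OF add_subgroup_UNIV, of snd snd aug_steen eps1 y]
  by (simp add: prod_eq_iff eps1_def split: prod.split)

lemma gens_neg [simp]: "n < 0 \<Longrightarrow> gens low n = {}"
  by (auto simp: gens_def)

lemma free_graded_carr_empty: "f \<in> carr (free_graded deg {} X) \<Longrightarrow> f = 0"
  by (simp add: free_graded_carr_iff)

section \<open>The lifted resolution\<close>

locale lifted_resolution = secondary_algebra A
  for A :: "steenrod \<Rightarrow> B0 \<Rightarrow> steenrod" +
  fixes low deg :: "'g \<Rightarrow> nat"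
    and dA :: "'g \<Rightarrow> 'g \<Rightarrow>\<^sub>0 steenrod"
    and ex :: "'g \<Rightarrow> 'g \<Rightarrow>\<^sub>0 free2"
  assumes minimal_resolution: "minimal_resolution low deg dA"
    and literal_expression: "literal_expression low deg dA ex"
begin

abbreviation FB :: "int \<Rightarrow> ('g \<Rightarrow>\<^sub>0 B0) graded" where
  "FB n \<equiv> free_graded deg (gens low n) free_alg_graded"

abbreviation FB1 :: "int \<Rightarrow> ('g \<Rightarrow>\<^sub>0 B1) graded" where
  "FB1 n \<equiv> free_graded deg (gens low n) B1_graded"

abbreviation FA :: "int \<Rightarrow> ('g \<Rightarrow>\<^sub>0 steenrod) graded" where
  "FA n \<equiv> free_graded deg (gens low n) steen_graded"

abbreviation "d0 \<equiv> lift_d0 ex"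
abbreviation "d1 \<equiv> lift_d1 ex"
abbreviation "d\<^sub>A \<equiv> lin_ext (*) dA"

lemma FB_carr_iff: "f \<in> carr (FB n) \<longleftrightarrow> (\<forall>g\<in>Poly_Mapping.keys f. int (low g) = n)"
  by (auto simp: free_graded_carr_iff gens_def)

lemma FA_carr_iff: "f \<in> carr (FA n) \<longleftrightarrow> (\<forall>g\<in>Poly_Mapping.keys f. int (low g) = n)"
  by (auto simp: free_graded_carr_iff gens_def)

lemma FB1_carr_iff:
  "f \<in> carr (FB1 n) \<longleftrightarrow> (\<forall>g\<in>Poly_Mapping.keys f. int (low g) = n) \<and>
    (\<forall>g. fst (Poly_Mapping.lookup f g) \<in> relR)"
  by (auto simp: free_graded_carr_iff gens_def B1_carr mem_Times_iff)

lemma graded_group_FB: "graded_group (FB n)"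
  and graded_group_FB1: "graded_group (FB1 n)"
  by (intro graded_group_free graded_group_B0 graded_group_B1)+

lemma FB_diff: "x \<in> carr (FB n) \<Longrightarrow> y \<in> carr (FB n) \<Longrightarrow> x - y \<in> carr (FB n)"
  using add_subgroup_diff graded_group_carr graded_group_FB by blast

lemma FB1_add: "x \<in> carr (FB1 n) \<Longrightarrow> y \<in> carr (FB1 n) \<Longrightarrow> x + y \<in> carr (FB1 n)"
  using add_subgroup_add graded_group_carr graded_group_FB1 by blast

lemma FB1_diff: "x \<in> carr (FB1 n) \<Longrightarrow> y \<in> carr (FB1 n) \<Longrightarrow> x - y \<in> carr (FB1 n)"
  using add_subgroup_diff graded_group_carr graded_group_FB1 by blast

lemma FB_single: "int (low g) = n \<Longrightarrow> Poly_Mapping.single g b \<in> carr (FB n)"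
  and FA_single: "int (low g) = n \<Longrightarrow> Poly_Mapping.single g a \<in> carr (FA n)"
  by (auto simp: FB_carr_iff FA_carr_iff)

lemma map_proj_FB: "x \<in> carr (FB n) \<Longrightarrow> Poly_Mapping.map proj x \<in> carr (FA n)"
  using keys_map_subset[of proj x] by (auto simp: FB_carr_iff FA_carr_iff)

lemma map_snd_FB1: "y \<in> carr (FB1 n) \<Longrightarrow> Poly_Mapping.map snd y \<in> carr (FA n)"
  using keys_map_subset[of snd y] by (auto simp: FB1_carr_iff FA_carr_iff)

lemma map_fst_FB1: "y \<in> carr (FB1 n) \<Longrightarrow> Poly_Mapping.map fst y \<in> carr (FB n)"
  using keys_map_subset[of fst y] by (auto simp: FB1_carr_iff FB_carr_iff)

lemma map_proj_map_fst: "y \<in> carr (FB1 n) \<Longrightarrow> Poly_Mapping.map proj (Poly_Mapping.map fst y) = 0"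
  by (simp add: map_proj_eq_0_iff lookup_map_0 FB1_carr_iff)

lemma pm_pair_FB1:
  "f \<in> carr (FB n) \<Longrightarrow> Poly_Mapping.map proj f = 0 \<Longrightarrow> h \<in> carr (FA n) \<Longrightarrow> pm_pair f h \<in> carr (FB1 n)"
  by (auto simp: FB_carr_iff FA_carr_iff FB1_carr_iff keys_pm_pair lookup_pm_pair map_proj_eq_0_iff)

lemma lift_gen_piece: "low g > 0 \<Longrightarrow> lift_gen ex g \<in> piece (FB (int (low g) - 1)) (int (deg g))"
  using literal_expression keys_map_subset[of "Poly_Mapping.map chi" "ex g"]
  by (auto simp: literal_expression_def lift_gen_def free_graded_piece_iff lookup_map_0 map_piece)

lemma lift_gen_carr: "low g > 0 \<Longrightarrow> lift_gen ex g \<in> carr (FB (int (low g) - 1))"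
  by (rule graded_group_piece_carr[OF graded_group_FB lift_gen_piece])

lemma map_proj_lift_gen: "low g > 0 \<Longrightarrow> Poly_Mapping.map proj (lift_gen ex g) = dA g"
  using literal_expression
  by (simp add: literal_expression_def lift_gen_def map_map_0)

lemma proj_lift_gen:
  "low g > 0 \<Longrightarrow> proj (Poly_Mapping.lookup (lift_gen ex g) h) = Poly_Mapping.lookup (dA g) h"
  using map_proj_lift_gen[of g] by (metis lookup_map_0 proj_0)

section \<open>Exactness and degrees in the minimal resolution\<close>

lemma aug_exact:
  assumes "f \<in> carr (FA 0)" "coeff_sum aug_steen f = 0"
  shows "\<exists>f'\<in>carr (FA 1). f = d\<^sub>A f'"
proof -
  have "{x \<in> carr (FA 0). coeff_sum aug_steen x = 0} = d\<^sub>A ` carr (FA 1)"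
    using minimal_resolution by (simp add: minimal_resolution_def Let_def)
  then show ?thesis
    using assms by auto
qed

lemma dA_exact_iff:
  assumes "n > 0"
  shows "f \<in> carr (FA n) \<and> d\<^sub>A f = 0 \<longleftrightarrow> (\<exists>f'\<in>carr (FA (n + 1)). f = d\<^sub>A f')"
proof -
  have *: "{x \<in> carr (FA (m + 1)). d\<^sub>A x = 0} = d\<^sub>A ` carr (FA (m + 2))" if "m \<ge> 0" for m
    using minimal_resolution that by (simp add: minimal_resolution_def Let_def)
  have "{x \<in> carr (FA n). d\<^sub>A x = 0} = d\<^sub>A ` carr (FA (n + 1))"
    using *[of "n - 1"] assms by (simp add: add.commute)
  then show ?thesis
    by blast
qed

lemma deg_low_0:
  assumes "low g = 0"
  shows "deg g = 0"
proof -
  have "deg ` gens low 0 = {0}"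
    using minimal_resolution by (simp add: minimal_resolution_def Let_def bij_betw_def)
  then show ?thesis
    using assms by (auto simp: gens_def)
qed

lemma ex_low_0: "\<exists>g. low g = 0"
proof -
  have "deg ` gens low 0 = {0}"
    using minimal_resolution by (simp add: minimal_resolution_def Let_def bij_betw_def)
  then show ?thesis
    by (auto simp: gens_def)
qed

lemma deg_low_1:
  assumes "low g = 1"
  shows "deg g > 0"
proof -
  have "deg ` gens low 1 = {2 ^ n | n. True}"
    using minimal_resolution by (simp add: minimal_resolution_def Let_def bij_betw_def)
  moreover have "g \<in> gens low 1"
    using assms by (simp add: gens_def)
  ultimately obtain n where "deg g = 2 ^ n"
    by blast
  then show ?thesis
    by simp
qed

text \<open>Generators of lower index 1 have degree a power of two and the one of lower index 0 has
  degree 0, so these coefficients have positive degree and no constant term.\<close>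

lemma aug_lift_gen:
  assumes "low g = 1"
  shows "aug_B0 (Poly_Mapping.lookup (lift_gen ex g) h) = 0"
proof (cases "low h = 0")
  case True
  then show ?thesis
    using lift_gen_piece[of g] assms deg_low_1[OF assms] deg_low_0[of h]
    by (auto simp: free_graded_piece_iff aug_B0_def intro!: free_alg_piece_lookup_0)
next
  case False
  then have "h \<notin> Poly_Mapping.keys (lift_gen ex g)"
    using lift_gen_carr[of g] assms by (auto simp: FB_carr_iff)
  then show ?thesis
    by (simp add: in_keys_iff)
qed

section \<open>The lifted differentials and their composites\<close>

lemma d0_add: "d0 (x + y) = d0 x + d0 y" and d0_diff: "d0 (x - y) = d0 x - d0 y"
  by (simp_all add: lift_d0_def lin_ext_add lin_ext_diff biadditive_times)

lemma d1_add: "d1 (x + y) = d1 x + d1 y" and d1_diff: "d1 (x - y) = d1 x - d1 y"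
  by (simp_all add: lift_d1_def lin_ext_add lin_ext_diff biadditive_rmulB)

lemma d0_0 [simp]: "d0 0 = 0" and d1_0 [simp]: "d1 0 = 0"
  by (simp_all add: lift_d0_def lift_d1_def)

text \<open>Position -1 is left out because generators of lower index 0 have no lifted value; below
  it there are no generators in the source.\<close>

lemma pair_module_hom_d:
  assumes "n \<noteq> -1"
  shows "pair_module_hom (secB A) (free_pair_module deg (gens low (n + 1)) (secB A))
    (free_pair_module deg (gens low n) (secB A)) d0 d1"
proof -
  have "lift_gen ex g \<in> piece (FB n) (int (deg g))" if "g \<in> gens low (n + 1)" for g
  proof -
    have "low g > 0" "int (low g) - 1 = n"
      using that assms by (auto simp: gens_def)
    then show ?thesis
      using lift_gen_piece by metis
  qed
  then show ?thesis
    using pair_module_hom_lin_ext[OF pair_algebra, of "gens low (n + 1)" "lift_gen ex" deg "gens low n"]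
    by (simp add: biadditive_rmulB lift_d0_def[abs_def] lift_d1_def[abs_def])
qed

lemma d0_hom: "n \<noteq> -1 \<Longrightarrow> graded_hom (FB (n + 1)) (FB n) d0"
  and d1_hom: "n \<noteq> -1 \<Longrightarrow> graded_hom (FB1 (n + 1)) (FB1 n) d1"
  using pair_module_hom_d[of n] by (simp_all add: pair_module_hom_def free_pair_module_def)

lemma d0_map_times: "d0 (Poly_Mapping.map ((*) b) x) = Poly_Mapping.map ((*) b) (d0 x)"
  unfolding lift_d0_def
  by (rule map_lin_ext[symmetric, OF biadditive_times biadditive_times add_subgroup_UNIV])
    (auto simp: algebra_simps)

lemma map_fst_d1: "Poly_Mapping.map fst (d1 y) = d0 (Poly_Mapping.map fst y)"
  unfolding lift_d0_def lift_d1_def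
  by (rule map_lin_ext[OF biadditive_rmulB biadditive_times add_subgroup_UNIV])
    (auto simp: rmulB_def split: prod.split)

text \<open>Right multiplication acts on the second component through the projection alone, without
  a contribution from the first component or from A.\<close>

lemma map_snd_d1:
  assumes "\<And>g. g \<in> Poly_Mapping.keys y \<Longrightarrow> low g > 0"
  shows "Poly_Mapping.map snd (d1 y) = d\<^sub>A (Poly_Mapping.map snd y)"
  unfolding lift_d1_def
  by (rule map_lin_ext[OF biadditive_rmulB biadditive_times add_subgroup_UNIV])
    (auto simp: rmulB_def proj_lift_gen assms split: prod.split)

lemma map_proj_d0:
  assumes "\<And>g. g \<in> Poly_Mapping.keys x \<Longrightarrow> low g > 0"
  shows "Poly_Mapping.map proj (d0 x) = d\<^sub>A (Poly_Mapping.map proj x)"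
  unfolding lift_d0_def
  by (rule map_lin_ext[OF biadditive_times biadditive_times add_subgroup_UNIV])
    (auto simp: proj_mult proj_add proj_lift_gen assms)

lemma d0_d0: "d0 (d0 x) = lin_ext (*) (ddg ex) x"
  unfolding lift_d0_def ddg_def
  by (rule lin_ext_lin_ext) (simp_all add: biadditive_times mult.assoc)

lemma d1_d1: "d1 (d1 y) = lin_ext rmulB (ddg ex) y"
  unfolding lift_d0_def lift_d1_def ddg_def
  by (rule lin_ext_lin_ext[OF biadditive_rmulB biadditive_rmulB biadditive_rmulB biadditive_times])
    (auto simp: rmulB_def mult.assoc proj_mult split: prod.split)

lemma ddg_carr:
  assumes "low g \<ge> 2"
  shows "ddg ex g \<in> carr (FB (int (low g) - 2))"
  unfolding ddg_def
  using graded_homD(1)[OF d0_hom, of "int (low g) - 2"] lift_gen_carr[of g] assms by simp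

text \<open>Projection turns the lifted dd into that of the resolution, and \<open>dA g\<close> is a
  cycle there because it is the boundary of the generator g.\<close>

lemma map_proj_ddg:
  assumes "low g \<ge> 2"
  shows "Poly_Mapping.map proj (ddg ex g) = 0"
proof -
  have "d\<^sub>A (Poly_Mapping.single g 1) = dA g"
    by (rule poly_mapping_eqI) (simp add: lin_ext_single[OF biadditive_times] lookup_map_0)
  moreover have "Poly_Mapping.single g 1 \<in> carr (FA (int (low g) - 1 + 1))"
    by (rule FA_single) simp
  ultimately have "\<exists>f\<in>carr (FA (int (low g) - 1 + 1)). dA g = d\<^sub>A f"
    by metis
  moreover have "0 < int (low g) - 1"
    using assms by simp
  ultimately have "d\<^sub>A (dA g) = 0"
    using dA_exact_iff by blast
  moreover have "low h > 0" if "h \<in> Poly_Mapping.keys (lift_gen ex g)" for h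
  proof -
    have "int (low h) = int (low g) - 1"
      using lift_gen_carr[of g] that assms unfolding FB_carr_iff by auto
    then show ?thesis
      using assms by linarith
  qed
  ultimately show ?thesis
    using map_proj_lift_gen[of g] assms by (simp add: ddg_def map_proj_d0)
qed

lemma ddg_relR: "low g \<ge> 2 \<Longrightarrow> Poly_Mapping.lookup (ddg ex g) h \<in> relR"
  using iffD1[OF map_proj_eq_0_iff map_proj_ddg] by simp

text \<open>Each term of ddg has a right factor coming from a generator of lower index 1, hence
  augmentation 0. This makes \<open>aug_A\<close> applicable to A(a, ddg).\<close>

lemma aug_ddg:
  assumes "low g = 2"
  shows "aug_B0 (Poly_Mapping.lookup (ddg ex g) h) = 0"
proof -
  have "aug_B0 (Poly_Mapping.lookup (lift_gen ex k) h) = 0"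
    if "k \<in> Poly_Mapping.keys (lift_gen ex g)" for k
    using lift_gen_carr[of g] that assms by (intro aug_lift_gen) (auto simp: FB_carr_iff)
  then show ?thesis
    unfolding ddg_def lift_d0_def
    by (simp add: lookup_lin_ext additive_sum[OF add_subgroup_UNIV aug_B0_add] aug_B0_mult)
qed

text \<open>The second component of a coefficient gets multiplied by the projection of an entry of
  ddg, which is 0.\<close>

lemma map_snd_d1_d1:
  assumes "\<And>g. g \<in> Poly_Mapping.keys y \<Longrightarrow> low g \<ge> 2"
  shows "Poly_Mapping.map snd (d1 (d1 y)) = 0"
proof -
  have "Poly_Mapping.map snd (lin_ext rmulB (ddg ex) y) = lin_ext (*) (\<lambda>_. 0) (Poly_Mapping.map snd y)"
    using ddg_relR[OF assms]
    by (intro map_lin_ext[OF biadditive_rmulB biadditive_times add_subgroup_UNIV])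
      (auto simp: rmulB_def relR_def split: prod.split)
  also have "\<dots> = 0"
    by (simp add: lin_ext_def)
  finally show ?thesis
    by (simp add: d1_d1)
qed

lemma map_proj_d0_d0: 
  assumes "\<And>g. g \<in> Poly_Mapping.keys x \<Longrightarrow> low g \<ge> 2"
  shows "Poly_Mapping.map proj (d0 (d0 x)) = 0"
  unfolding d0_d0 map_proj_eq_0_iff using ddg_relR[OF assms]
  by (auto simp: lookup_lin_ext intro!: add_subgroup_sum add_subgroup_relR relR_mult(1))

lemma coeff_sum_aug_d0:
  assumes "x \<in> carr (FB 1)"
  shows "coeff_sum aug_B0 (d0 x) = 0"
  unfolding lift_d0_def using assms
  by (intro coeff_sum_lin_ext_eq_0 biadditive_times aug_B0_add)
    (simp add: aug_B0_mult aug_lift_gen FB_carr_iff)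

lemma coeff_sum_eps1_d1:
  assumes "y \<in> carr (FB1 1)"
  shows "coeff_sum eps1 (d1 y) = 0"
  unfolding lift_d1_def
proof (rule coeff_sum_lin_ext_eq_0[OF biadditive_rmulB eps1_add])
  fix g h
  assume "g \<in> Poly_Mapping.keys y"
  then have "low g = 1"
    using assms by (auto simp: FB1_carr_iff)
  then show "eps1 (rmulB (Poly_Mapping.lookup y g) (Poly_Mapping.lookup (lift_gen ex g) h)) = 0"
    by (auto simp: eps1_def rmulB_def aug_B0_mult aug_steen_mult aug_steen_proj aug_lift_gen zero_prod_def
        split: prod.split)
qed

section \<open>The sequence as a secondary complex\<close>

lemma pair_module_hom_seq:
  "pair_module_hom (secB A) (seq_mod A low deg (n + 1)) (seq_mod A low deg n) (seq_d0 ex n) (seq_d1 ex n)"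
proof (cases "n = -1")
  case True
  have "pair_module_hom (secB A) (free_pair_module deg (gens low (n + 1)) (secB A)) (second_factor n)
      (coeff_sum aug_B0) (coeff_sum eps1)"
    using pair_module_hom_coeff_sum[OF pair_algebra pair_module_GS pair_module_hom_GS aug_B0_add eps1_add,
        of "gens low 0" deg] deg_low_0 True
    by (simp add: second_factor_def gens_def)
  then have "pair_module_hom (secB A) (seq_mod A low deg (n + 1)) (seq_mod A low deg n)
      (\<lambda>(x, v). (0, coeff_sum aug_B0 x)) (\<lambda>(y, w). (0, coeff_sum eps1 y))"
    unfolding seq_mod_eq by (rule pair_module_hom_prod_offdiag) (rule pair_module_free[OF pair_algebra])
  then show ?thesis
    using True by (simp add: seq_d0_def seq_d1_def)
next
  case False
  have "pair_module_hom (secB A) (seq_mod A low deg (n + 1)) (seq_mod A low deg n)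
      (\<lambda>(x, v). (d0 x, 0)) (\<lambda>(y, w). (d1 y, 0))"
    unfolding seq_mod_eq
    by (rule pair_module_hom_prod_diag[OF pair_module_hom_d[OF False] pair_module_second_factor])
  then show ?thesis
    using False by (simp add: seq_d0_def seq_d1_def)
qed

text \<open>What remains of a secondary complex when only the free factors are kept. The last
  condition is the equation H d = d H in position -1, where the left side vanishes and d on the
  right is the augmentation.\<close>

definition completion_maps :: "(nat \<Rightarrow> ('g \<Rightarrow>\<^sub>0 B0) \<Rightarrow> 'g \<Rightarrow>\<^sub>0 B1) \<Rightarrow> bool" where
  "completion_maps H \<longleftrightarrow>
     (\<forall>m. graded_hom (FB (int m + 2)) (FB1 (int m)) (H m)) \<and>
     (\<forall>m b. \<forall>x\<in>carr (FB (int m + 2)).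
        H m (Poly_Mapping.map ((*) b) x) = Poly_Mapping.map (lmulB A b) (H m x)) \<and>
     (\<forall>m. \<forall>x\<in>carr (FB (int m + 2)). Poly_Mapping.map fst (H m x) = d0 (d0 x)) \<and>
     (\<forall>m. \<forall>y\<in>carr (FB1 (int m + 2)). d1 (d1 y) = H m (Poly_Mapping.map fst y)) \<and>
     (\<forall>m. \<forall>x\<in>carr (FB (int m + 3)). H m (d0 x) = d1 (H (m + 1) x)) \<and>
     (\<forall>x\<in>carr (FB 2). coeff_sum eps1 (H 0 x) = 0)"

lemma completion_mapsD:
  assumes "completion_maps H"
  shows "graded_hom (FB (int m + 2)) (FB1 (int m)) (H m)"
    and "x \<in> carr (FB (int m + 2)) \<Longrightarrow>
      H m (Poly_Mapping.map ((*) b) x) = Poly_Mapping.map (lmulB A b) (H m x)"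
    and "x \<in> carr (FB (int m + 2)) \<Longrightarrow> Poly_Mapping.map fst (H m x) = d0 (d0 x)"
    and "y \<in> carr (FB1 (int m + 2)) \<Longrightarrow> d1 (d1 y) = H m (Poly_Mapping.map fst y)"
    and "x \<in> carr (FB (int m + 3)) \<Longrightarrow> H m (d0 x) = d1 (H (m + 1) x)"
    and "x \<in> carr (FB 2) \<Longrightarrow> coeff_sum eps1 (H 0 x) = 0"
  using assms unfolding completion_maps_def by blast+

lemma seq_mod_simps:
  "mod0 (seq_mod A low deg n) = gprod (FB n) (if n = -1 then G0_graded else zero_graded)"
  "mod1 (seq_mod A low deg n) = gprod (FB1 n) (if n = -1 then GS1_graded else zero_graded)"
  "act0 (seq_mod A low deg n) b (f, x) = (Poly_Mapping.map ((*) b) f, aug_B0 b * x)"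
  "act1 (seq_mod A low deg n) b (h, z) = (Poly_Mapping.map (lmulB A b) h, GS_act1 A b z)"
  "mbdry (seq_mod A low deg n) (h, z) = (Poly_Mapping.map fst h, fst z)"
  by (simp_all add: seq_mod_def)

lemma zero_graded_simps [simp]: "carr zero_graded = {0}" "piece zero_graded n = {0}"
  by (simp_all add: zero_graded_def)

lemma completion_maps_of_complex:
  assumes "secondary_complex (secB A) (seq_mod A low deg) (seq_d0 ex) (seq_d1 ex) (seq_H H)"
  shows "completion_maps H"
proof -
  note c = assms[unfolded secondary_complex_def]
  have nat: "nat (int m + 1) = m + 1" for m
    by simp
  have hom: "graded_hom (FB (int m + 2)) (FB1 (int m)) (H m)" for m
  proof -
    have "graded_hom (mod0 (seq_mod A low deg (int m + 2))) (mod1 (seq_mod A low deg (int m))) (seq_H H (int m))"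
      using c by blast
    then show ?thesis
      by (simp add: graded_hom_def seq_mod_simps gprod_carr gprod_piece seq_H_def Ball_def)
  qed
  have lin: "H m (Poly_Mapping.map ((*) b) x) = Poly_Mapping.map (lmulB A b) (H m x)"
    if "x \<in> carr (FB (int m + 2))" for m b x
  proof -
    have "left_linear (lev0 (secB A)) (mod0 (seq_mod A low deg (int m + 2)))
       (act0 (seq_mod A low deg (int m + 2))) (act1 (seq_mod A low deg (int m))) (seq_H H (int m))"
      using c by blast
    then show ?thesis
      using that by (simp add: left_linear_def seq_mod_simps gprod_carr seq_H_def Ball_def)
  qed
  have fst: "Poly_Mapping.map fst (H m x) = d0 (d0 x)" if "x \<in> carr (FB (int m + 2))" for m x
  proof -
    have "\<forall>x\<in>carr (mod0 (seq_mod A low deg (int m + 2))).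
        seq_d0 ex (int m) (seq_d0 ex (int m + 1) x) = mbdry (seq_mod A low deg (int m)) (seq_H H (int m) x)"
      using c by blast
    from bspec[OF this, of "(x, 0)"] show ?thesis
      using that by (simp add: seq_mod_simps gprod_carr seq_d0_def seq_H_def)
  qed
  have dd: "d1 (d1 y) = H m (Poly_Mapping.map fst y)" if "y \<in> carr (FB1 (int m + 2))" for m y
  proof -
    have "\<forall>y\<in>carr (mod1 (seq_mod A low deg (int m + 2))).
        seq_d1 ex (int m) (seq_d1 ex (int m + 1) y) = seq_H H (int m) (mbdry (seq_mod A low deg (int m + 2)) y)"
      using c by blast
    from bspec[OF this, of "(y, 0)"] show ?thesis
      using that by (simp add: seq_mod_simps gprod_carr seq_d1_def seq_H_def)
  qed
  have comm: "\<forall>x\<in>carr (mod0 (seq_mod A low deg (n + 3))).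
        seq_H H n (seq_d0 ex (n + 2) x) = seq_d1 ex n (seq_H H (n + 1) x)" for n
    using c by blast
  have Hd: "H m (d0 x) = d1 (H (m + 1) x)" if "x \<in> carr (FB (int m + 3))" for m x
    using bspec[OF comm[of "int m"], of "(x, 0)"] that
    by (simp add: seq_mod_simps gprod_carr seq_d0_def seq_d1_def seq_H_def nat)
  have eps: "coeff_sum eps1 (H 0 x) = 0" if "x \<in> carr (FB 2)" for x
    using bspec[OF comm[of "-1"], of "(x, 0)"] that
    by (simp add: seq_mod_simps gprod_carr seq_d0_def seq_d1_def seq_H_def zero_prod_def)
  show ?thesis
    unfolding completion_maps_def using hom lin fst dd Hd eps by blast
qed

lemma secondary_complex_of_maps:
  assumes "completion_maps H"
  shows "secondary_complex (secB A) (seq_mod A low deg) (seq_d0 ex) (seq_d1 ex) (seq_H H)"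
proof -
  note H = completion_mapsD[OF assms]
  have H_0: "H m 0 = 0" for m
    by (rule graded_hom_0[OF graded_group_FB H(1)])
  have cases: "n < -1 \<or> n = -1 \<or> (\<exists>m. n = int m)" for n
    by (cases n) auto
  have neg: "x = 0" if "x \<in> carr (FB n)" "n < 0" for x n
    using that by (auto dest: free_graded_carr_empty)
  have neg1: "y = 0" if "y \<in> carr (FB1 n)" "n < 0" for y n
    using that by (auto dest: free_graded_carr_empty)
  have nat: "nat (int m + 1) = m + 1" for m
    by simp
  have "graded_hom (mod0 (seq_mod A low deg (n + 2))) (mod1 (seq_mod A low deg n)) (seq_H H n) \<and>
      left_linear (lev0 (secB A)) (mod0 (seq_mod A low deg (n + 2))) (act0 (seq_mod A low deg (n + 2)))
        (act1 (seq_mod A low deg n)) (seq_H H n)" for n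
  proof (cases "n < 0")
    case True
    have z: "seq_H H n = (\<lambda>_. 0)"
      using True by (simp add: seq_H_def fun_eq_iff)
    show ?thesis
      unfolding z graded_hom_def left_linear_def
      using pair_module_act_0[OF pair_module_seq[where low = low and deg = deg]]
        pair_module_0_mem[OF pair_module_seq[where low = low and deg = deg]] by simp
  next
    case False
    then obtain m where n: "n = int m"
      using nonneg_int_cases[of n] by auto
    show ?thesis
      using H(1)[of m] H(2)[of _ m] unfolding n
      by (auto simp: graded_hom_def left_linear_def seq_mod_simps gprod_carr gprod_piece seq_H_def
          GS_act1_def GS_lift_def lmulB_def eps1_def zero_prod_def A_0_right)
  qed
  moreover have "seq_d0 ex n (seq_d0 ex (n + 1) x) = mbdry (seq_mod A low deg n) (seq_H H n x)"
    if "x \<in> carr (mod0 (seq_mod A low deg (n + 2)))" for n x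
  proof -
    obtain f v where "x = (f, v)"
      by (cases x)
    with that have x: "x = (f, v)" "f \<in> carr (FB (n + 2))"
      by (simp_all add: seq_mod_simps gprod_carr)
    consider "n < -1" | "n = -1" | m where "n = int m"
      using cases by blast
    then show ?thesis
    proof cases
      case 1
      \<comment> \<open>In position -2 the source is the free module of lower index 0. There the
        first map ends in G^Sigma and the second one discards that factor, so both sides are
        0.\<close>
      have "f = 0" if "n \<noteq> -2"
        using neg[OF x(2)] 1 that by simp
      with 1 show ?thesis
        using x(1) by (cases "n = -2") (auto simp: seq_mod_def seq_d0_def seq_H_def zero_prod_def)
    next
      case 2
      then show ?thesis
        using x coeff_sum_aug_d0 by (simp add: seq_mod_def seq_d0_def seq_H_def zero_prod_def)
    next
      case 3
      then show ?thesis
        using x H(3)[of f] by (simp add: seq_mod_def seq_d0_def seq_H_def zero_prod_def)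
    qed
  qed
  moreover have "seq_d1 ex n (seq_d1 ex (n + 1) y) = seq_H H n (mbdry (seq_mod A low deg (n + 2)) y)"
    if "y \<in> carr (mod1 (seq_mod A low deg (n + 2)))" for n y
  proof -
    obtain f v where "y = (f, v)"
      by (cases y)
    with that have y: "y = (f, v)" "f \<in> carr (FB1 (n + 2))"
      by (simp_all add: seq_mod_simps gprod_carr)
    consider "n < -1" | "n = -1" | m where "n = int m"
      using cases by blast
    then show ?thesis
    proof cases
      case 1
      have "f = 0" if "n \<noteq> -2"
        using neg1[OF y(2)] 1 that by simp
      with 1 show ?thesis
        using y(1) by (cases "n = -2") (auto simp: seq_mod_def seq_d1_def seq_H_def zero_prod_def)
    next
      case 2
      then show ?thesis
        using y coeff_sum_eps1_d1 by (simp add: seq_mod_def seq_d1_def seq_H_def zero_prod_def)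
    next
      case 3
      then show ?thesis
        using y H(4)[of f] by (simp add: seq_mod_def seq_d1_def seq_H_def zero_prod_def)
    qed
  qed
  moreover have "seq_H H n (seq_d0 ex (n + 2) x) = seq_d1 ex n (seq_H H (n + 1) x)"
    if "x \<in> carr (mod0 (seq_mod A low deg (n + 3)))" for n x
  proof -
    obtain f v where "x = (f, v)"
      by (cases x)
    with that have x: "x = (f, v)" "f \<in> carr (FB (n + 3))"
      by (simp_all add: seq_mod_simps gprod_carr)
    consider "n < -1" | "n = -1" | m where "n = int m"
      using cases by blast
    then show ?thesis
    proof cases
      case 1
      then show ?thesis
        by (simp add: seq_d1_def seq_H_def zero_prod_def)
    next
      case 2
      then show ?thesis
        using x H(6)[of f] by (simp add: seq_d1_def seq_H_def zero_prod_def)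
    next
      case 3
      then show ?thesis
        using x H(5)[of f] by (simp add: seq_d0_def seq_d1_def seq_H_def zero_prod_def nat)
    qed
  qed
  ultimately show ?thesis
    unfolding secondary_complex_def using pair_module_seq pair_module_hom_seq by blast
qed

section \<open>Exactness\<close>

lemma d1_pm_pair_0:
  assumes "z \<in> carr (FA (int m + 1))"
  shows "d1 (pm_pair 0 z) = pm_pair 0 (d\<^sub>A z)"
proof (rule pm_prod_eqI)
  show "Poly_Mapping.map fst (d1 (pm_pair 0 z)) = Poly_Mapping.map fst (pm_pair 0 (d\<^sub>A z))"
    by (simp add: map_fst_d1)
  have "low g > 0" if "g \<in> Poly_Mapping.keys z" for g
    using assms that by (force simp: FA_carr_iff)
  then show "Poly_Mapping.map snd (d1 (pm_pair 0 z)) = Poly_Mapping.map snd (pm_pair 0 (d\<^sub>A z))"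
    by (subst map_snd_d1) (auto simp: keys_pm_pair)
qed

lemma exact_pos:
  assumes "completion_maps H" and c: "c \<in> carr (FB (int m + 1))" and \<gamma>: "\<gamma> \<in> carr (FB1 (int m))"
    and eq: "d0 c = Poly_Mapping.map fst \<gamma>"
    and eq0: "m = 0 \<Longrightarrow> coeff_sum eps1 \<gamma> = 0" and eqS: "m > 0 \<Longrightarrow> H (m - 1) c = d1 \<gamma>"
  shows "\<exists>b\<in>carr (FB (int m + 2)). \<exists>\<beta>\<in>carr (FB1 (int m + 1)).
    c = d0 b + Poly_Mapping.map fst \<beta> \<and> \<gamma> = H m b + d1 \<beta>"
proof -
  note H = completion_mapsD[OF assms(1)]
  have pos: "low g > 0" if "f \<in> carr (FB (int m + 1))" "g \<in> Poly_Mapping.keys f" for f g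
    using that by (force simp: FB_carr_iff)
  have "d\<^sub>A (Poly_Mapping.map proj c) = 0"
    using map_proj_d0[of c, OF pos, OF c] map_proj_map_fst[OF \<gamma>] eq by simp
  then obtain a where a: "a \<in> carr (FA (int m + 2))" "Poly_Mapping.map proj c = d\<^sub>A a"
    using dA_exact_iff[of "int m + 1" "Poly_Mapping.map proj c"] map_proj_FB[OF c] by (auto simp: add.commute)
  obtain b where b: "b \<in> carr (FB (int m + 2))" "Poly_Mapping.map proj b = a"
    using lift_free_carr[OF a(1)] by blast
  have pos2: "low g > 0" if "g \<in> Poly_Mapping.keys b" for g
    using b(1) that by (force simp: FB_carr_iff)
  define \<rho> where "\<rho> = c - d0 b"
  have "d0 b \<in> carr (FB (int m + 1))"
    using graded_homD(1)[OF d0_hom, of "int m + 1" b] b(1) by (simp add: add.commute)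
  then have \<rho>: "\<rho> \<in> carr (FB (int m + 1))"
    unfolding \<rho>_def using FB_diff[OF c] by blast
  have "Poly_Mapping.map proj \<rho> = 0"
    by (simp add: \<rho>_def map_proj_diff map_proj_d0[OF pos2] a(2) b(2))
  then have \<beta>0: "pm_pair \<rho> 0 \<in> carr (FB1 (int m + 1))"
    by (intro pm_pair_FB1 \<rho>) (simp_all add: FA_carr_iff)
  define \<gamma>' where "\<gamma>' = \<gamma> - H m b - d1 (pm_pair \<rho> 0)"
  have \<gamma>': "\<gamma>' \<in> carr (FB1 (int m))"
    unfolding \<gamma>'_def using graded_homD(1)[OF d1_hom, of "int m" "pm_pair \<rho> 0"]
    by (intro FB1_diff \<gamma> graded_homD(1)[OF H(1)] b(1)) (simp add: \<beta>0)
  have fst: "Poly_Mapping.map fst \<gamma>' = 0"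
    unfolding \<gamma>'_def map_fst_diff map_fst_d1 H(3)[OF b(1)] by (simp add: \<rho>_def d0_diff eq)
  define y where "y = Poly_Mapping.map snd \<gamma>'"
  have y: "y \<in> carr (FA (int m))"
    unfolding y_def by (rule map_snd_FB1[OF \<gamma>'])
  have "\<exists>z\<in>carr (FA (int m + 1)). y = d\<^sub>A z"
  proof (cases "m = 0")
    case True
    \<comment> \<open>For m = 0, being a cycle means having augmentation 0, and each of the three
      terms of \<gamma>' has it: by hypothesis, by the condition on H in position -1, and because
      the augmentation kills boundaries.\<close>
    have "coeff_sum eps1 (x - x') = coeff_sum eps1 x - coeff_sum eps1 x'" for x x' :: "'g \<Rightarrow>\<^sub>0 B1"
      by (rule additive_diff[OF add_subgroup_UNIV]) (simp_all add: coeff_sum_add eps1_add)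
    then have "coeff_sum eps1 \<gamma>' = 0"
      using True eq0 H(6)[of b] b(1) coeff_sum_eps1_d1[of "pm_pair \<rho> 0"] \<beta>0 by (simp add: \<gamma>'_def)
    then have "coeff_sum aug_steen y = 0"
      unfolding y_def coeff_sum_eps1 by (simp add: zero_prod_def)
    then show ?thesis
      using aug_exact[of y] y True by simp
  next
    case False
    then obtain k where m: "m = k + 1"
      by (metis Suc_eq_plus1 not0_implies_Suc)
    have hom: "graded_hom (FB (int k + 2)) (FB1 (int k)) (H k)"
      by (rule H(1))
    have c': "c \<in> carr (FB (int k + 2))" and \<rho>': "\<rho> \<in> carr (FB (int k + 2))"
      and b': "b \<in> carr (FB (int k + 3))" and \<beta>0': "pm_pair \<rho> 0 \<in> carr (FB1 (int k + 2))"
      using c \<rho> b(1) \<beta>0 m by (simp_all add: algebra_simps)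
    have d0b: "d0 b \<in> carr (FB (int k + 2))"
      using \<open>d0 b \<in> carr (FB (int m + 1))\<close> m by (simp add: algebra_simps)
    \<comment> \<open>Along c = \<rho> + d b the value of H splits: \<rho> lies in R<g>, so H \<rho>
      is dd of (\<rho>, 0), while H d b = d H b. These cancel the two terms subtracted in
      \<gamma>'.\<close>
    have "H k c = H k \<rho> + H k (d0 b)"
      using graded_homD(2)[OF hom \<rho>' d0b] by (simp add: \<rho>_def)
    moreover have "d1 \<gamma> = H k c" "d1 (H m b) = H k (d0 b)" "d1 (d1 (pm_pair \<rho> 0)) = H k \<rho>"
      using eqS H(5)[OF b'] H(4)[OF \<beta>0'] m by auto
    ultimately have "d1 \<gamma>' = 0"
      by (simp add: \<gamma>'_def d1_diff)
    moreover have "low g > 0" if "g \<in> Poly_Mapping.keys \<gamma>'" for g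
      using \<gamma>' that m by (force simp: FB1_carr_iff)
    ultimately have "d\<^sub>A y = 0"
      using map_snd_d1[of \<gamma>'] by (simp add: y_def)
    then show ?thesis
      using dA_exact_iff[of "int m" y] y m by auto
  qed
  then obtain z where z: "z \<in> carr (FA (int m + 1))" "y = d\<^sub>A z"
    by blast
  have "\<gamma>' = pm_pair 0 y"
    by (rule pm_prod_eqI) (simp_all add: fst y_def)
  then have "\<gamma>' = d1 (pm_pair 0 z)"
    by (simp add: d1_pm_pair_0[OF z(1)] z(2))
  \<comment> \<open>The element \<beta> is (\<rho>, z): its first component corrects c and its
    second component corrects \<gamma>.\<close>
  then have "\<gamma> = H m b + d1 (pm_pair \<rho> 0 + pm_pair 0 z)"
    by (simp add: d1_add \<gamma>'_def algebra_simps)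
  moreover have "c = d0 b + Poly_Mapping.map fst (pm_pair \<rho> 0 + pm_pair 0 z)"
    by (simp add: map_fst_add \<rho>_def)
  moreover have "pm_pair 0 z \<in> carr (FB1 (int m + 1))"
    by (rule pm_pair_FB1) (simp_all add: z FB_carr_iff)
  ultimately show ?thesis
    using b(1) FB1_add[OF \<beta>0] by blast
qed

text \<open>Here \<gamma> = (s, e) lies in 2G + Sigma F. As s is even, the projection of c has
  augmentation 0 and is a boundary. Subtracting d b does not change the augmentation, so the
  remainder in R<g> still has augmentation s, and e is reached through the second component of
  \<beta>.\<close>

lemma exact_0:
  assumes c: "c \<in> carr (FB 0)" and s: "s \<in> {0, 2}" and eq: "coeff_sum aug_B0 c = s"
  shows "\<exists>b\<in>carr (FB 1). \<exists>\<beta>\<in>carr (FB1 0). c = d0 b + Poly_Mapping.map fst \<beta> \<and> (s, e) = coeff_sum eps1 \<beta>"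
proof -
  have "coeff_sum aug_steen (Poly_Mapping.map proj c) = red4 (coeff_sum aug_B0 c)"
    by (rule coeff_sum_map[OF add_subgroup_UNIV, symmetric]) (simp_all add: red4_add aug_steen_proj)
  then have "coeff_sum aug_steen (Poly_Mapping.map proj c) = 0"
    using eq s by (auto simp: red4_def)
  then obtain a where a: "a \<in> carr (FA 1)" "Poly_Mapping.map proj c = d\<^sub>A a"
    using aug_exact[OF map_proj_FB[OF c]] by blast
  obtain b where b: "b \<in> carr (FB 1)" "Poly_Mapping.map proj b = a"
    using lift_free_carr[OF a(1)] by blast
  have pos: "low g > 0" if "g \<in> Poly_Mapping.keys b" for g
    using b(1) that by (force simp: FB_carr_iff)
  obtain g where g: "low g = 0"
    using ex_low_0 by blast
  define \<rho> where "\<rho> = c - d0 b"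
  \<comment> \<open>The unit multiple of the generator of lower index 0 realises the class e in
    Sigma F.\<close>
  define z where "z = Poly_Mapping.single g (if e = 0 then 0 else 1 :: steenrod)"
  have "d0 b \<in> carr (FB 0)"
    using graded_homD(1)[OF d0_hom, of 0 b] b(1) by simp
  then have \<rho>: "\<rho> \<in> carr (FB 0)"
    unfolding \<rho>_def using FB_diff[OF c] by blast
  have "Poly_Mapping.map proj \<rho> = 0"
    by (simp add: \<rho>_def map_proj_diff map_proj_d0[OF pos] a(2) b(2))
  moreover have "z \<in> carr (FA 0)"
    unfolding z_def by (rule FA_single) (simp add: g)
  ultimately have "pm_pair \<rho> z \<in> carr (FB1 0)"
    using pm_pair_FB1[OF \<rho>] by blast
  moreover have "coeff_sum aug_B0 \<rho> = s"
    using additive_diff[OF add_subgroup_UNIV coeff_sum_add[OF aug_B0_add], of c "d0 b"]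
      coeff_sum_aug_d0[OF b(1)] eq by (simp add: \<rho>_def)
  moreover have "coeff_sum aug_steen z = e"
    by (cases e) (simp_all add: z_def coeff_sum_single)
  ultimately show ?thesis
    using b(1) by (intro bexI[of _ b] bexI[of _ "pm_pair \<rho> z"]) (simp_all add: coeff_sum_eps1 \<rho>_def)
qed

text \<open>The work lies in positive positions and in position 0; in position -1 exactness is
  surjectivity of the augmentation, and below it all modules vanish.\<close>

lemma exact_secondary_complex_iff:
  "exact_secondary_complex (secB A) (seq_mod A low deg) (seq_d0 ex) (seq_d1 ex) (seq_H H) \<longleftrightarrow>
     completion_maps H"
proof
  assume H: "completion_maps H"
  have "\<exists>b\<in>carr (mod0 (seq_mod A low deg (n + 1))). \<exists>\<beta>\<in>carr (mod1 (seq_mod A low deg n)).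
      c = seq_d0 ex n b + mbdry (seq_mod A low deg n) \<beta> \<and>
      \<gamma> = seq_H H (n - 1) b + seq_d1 ex (n - 1) \<beta>"
    if c: "c \<in> carr (mod0 (seq_mod A low deg n))" and \<gamma>: "\<gamma> \<in> carr (mod1 (seq_mod A low deg (n - 1)))"
      and 1: "seq_d0 ex (n - 1) c = mbdry (seq_mod A low deg (n - 1)) \<gamma>"
      and 2: "seq_H H (n - 2) c = seq_d1 ex (n - 2) \<gamma>" for n c \<gamma>
  proof -
    have "n = int (nat (n - 1)) + 1" if "n > 0"
      using that by simp
    then have "n < -1 \<or> n = -1 \<or> n = 0 \<or> (\<exists>m. n = int m + 1)"
      by (cases "n > 0") (blast, linarith)
    then consider "n < -1" | "n = -1" | "n = 0" | m where "n = int m + 1"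
      by blast
    then show ?thesis
    proof cases
      case 1
      then have "c = 0" "\<gamma> = 0"
        using c \<gamma> by (auto simp: seq_mod_simps gprod_carr zero_prod_def dest: free_graded_carr_empty)
      moreover have "c = seq_d0 ex n 0 + mbdry (seq_mod A low deg n) 0"
        "\<gamma> = seq_H H (n - 1) 0 + seq_d1 ex (n - 1) 0" if "c = 0" "\<gamma> = 0"
        using 1 that by (simp_all add: seq_mod_def seq_d0_def seq_d1_def seq_H_def zero_prod_def)
      ultimately show ?thesis
        using pair_module_0_mem[OF pair_module_seq[where low = low and deg = deg]] by blast
    next
      case 2
      then have \<gamma>0: "\<gamma> = 0"
        using \<gamma> by (auto simp: seq_mod_simps gprod_carr zero_prod_def dest: free_graded_carr_empty)
      obtain x where x: "c = (0, x)"
        using c 2 by (auto simp: seq_mod_simps gprod_carr dest: free_graded_carr_empty)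
      obtain g where g: "low g = 0"
        using ex_low_0 by blast
      let ?b = "Poly_Mapping.single g (Poly_Mapping.single 0 x) :: 'g \<Rightarrow>\<^sub>0 B0"
      have "?b \<in> carr (FB 0)"
        by (rule FB_single) (simp add: g)
      moreover have "coeff_sum aug_B0 ?b = x"
        by (simp add: coeff_sum_single)
      ultimately show ?thesis
        using 2 x \<gamma>0
        by (intro bexI[of _ "(?b, 0)"] bexI[of _ 0])
          (simp_all add: GS1_graded_def B1_carr relR_def free_graded_carr_iff seq_mod_def gprod_carr seq_d0_def seq_d1_def seq_H_def zero_prod_def)
    next
      case 3
      then obtain f s e where f: "c = (f, 0)" "f \<in> carr (FB 0)" and s: "\<gamma> = (0, s, e)" "s \<in> {0, 2}"
        using c \<gamma> by (auto simp: seq_mod_simps gprod_carr GS1_graded_def dest: free_graded_carr_empty)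
      have "coeff_sum aug_B0 f = s"
        using 1 3 f s by (simp add: seq_d0_def seq_mod_def)
      then obtain b \<beta> where "b \<in> carr (FB 1)" "\<beta> \<in> carr (FB1 0)" "f = d0 b + Poly_Mapping.map fst \<beta>"
        "(s, e) = coeff_sum eps1 \<beta>"
        using exact_0[OF f(2) s(2)] by blast
      then show ?thesis
        using 3 f s
        by (intro bexI[of _ "(b, 0)"] bexI[of _ "(\<beta>, 0)"])
          (simp_all add: seq_mod_def gprod_carr seq_d0_def seq_d1_def seq_H_def zero_prod_def)
    next
      case (4 m)
      then obtain f h where f: "c = (f, 0)" "f \<in> carr (FB (int m + 1))"
        and h: "\<gamma> = (h, 0)" "h \<in> carr (FB1 (int m))"
        using c \<gamma> by (auto simp: seq_mod_simps gprod_carr zero_prod_def)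
      have "d0 f = Poly_Mapping.map fst h"
        using 1 4 f h by (simp add: seq_d0_def seq_mod_def)
      moreover have "coeff_sum eps1 h = 0" if "m = 0"
        using 2 4 that f h by (simp add: seq_H_def seq_d1_def zero_prod_def)
      moreover have "H (m - 1) f = d1 h" if "m > 0"
        using 2 4 that f h by (auto simp: seq_H_def seq_d1_def zero_prod_def nat_diff_distrib)
      ultimately obtain b \<beta> where "b \<in> carr (FB (int m + 2))" "\<beta> \<in> carr (FB1 (int m + 1))"
        "f = d0 b + Poly_Mapping.map fst \<beta>" "h = H m b + d1 \<beta>"
        using exact_pos[OF H f(2) h(2)] by blast
      then show ?thesis
        using 4 f h
        by (intro bexI[of _ "(b, 0)"] bexI[of _ "(\<beta>, 0)"])
          (simp_all add: seq_mod_def gprod_carr seq_d0_def seq_d1_def seq_H_def zero_prod_def add.commute)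
    qed
  qed
  then show "exact_secondary_complex (secB A) (seq_mod A low deg) (seq_d0 ex) (seq_d1 ex) (seq_H H)"
    unfolding exact_secondary_complex_def using secondary_complex_of_maps[OF H] by blast
qed (auto simp: exact_secondary_complex_def completion_maps_of_complex)

section \<open>Completions and the maps \<open>\<delta>\<close>\<close>

lemma completions_eq:
  "completions A low deg ex =
    {H. (\<forall>m. H m \<in> extensional (carr (FB (int m + 2)))) \<and> completion_maps H}"
  by (simp add: completions_def exact_secondary_complex_iff add.commute)

definition FS :: "int \<Rightarrow> ('g \<Rightarrow>\<^sub>0 steenrod) graded" where
  "FS n = free_graded deg (gens low n) (susp steen_graded)"

lemma FS_carr_iff: "f \<in> carr (FS n) \<longleftrightarrow> f \<in> carr (FA n)"
  by (simp add: FS_def free_graded_carr_iff susp_def)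

definition delta_maps :: "(nat \<Rightarrow> ('g \<Rightarrow>\<^sub>0 steenrod) \<Rightarrow> 'g \<Rightarrow>\<^sub>0 steenrod) \<Rightarrow> bool" where
  "delta_maps \<delta> \<longleftrightarrow>
     (\<forall>m. graded_hom (FA (int m + 2)) (FS (int m)) (\<delta> m)) \<and>
     (\<forall>m a g. low g = m + 2 \<longrightarrow>
        \<delta> m (Poly_Mapping.single g a) =
          Poly_Mapping.map ((*) a) (\<delta> m (Poly_Mapping.single g 1)) +
          Poly_Mapping.map (A a) (ddg ex g)) \<and>
     (\<forall>g. low g = 2 \<longrightarrow> coeff_sum aug_steen (\<delta> 0 (Poly_Mapping.single g 1)) = 0) \<and>
     (\<forall>m g. low g = m + 3 \<longrightarrow> d\<^sub>A (\<delta> (m + 1) (Poly_Mapping.single g 1)) = \<delta> m (dA g))"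

lemma delta_families_eq:
  "delta_families A low deg dA ex =
    {\<delta>. (\<forall>m. \<delta> m \<in> extensional (carr (FA (int m + 2)))) \<and> delta_maps \<delta>}"
  by (simp add: delta_families_def delta_maps_def FS_def add.commute)

section \<open>From a completion to delta\<close>

lemma d0_d0_single_1: "d0 (d0 (Poly_Mapping.single g 1)) = ddg ex g"
  unfolding d0_d0 by (rule poly_mapping_eqI) (simp add: lin_ext_single[OF biadditive_times] lookup_map_0)

lemma low_ge_2:
  assumes "x \<in> carr (FB (int m + 2))" "g \<in> Poly_Mapping.keys x"
  shows "low g \<ge> 2"
  using assms unfolding FB_carr_iff by fastforce

text \<open>Two lifts of one element differ by the boundary of a level 1 element (x - x', 0), where
  H is given by \<open>d1 (d1 _)\<close>, which has second component 0.\<close>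

lemma completion_maps_cong:
  assumes "completion_maps H" "x \<in> carr (FB (int m + 2))" "x' \<in> carr (FB (int m + 2))"
    and "Poly_Mapping.map proj x = Poly_Mapping.map proj x'"
  shows "Poly_Mapping.map snd (H m x) = Poly_Mapping.map snd (H m x')"
proof -
  note H = completion_mapsD[OF assms(1)]
  have diff: "x - x' \<in> carr (FB (int m + 2))"
    by (rule FB_diff[OF assms(2,3)])
  have "Poly_Mapping.map proj (x - x') = 0"
    by (simp add: map_proj_diff assms(4))
  then have "pm_pair (x - x') 0 \<in> carr (FB1 (int m + 2))"
    by (intro pm_pair_FB1 diff) (simp_all add: FA_carr_iff)
  from H(4)[OF this] have "H m (x - x') = d1 (d1 (pm_pair (x - x') 0))"
    by simp
  moreover have "H m (x - x') = H m x - H m x'"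
    by (rule additive_diff[OF graded_group_carr[OF graded_group_FB] _ assms(2,3)])
      (rule graded_homD(2)[OF H(1)])
  moreover have "Poly_Mapping.map snd (d1 (d1 (pm_pair (x - x') 0))) = 0"
    by (rule map_snd_d1_d1) (use low_ge_2[OF diff] in \<open>simp add: keys_pm_pair\<close>)
  ultimately have "Poly_Mapping.map snd (H m x - H m x') = 0"
    by metis
  then show ?thesis
    by (simp add: map_snd_diff)
qed

text \<open>An arbitrary choice, neither additive nor degree preserving. By
  \<open>delta_of_map_proj\<close> it may be traded for whichever lift suits the property being
  proved.\<close>

definition lift :: "nat \<Rightarrow> ('g \<Rightarrow>\<^sub>0 steenrod) \<Rightarrow> 'g \<Rightarrow>\<^sub>0 B0" where
  "lift m f = (SOME x. x \<in> carr (FB (int m + 2)) \<and> Poly_Mapping.map proj x = f)"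

lemma lift:
  assumes "f \<in> carr (FA (int m + 2))"
  shows "lift m f \<in> carr (FB (int m + 2))" "Poly_Mapping.map proj (lift m f) = f"
proof -
  have "\<exists>x. x \<in> carr (FB (int m + 2)) \<and> Poly_Mapping.map proj x = f"
    using lift_free_carr[OF assms] by blast
  from someI_ex[OF this] show "lift m f \<in> carr (FB (int m + 2))" "Poly_Mapping.map proj (lift m f) = f"
    by (simp_all add: lift_def)
qed

definition delta_of :: "(nat \<Rightarrow> ('g \<Rightarrow>\<^sub>0 B0) \<Rightarrow> 'g \<Rightarrow>\<^sub>0 B1) \<Rightarrow> nat \<Rightarrow> ('g \<Rightarrow>\<^sub>0 steenrod) \<Rightarrow> 'g \<Rightarrow>\<^sub>0 steenrod"
  where "delta_of H m = (\<lambda>f\<in>carr (FA (int m + 2)). Poly_Mapping.map snd (H m (lift m f)))"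

definition completion_of ::
  "(nat \<Rightarrow> ('g \<Rightarrow>\<^sub>0 steenrod) \<Rightarrow> 'g \<Rightarrow>\<^sub>0 steenrod) \<Rightarrow> nat \<Rightarrow> ('g \<Rightarrow>\<^sub>0 B0) \<Rightarrow> 'g \<Rightarrow>\<^sub>0 B1"
  where "completion_of \<delta> m =
    (\<lambda>x\<in>carr (FB (int m + 2)). pm_pair (d0 (d0 x)) (\<delta> m (Poly_Mapping.map proj x)))"

lemma delta_of_map_proj:
  assumes "completion_maps H" "x \<in> carr (FB (int m + 2))"
  shows "delta_of H m (Poly_Mapping.map proj x) = Poly_Mapping.map snd (H m x)"
proof -
  have "Poly_Mapping.map proj x \<in> carr (FA (int m + 2))"
    by (rule map_proj_FB[OF assms(2)])
  with lift[OF this] show ?thesis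
    using completion_maps_cong[OF assms(1) _ assms(2)] by (simp add: delta_of_def)
qed

lemma delta_maps_delta_of:
  assumes "completion_maps H"
  shows "delta_maps (delta_of H)"
proof -
  note H = completion_mapsD[OF assms] and \<delta> = delta_of_map_proj[OF assms]
  have H_carr: "H m x \<in> carr (FB1 (int m))" if "x \<in> carr (FB (int m + 2))" for m x
    by (rule graded_homD(1)[OF H(1) that])
  have "graded_hom (FA (int m + 2)) (FS (int m)) (delta_of H m)" for m
    unfolding graded_hom_def
  proof (intro conjI ballI allI)
    fix f
    assume f: "f \<in> carr (FA (int m + 2))"
    show "delta_of H m f \<in> carr (FS (int m))"
      using f lift[OF f] by (simp add: FS_carr_iff delta_of_def map_snd_FB1 H_carr)
    fix f'
    assume f': "f' \<in> carr (FA (int m + 2))"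
    note l = lift[OF f] lift[OF f']
    have "lift m f + lift m f' \<in> carr (FB (int m + 2))"
      using l add_subgroup_add[OF graded_group_carr[OF graded_group_FB]] by blast
    from \<delta>[OF this] show "delta_of H m (f + f') = delta_of H m f + delta_of H m f'"
      using \<delta>[OF l(1)] \<delta>[OF l(3)] l graded_homD(2)[OF H(1) l(1,3)]
      by (simp add: map_proj_add map_snd_add)
  next
    fix n f
    assume "f \<in> piece (FA (int m + 2)) n"
    \<comment> \<open>The chosen lift of f may be inhomogeneous, so a homogeneous one takes its
      place.\<close>
    then obtain x where x: "x \<in> piece (FB (int m + 2)) n" "Poly_Mapping.map proj x = f"
      using lift_free_piece by blast
    have "delta_of H m f = Poly_Mapping.map snd (H m x)"
      using \<delta>[OF graded_group_piece_carr[OF graded_group_FB x(1)]] x(2) by simp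
    moreover have "H m x \<in> piece (FB1 (int m)) n"
      by (rule graded_homD(3)[OF H(1) x(1)])
    ultimately show "delta_of H m f \<in> piece (FS (int m)) n"
      using keys_map_subset[of snd "H m x"]
      by (auto simp: FS_def free_graded_piece_iff B1_graded_def gprod_piece lookup_map_0 mem_Times_iff)
  qed
  moreover have "delta_of H m (Poly_Mapping.single g a) =
          Poly_Mapping.map ((*) a) (delta_of H m (Poly_Mapping.single g 1)) +
          Poly_Mapping.map (A a) (ddg ex g)" if g: "low g = m + 2" for m a g
  proof -
    obtain b where b: "proj b = a"
      using proj_surj by metis
    have s: "Poly_Mapping.single g c \<in> carr (FB (int m + 2))" for c
      by (rule FB_single) (simp add: g)
    have "delta_of H m (Poly_Mapping.single g a) = Poly_Mapping.map snd (H m (Poly_Mapping.single g b))"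
      using \<delta>[OF s[of b]] b by (simp add: map_single_0)
    \<comment> \<open>Left linearity of H; the action of b on (ddg, h(g)) is where the term A(a,
      ddg) enters.\<close>
    also have "H m (Poly_Mapping.single g b) = Poly_Mapping.map (lmulB A b) (H m (Poly_Mapping.single g 1))"
      using H(2)[OF s[of 1], of b] by (simp add: single_map_times_1[symmetric])
    also have "Poly_Mapping.map snd \<dots> =
        Poly_Mapping.map ((*) a) (Poly_Mapping.map snd (H m (Poly_Mapping.single g 1))) +
        Poly_Mapping.map (A a) (Poly_Mapping.map fst (H m (Poly_Mapping.single g 1)))"
    proof (rule poly_mapping_eqI)
      have "lmulB A b 0 = 0"
        by (simp add: lmulB_def zero_prod_def A_0_right)
      then show "Poly_Mapping.lookup (Poly_Mapping.map snd (Poly_Mapping.map (lmulB A b) y)) h =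
          Poly_Mapping.lookup (Poly_Mapping.map ((*) a) (Poly_Mapping.map snd y) +
            Poly_Mapping.map (A a) (Poly_Mapping.map fst y)) h" for y :: "'g \<Rightarrow>\<^sub>0 B1" and h
        by (simp add: lookup_add lookup_map_0[of "lmulB A b"] lookup_map_0[of "A a", OF A_0_right]
            lookup_map_0 b lmulB_def split: prod.split)
    qed
    also have "Poly_Mapping.map fst (H m (Poly_Mapping.single g 1)) = ddg ex g"
      using H(3)[OF s] d0_d0_single_1 by simp
    also have "Poly_Mapping.map snd (H m (Poly_Mapping.single g 1)) = delta_of H m (Poly_Mapping.single g 1)"
      using \<delta>[OF s[of 1]] by (simp add: map_single_0)
    finally show ?thesis .
  qed
  moreover have "coeff_sum aug_steen (delta_of H 0 (Poly_Mapping.single g 1)) = 0" if g: "low g = 2" for g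
  proof -
    have s: "Poly_Mapping.single g 1 \<in> carr (FB 2)"
      by (rule FB_single) (simp add: g)
    have "delta_of H 0 (Poly_Mapping.single g 1) = Poly_Mapping.map snd (H 0 (Poly_Mapping.single g 1))"
      using \<delta>[of "Poly_Mapping.single g 1" 0] s by (simp add: map_single_0)
    then show ?thesis
      using H(6)[OF s] unfolding coeff_sum_eps1 by (simp add: zero_prod_def)
  qed
  moreover have "d\<^sub>A (delta_of H (m + 1) (Poly_Mapping.single g 1)) = delta_of H m (dA g)"
    if g: "low g = m + 3" for m g
  proof -
    have s: "Poly_Mapping.single g 1 \<in> carr (FB (int m + 3))"
      by (rule FB_single) (simp add: g)
    then have s': "Poly_Mapping.single g 1 \<in> carr (FB (int (m + 1) + 2))"
      by (simp add: algebra_simps)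
    have d0: "d0 (Poly_Mapping.single g 1) = lift_gen ex g"
      unfolding lift_d0_def
      by (rule poly_mapping_eqI) (simp add: lin_ext_single[OF biadditive_times] lookup_map_0)
    \<comment> \<open>The literal lift is a lift of \<open>dA g\<close> and at the same time d of
      the generator, so H d = d H computes delta on \<open>dA g\<close>.\<close>
    have "lift_gen ex g \<in> carr (FB (int m + 2))"
      using lift_gen_carr[of g] g by (simp add: algebra_simps)
    from \<delta>[OF this] have "delta_of H m (dA g) = Poly_Mapping.map snd (H m (lift_gen ex g))"
      using map_proj_lift_gen[of g] g by simp
    also have "\<dots> = Poly_Mapping.map snd (d1 (H (m + 1) (Poly_Mapping.single g 1)))"
      using H(5)[OF s] d0 by simp
    also have "\<dots> = d\<^sub>A (Poly_Mapping.map snd (H (m + 1) (Poly_Mapping.single g 1)))"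
    proof (rule map_snd_d1)
      fix h
      assume "h \<in> Poly_Mapping.keys (H (m + 1) (Poly_Mapping.single g 1))"
      then show "low h > 0"
        using H_carr[OF s'] unfolding FB1_carr_iff by fastforce
    qed
    also have "Poly_Mapping.map snd (H (m + 1) (Poly_Mapping.single g 1)) =
        delta_of H (m + 1) (Poly_Mapping.single g 1)"
      using \<delta>[OF s'] by (simp add: map_single_0)
    finally show ?thesis
      by simp
  qed
  ultimately show ?thesis
    unfolding delta_maps_def by blast
qed

section \<open>From delta to a completion\<close>

lemma delta_mapsD:
  assumes "delta_maps \<delta>"
  shows "graded_hom (FA (int m + 2)) (FS (int m)) (\<delta> m)"
    and "low g = m + 2 \<Longrightarrow> \<delta> m (Poly_Mapping.single g a) =
        Poly_Mapping.map ((*) a) (\<delta> m (Poly_Mapping.single g 1)) + Poly_Mapping.map (A a) (ddg ex g)"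
    and "low g = 2 \<Longrightarrow> coeff_sum aug_steen (\<delta> 0 (Poly_Mapping.single g 1)) = 0"
    and "low g = m + 3 \<Longrightarrow> d\<^sub>A (\<delta> (m + 1) (Poly_Mapping.single g 1)) = \<delta> m (dA g)"
  using assms unfolding delta_maps_def by blast+

lemma delta_0: "delta_maps \<delta> \<Longrightarrow> \<delta> m 0 = 0"
  using graded_homD(2)[OF delta_mapsD(1), of \<delta> 0 m 0] by (simp add: FA_carr_iff)

lemma map_times_add:
  "Poly_Mapping.map ((*) a) (f + f') = Poly_Mapping.map ((*) a) f + Poly_Mapping.map ((*) a) f'"
  for a :: "'b::ring"
  by (rule map_add_fun[OF add_subgroup_UNIV]) (simp_all add: distrib_left)

text \<open>The prescribed formula for multiples of generators holds for multiples of any element,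
  with ddx in place of ddg. On c g this is the cocycle identity \<open>A_mult_left\<close>. It
  amounts to left linearity of the completion built from delta.\<close>

lemma delta_map_times:
  assumes "delta_maps \<delta>" "x \<in> carr (FB (int m + 2))"
  shows "\<delta> m (Poly_Mapping.map proj (Poly_Mapping.map ((*) b) x)) =
    Poly_Mapping.map (A (proj b)) (d0 (d0 x)) + Poly_Mapping.map ((*) (proj b)) (\<delta> m (Poly_Mapping.map proj x))"
  using graded_group_B0 assms(2)
proof (induction rule: free_graded_induct)
  case zero
  show ?case
    by (simp add: delta_0[OF assms(1)])
next
  case (single g c)
  have g: "low g = m + 2"
    using single(1) by (auto simp: gens_def)
  let ?t = "\<delta> m (Poly_Mapping.single g 1)"
  have dd: "d0 (d0 (Poly_Mapping.single g c)) = Poly_Mapping.map ((*) c) (ddg ex g)"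
    by (simp add: d0_d0 lin_ext_single biadditive_times)
  have "\<delta> m (Poly_Mapping.map proj (Poly_Mapping.map ((*) b) (Poly_Mapping.single g c))) =
      \<delta> m (Poly_Mapping.single g (proj b * proj c))"
    by (simp add: map_single_0 proj_mult)
  also have "\<dots> = Poly_Mapping.map ((*) (proj b * proj c)) ?t + Poly_Mapping.map (A (proj b * proj c)) (ddg ex g)"
    by (rule delta_mapsD(2)[OF assms(1) g])
  also have "\<dots> = Poly_Mapping.map (A (proj b)) (Poly_Mapping.map ((*) c) (ddg ex g)) +
      Poly_Mapping.map ((*) (proj b)) (Poly_Mapping.map ((*) (proj c)) ?t + Poly_Mapping.map (A (proj c)) (ddg ex g))"
  proof (rule poly_mapping_eqI)
    fix h
    have "A (proj b * proj c) (Poly_Mapping.lookup (ddg ex g) h) =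
        A (proj b) (c * Poly_Mapping.lookup (ddg ex g) h) + proj b * A (proj c) (Poly_Mapping.lookup (ddg ex g) h)"
      using ddg_relR[of g] g by (intro A_mult_left) simp
    then show "Poly_Mapping.lookup (Poly_Mapping.map ((*) (proj b * proj c)) ?t +
        Poly_Mapping.map (A (proj b * proj c)) (ddg ex g)) h =
      Poly_Mapping.lookup (Poly_Mapping.map (A (proj b)) (Poly_Mapping.map ((*) c) (ddg ex g)) +
        Poly_Mapping.map ((*) (proj b)) (Poly_Mapping.map ((*) (proj c)) ?t + Poly_Mapping.map (A (proj c)) (ddg ex g))) h"
      by (simp add: lookup_add lookup_map_0[of "A _", OF A_0_right] lookup_map_0[of "(*) _"] algebra_simps)
  qed
  also have "Poly_Mapping.map ((*) (proj c)) ?t + Poly_Mapping.map (A (proj c)) (ddg ex g) =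
      \<delta> m (Poly_Mapping.map proj (Poly_Mapping.single g c))"
    using delta_mapsD(2)[OF assms(1) g, of "proj c"] by (simp add: map_single_0)
  finally show ?case
    by (simp add: dd)
next
  case (add x y)
  have "Poly_Mapping.lookup (d0 (d0 z)) h \<in> relR" if "z \<in> carr (FB (int m + 2))" for z h
    using map_proj_d0_d0[of z, OF low_ge_2, OF that] map_proj_eq_0_iff by metis
  then have dd: "Poly_Mapping.map (A (proj b)) (d0 (d0 x) + d0 (d0 y)) =
      Poly_Mapping.map (A (proj b)) (d0 (d0 x)) + Poly_Mapping.map (A (proj b)) (d0 (d0 y))"
    using add.hyps by (intro map_add_fun[OF add_subgroup_relR]) (auto simp: A_add_right)
  have times: "Poly_Mapping.map ((*) b) z \<in> carr (FB (int m + 2))" if "z \<in> carr (FB (int m + 2))" for z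
    using that keys_map_subset[of "(*) b" z] by (auto simp: FB_carr_iff)
  note [simp] = graded_homD(2)[OF delta_mapsD(1)[OF assms(1)]]
  show ?case
    using add map_proj_FB[OF times] map_proj_FB by (simp add: map_times_add map_proj_add d0_add dd)
qed

text \<open>On b g both sides acquire the same extra term: delta(d(bg)) contains A(b, dd(dg)) by
  \<open>delta_map_times\<close>, and d delta(bg) contains d A(b, ddg) = A(b, d(ddg)).\<close>

lemma delta_dA:
  assumes "delta_maps \<delta>" "x \<in> carr (FB (int m + 3))"
  shows "\<delta> m (d\<^sub>A (Poly_Mapping.map proj x)) = d\<^sub>A (\<delta> (m + 1) (Poly_Mapping.map proj x))"
  using graded_group_B0 assms(2)
proof (induction rule: free_graded_induct)
  case (single g b)
  have g: "low g = m + 3" "low g = (m + 1) + 2"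
    using single(1) by (auto simp: gens_def)
  have Dg: "lift_gen ex g \<in> carr (FB (int m + 2))"
    using lift_gen_carr[of g] g(1) by (simp add: algebra_simps)
  have ddg: "Poly_Mapping.lookup (ddg ex g) h \<in> relR" for h
    using ddg_relR[of g] g(1) by simp
  have pos: "low h > 0" if "h \<in> Poly_Mapping.keys (ddg ex g)" for h
    using ddg_carr[of g] that g(1) unfolding FB_carr_iff by fastforce
  \<comment> \<open>By \<open>A_mult_right\<close>, A(b, -) commutes with multiplication from the
    right, that is, with d; its additivity is available because the entries of ddg lie in
    \<open>relR\<close>.\<close>
  have dA_A: "d\<^sub>A (Poly_Mapping.map (A (proj b)) (ddg ex g)) = Poly_Mapping.map (A (proj b)) (d0 (ddg ex g))"
    unfolding lift_d0_def
    by (rule map_lin_ext[symmetric, OF biadditive_times biadditive_times add_subgroup_relR])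
      (use pos ddg in \<open>auto simp: A_add_right A_0_right A_mult_right relR_mult(2) proj_lift_gen\<close>)
  have dA_times: "d\<^sub>A (Poly_Mapping.map ((*) a) f) = Poly_Mapping.map ((*) a) (d\<^sub>A f)" for a f
    by (rule map_lin_ext[symmetric, OF biadditive_times biadditive_times add_subgroup_UNIV])
      (auto simp: algebra_simps)
  have "d\<^sub>A (Poly_Mapping.map proj (Poly_Mapping.single g b)) =
      Poly_Mapping.map proj (Poly_Mapping.map ((*) b) (lift_gen ex g))"
    using map_proj_lift_gen[of g] g(1)
    by (intro poly_mapping_eqI)
      (simp add: map_single_0 lin_ext_single biadditive_times lookup_map_0 proj_mult proj_lift_gen)
  then have "\<delta> m (d\<^sub>A (Poly_Mapping.map proj (Poly_Mapping.single g b))) =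
      Poly_Mapping.map (A (proj b)) (d0 (ddg ex g)) + Poly_Mapping.map ((*) (proj b)) (\<delta> m (dA g))"
    using delta_map_times[OF assms(1) Dg] map_proj_lift_gen[of g] g(1) by (simp add: ddg_def)
  also have "\<dots> = d\<^sub>A (\<delta> (m + 1) (Poly_Mapping.single g (proj b)))"
    using delta_mapsD(2)[OF assms(1) g(2), of "proj b"] delta_mapsD(4)[OF assms(1) g(1)]
    by (simp add: lin_ext_add biadditive_times dA_A dA_times)
  finally show ?case
    by (simp add: map_single_0)
next
  case (add x y)
  have dA: "d\<^sub>A (Poly_Mapping.map proj z) \<in> carr (FA (int m + 2))" if "z \<in> carr (FB (int m + 3))" for z
  proof -
    have "d0 z \<in> carr (FB (int m + 2))"
      using graded_homD(1)[OF d0_hom, of "int m + 2" z] that by (simp add: add.commute)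
    moreover have "low g > 0" if "g \<in> Poly_Mapping.keys z" for g
      using \<open>z \<in> carr _\<close> that unfolding FB_carr_iff by fastforce
    ultimately show ?thesis
      using map_proj_FB[of "d0 z"] map_proj_d0[of z] by simp
  qed
  have "Poly_Mapping.map proj z \<in> carr (FA (int (m + 1) + 2))" if "z \<in> carr (FB (int m + 3))" for z
    using map_proj_FB[OF that] by (simp add: algebra_simps)
  then show ?case
    using add graded_homD(2)[OF delta_mapsD(1)[OF assms(1), of m]] dA
      graded_homD(2)[OF delta_mapsD(1)[OF assms(1), of "m + 1"]]
    by (simp add: map_proj_add lin_ext_add biadditive_times)
qed (simp add: delta_0[OF assms(1)])

text \<open>On b g the term b delta(g) vanishes because the augmentation is multiplicative, and A(b,
  ddg) vanishes by \<open>aug_A\<close>.\<close>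

lemma coeff_sum_delta:
  assumes "delta_maps \<delta>" "x \<in> carr (FB 2)"
  shows "coeff_sum aug_steen (\<delta> 0 (Poly_Mapping.map proj x)) = 0"
  using graded_group_B0 assms(2)
proof (induction rule: free_graded_induct)
  case (single g b)
  have g: "low g = 2" "low g = 0 + 2"
    using single(1) by (auto simp: gens_def)
  have "aug_steen (A (proj b) (Poly_Mapping.lookup (ddg ex g) h)) = 0" for h
    using g(1) by (intro aug_A ddg_relR aug_ddg) simp_all
  then have "coeff_sum aug_steen (Poly_Mapping.map (A (proj b)) (ddg ex g)) = 0"
    by (simp add: coeff_sum_def lookup_map_0[of "A _", OF A_0_right])
  moreover have "coeff_sum aug_steen (Poly_Mapping.map ((*) (proj b)) f) = aug_steen (proj b) * coeff_sum aug_steen f"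
    for f :: "'g \<Rightarrow>\<^sub>0 steenrod"
    by (rule coeff_sum_map[OF add_subgroup_UNIV distrib_left, symmetric]) (simp_all add: aug_steen_mult)
  ultimately show ?case
    using delta_mapsD(2)[OF assms(1) g(2), of "proj b"] delta_mapsD(3)[OF assms(1) g(1)]
    by (simp add: map_single_0 coeff_sum_add[of aug_steen, OF aug_steen_add])
next
  case (add x y)
  then show ?case
    using graded_homD(2)[OF delta_mapsD(1)[OF assms(1), of 0]] map_proj_FB
    by (simp add: map_proj_add coeff_sum_add[of aug_steen, OF aug_steen_add])
qed (simp add: delta_0[OF assms(1)])

lemma completion_maps_completion_of:
  assumes "delta_maps \<delta>"
  shows "completion_maps (completion_of \<delta>)"
proof -
  note \<delta> = delta_mapsD[OF assms]
  have eq: "completion_of \<delta> m x = pm_pair (d0 (d0 x)) (\<delta> m (Poly_Mapping.map proj x))"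
    if "x \<in> carr (FB (int m + 2))" for m x
    using that by (simp add: completion_of_def)
  have dd: "graded_hom (FB (int m + 2)) (FB (int m)) (\<lambda>x. d0 (d0 x))" for m
    using d0_hom[of "int m + 1"] d0_hom[of "int m"] by (simp add: graded_hom_def add.commute)
  have R: "Poly_Mapping.map proj (d0 (d0 x)) = 0" if "x \<in> carr (FB (int m + 2))" for m x
    by (rule map_proj_d0_d0) (rule low_ge_2[OF that])
  have lin: "completion_of \<delta> m (Poly_Mapping.map ((*) b) x) = Poly_Mapping.map (lmulB A b) (completion_of \<delta> m x)"
    if x: "x \<in> carr (FB (int m + 2))" for m b x
  proof -
    have times: "Poly_Mapping.map ((*) b) x \<in> carr (FB (int m + 2))"
      using x keys_map_subset[of "(*) b" x] by (auto simp: FB_carr_iff)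
    have lmulB: "lmulB A b (r, a) = (b * r, A (proj b) r + proj b * a)" for r a
      by (simp add: lmulB_def)
    then have 0: "lmulB A b 0 = 0"
      by (simp add: zero_prod_def A_0_right)
    show ?thesis
      unfolding eq[OF times] eq[OF x] delta_map_times[OF assms x] d0_map_times
      by (rule poly_mapping_eqI)
        (simp add: lookup_map_0[of "lmulB A b", OF 0] lookup_pm_pair lookup_map_0[of "(*) _"] lookup_add
          lookup_map_0[of "A _", OF A_0_right] lmulB)
  qed
  have "graded_hom (FB (int m + 2)) (FB1 (int m)) (completion_of \<delta> m)" for m
    unfolding graded_hom_def
  proof (intro conjI ballI allI)
    fix x
    assume x: "x \<in> carr (FB (int m + 2))"
    have "\<delta> m (Poly_Mapping.map proj x) \<in> carr (FA (int m))"
      using graded_homD(1)[OF \<delta>(1) map_proj_FB[OF x]] by (simp add: FS_carr_iff)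
    then show "completion_of \<delta> m x \<in> carr (FB1 (int m))"
      unfolding eq[OF x] by (intro pm_pair_FB1 graded_homD(1)[OF dd x] R[OF x])
    fix y
    assume y: "y \<in> carr (FB (int m + 2))"
    have "x + y \<in> carr (FB (int m + 2))"
      using x y add_subgroup_add[OF graded_group_carr[OF graded_group_FB]] by blast
    then show "completion_of \<delta> m (x + y) = completion_of \<delta> m x + completion_of \<delta> m y"
      using x y graded_homD(2)[OF \<delta>(1) map_proj_FB[OF x] map_proj_FB[OF y]]
      by (simp add: eq d0_add map_proj_add pm_prod_eqI map_fst_add map_snd_add)
  next
    fix n x
    assume x: "x \<in> piece (FB (int m + 2)) n"
    have x': "x \<in> carr (FB (int m + 2))"
      by (rule graded_group_piece_carr[OF graded_group_FB x])
    have "Poly_Mapping.map proj x \<in> piece (FA (int m + 2)) n"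
      using x keys_map_subset[of proj x] by (auto simp: free_graded_piece_iff lookup_map_0 proj_piece)
    then have "\<delta> m (Poly_Mapping.map proj x) \<in> piece (FS (int m)) n"
      by (rule graded_homD(3)[OF \<delta>(1)])
    moreover have "d0 (d0 x) \<in> piece (FB (int m)) n"
      by (rule graded_homD(3)[OF dd x])
    moreover have "Poly_Mapping.lookup (d0 (d0 x)) g \<in> relR" for g
      using R[OF x'] map_proj_eq_0_iff by metis
    ultimately show "completion_of \<delta> m x \<in> piece (FB1 (int m)) n"
      unfolding eq[OF x']
      by (simp add: free_graded_piece_iff FS_def keys_pm_pair lookup_pm_pair B1_graded_def gprod_piece
          R_graded_def)
  qed
  moreover have "d1 (d1 y) = completion_of \<delta> m (Poly_Mapping.map fst y)"
    if y: "y \<in> carr (FB1 (int m + 2))" for m y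
  proof -
    \<comment> \<open>On the other side the second component is delta(0), since the boundary of y
      lies in R<g> and projects to 0.\<close>
    have "Poly_Mapping.map snd (d1 (d1 y)) = 0"
      using y by (intro map_snd_d1_d1) (fastforce simp: FB1_carr_iff)
    then show ?thesis
      using eq[OF map_fst_FB1[OF y]] map_proj_map_fst[OF y]
      by (intro pm_prod_eqI) (simp_all add: map_fst_d1 delta_0[OF assms])
  qed
  moreover have "completion_of \<delta> m (d0 x) = d1 (completion_of \<delta> (m + 1) x)"
    if x: "x \<in> carr (FB (int m + 3))" for m x
  proof -
    have x': "x \<in> carr (FB (int (m + 1) + 2))"
      using x by (simp add: algebra_simps)
    have d0x: "d0 x \<in> carr (FB (int m + 2))"
      using graded_homD(1)[OF d0_hom, of "int m + 2" x] x by (simp add: add.commute)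
    have pos: "low g > 0" if "g \<in> Poly_Mapping.keys x" for g
      using x that unfolding FB_carr_iff by fastforce
    have mem: "\<delta> (m + 1) (Poly_Mapping.map proj x) \<in> carr (FA (int (m + 1)))"
      using graded_homD(1)[OF \<delta>(1) map_proj_FB[OF x']] unfolding FS_carr_iff .
    have ddx: "d0 (d0 x) \<in> carr (FB (int (m + 1)))"
      by (rule graded_homD(1)[OF dd x'])
    have pos': "low g > 0"
      if "g \<in> Poly_Mapping.keys (pm_pair (d0 (d0 x)) (\<delta> (m + 1) (Poly_Mapping.map proj x)))" for g
      using that mem ddx unfolding keys_pm_pair FB_carr_iff FA_carr_iff by fastforce
    show ?thesis
      unfolding eq[OF x'] eq[OF d0x]
      by (rule pm_prod_eqI)
        (simp_all add: map_fst_d1 map_snd_d1 pos' map_proj_d0 pos delta_dA[OF assms x])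
  qed
  moreover have "coeff_sum eps1 (completion_of \<delta> 0 x) = 0" if x: "x \<in> carr (FB 2)" for x
  proof -
    have "d0 x \<in> carr (FB 1)"
      using graded_homD(1)[OF d0_hom, of 1 x] x by simp
    then show ?thesis
      using eq[of x 0] x
      by (simp add: coeff_sum_eps1 coeff_sum_aug_d0 coeff_sum_delta[OF assms] zero_prod_def)
  qed
  ultimately show ?thesis
    unfolding completion_maps_def using lin eq by simp
qed

section \<open>The bijection\<close>

lemma bij_betw_delta_of:
  "bij_betw delta_of (completions A low deg ex) (delta_families A low deg dA ex)"
proof (rule bij_betw_byWitness[where f' = completion_of])
  show "delta_of ` completions A low deg ex \<subseteq> delta_families A low deg dA ex"
    unfolding completions_eq delta_families_eq
    using delta_maps_delta_of by (auto simp: delta_of_def)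
  show "completion_of ` delta_families A low deg dA ex \<subseteq> completions A low deg ex"
    unfolding completions_eq delta_families_eq
    using completion_maps_completion_of by (auto simp: completion_of_def)
  show "\<forall>H\<in>completions A low deg ex. completion_of (delta_of H) = H"
  proof (intro ballI ext)
    fix H m x
    assume "H \<in> completions A low deg ex"
    then have H: "H m \<in> extensional (carr (FB (int m + 2)))" "completion_maps H"
      by (auto simp: completions_eq)
    show "completion_of (delta_of H) m x = H m x"
    proof (cases "x \<in> carr (FB (int m + 2))")
      case True
      \<comment> \<open>The first component of H is forced to be ddx, and the second is recovered
        from its value on the projection of x.\<close>
      then show ?thesis
        using completion_mapsD(3)[OF H(2) True] delta_of_map_proj[OF H(2) True]
        by (intro pm_prod_eqI) (simp_all add: completion_of_def)
    next
      case False
      then show ?thesis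
        using extensional_arb[OF H(1)] by (simp add: completion_of_def)
    qed
  qed
  show "\<forall>\<delta>\<in>delta_families A low deg dA ex. delta_of (completion_of \<delta>) = \<delta>"
  proof (intro ballI ext)
    fix \<delta> m f
    assume "\<delta> \<in> delta_families A low deg dA ex"
    then have \<delta>: "\<delta> m \<in> extensional (carr (FA (int m + 2)))" "delta_maps \<delta>"
      by (auto simp: delta_families_eq)
    show "delta_of (completion_of \<delta>) m f = \<delta> m f"
    proof (cases "f \<in> carr (FA (int m + 2))")
      case True
      then show ?thesis
        using lift[OF True] by (simp add: delta_of_def completion_of_def)
    next
      case False
      then show ?thesis
        using extensional_arb[OF \<delta>(1)] by (simp add: delta_of_def)
    qed
  qed
qed

end

theorem theorem8p6:
  fixes A :: "steenrod \<Rightarrow> B0 \<Rightarrow> steenrod"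
    and low deg :: "'g \<Rightarrow> nat"
    and dA :: "'g \<Rightarrow> 'g \<Rightarrow>\<^sub>0 steenrod"
    and ex :: "'g \<Rightarrow> 'g \<Rightarrow>\<^sub>0 free2"
  assumes "pair_algebra (secB A)"
    and "minimal_resolution low deg dA"
    and "literal_expression low deg dA ex"
  shows "\<exists>\<Phi>. bij_betw \<Phi> (completions A low deg ex) (delta_families A low deg dA ex) \<and>
           (\<forall>H\<in>completions A low deg ex. \<forall>m. \<forall>x\<in>carr (free_B0 low deg (m + 2)).
              \<Phi> H m (Poly_Mapping.map proj x) = Poly_Mapping.map snd (H m x))"
proof -
  interpret lifted_resolution A low deg dA ex
    by unfold_locales (fact assms)+
  have "delta_of H m (Poly_Mapping.map proj x) = Poly_Mapping.map snd (H m x)"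
    if "H \<in> completions A low deg ex" "x \<in> carr (free_B0 low deg (m + 2))" for H m x
    using that by (intro delta_of_map_proj) (simp_all add: completions_eq add.commute)
  then show ?thesis
    using bij_betw_delta_of by blast
qed

end
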